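(* Let $Q_1,Q_2$ be quantum circuits implementing channels from $\mathcal{H}$ to $\mathcal{K}$, written in Stinespring form with a common ancillary register $\mathcal{A}$ of $m$ qubits and common discarded register $\mathcal{B}$, and let $C_i$ be the mixed-unitary circuit constructed from $Q_i$ as below. For any $\epsilon>0$, if the ancillary register of both circuits is enlarged by $O(\log(1/\epsilon))$ additional (unused) qubits before the construction, then $\|Q_1-Q_2\|_\diamond\le\|C_1-C_2\|_\diamond\le\|Q_1-Q_2\|_\diamond+\epsilon$.
   Context: A circuit $Q$ in Stinespring form implements $Q(\rho)=\operatorname{tr}_{\mathcal{B}}U(|0\rangle\langle0|_{\mathcal{A}}\otimes\rho)U^*$ where $U$ is a unitary circuit from $\mathcal{A}\otimes\mathcal{H}$ to $\mathcal{K}\otimes\mathcal{B}$. The constructed circuit is $C(\rho)=N_{\mathcal{B}}(U[(M\circ D_{\mathcal{A}})(\rho)]U^* )$, a channel from $\mathcal{A}\otimes\mathcal{H}$ to $\mathcal{K}\otimes\mathcal{B}$, where: $D_{\mathcal{A}}$ applies the Pauli $Z$ gate independently with probability $1/2$ to each qubit of $\mathcal{A}$; $N_{\mathcal{B}}$ applies to each qubit of $\mathcal{B}$ independently the gate $Z$ with probability $1/2$ followed by $X$ with probability $1/2$ (completely depolarizing channel); a controlled-$N$ gate applies controlled-$Z$ with probability $1/2$ then controlled-$X$ with probability $1/2$ from a control qubit to a target qubit; and $M$ consists of $m$ stages, stage $j$ consisting of controlled-$N$ gates with control the $j$-th qubit of $\mathcal{A}$ and target each other qubit of $\mathcal{A}\otimes\mathcal{H}$,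 followed by controlled-$N$ gates with target the $j$-th qubit of $\mathcal{A}$ and control each other qubit of $\mathcal{A}$. Diamond norm: $\|\Phi\|_\diamond=\max_{X\neq0}\|(\Phi\otimes\mathrm{id}_{L(\mathcal{X})})(X)\|_1/\|X\|_1$ for $\Phi:L(\mathcal{X})\to L(\mathcal{Y})$; a difference of channels with different input/output spaces is compared via identifying $\mathcal{A}\otimes\mathcal{H}$ inputs, as both $C_i$ share the same spaces and both $Q_i$ share the same spaces. *)

theory Defs
  imports Complex_Main "Jordan_Normal_Form.Matrix"
begin

text \<open>Operators on a register of N qubits are complex 2^N x 2^N matrices.
  Qubit q (0 = first tensor factor) of basis index i is the bit of weight 2^(N-1-q).\<close>

definition adj :: "complex mat \<Rightarrow> complex mat" where
  "adj A = mat (dim_col A) (dim_row A) (\<lambda>(i,j). cnj (A $$ (j,i)))"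

definition mtrace :: "complex mat \<Rightarrow> complex" where
  "mtrace A = (\<Sum>i<dim_row A. A $$ (i,i))"

definition is_unitary :: "nat \<Rightarrow> complex mat \<Rightarrow> bool" where
  "is_unitary d U \<longleftrightarrow> U \<in> carrier_mat d d \<and> adj U * U = 1\<^sub>m d"

definition psd :: "complex mat \<Rightarrow> bool" where
  "psd R \<longleftrightarrow> R \<in> carrier_mat (dim_row R) (dim_row R) \<and> adj R = R \<and>
     (\<forall>v \<in> carrier_vec (dim_row R). Re (conjugate v \<bullet> (R *\<^sub>v v)) \<ge> 0)"

definition trace_norm :: "complex mat \<Rightarrow> real" where
  "trace_norm X = Re (mtrace (THE R. R \<in> carrier_mat (dim_col X) (dim_col X) \<and> psd R \<and> R * R = adj X * X))"

definition kron :: "complex mat \<Rightarrow> complex mat \<Rightarrow> complex mat" where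
  "kron A B = mat (dim_row A * dim_row B) (dim_col A * dim_col B)
     (\<lambda>(i,j). A $$ (i div dim_row B, j div dim_col B) * B $$ (i mod dim_row B, j mod dim_col B))"

definition proj0 :: "nat \<Rightarrow> complex mat" where
  "proj0 d = mat d d (\<lambda>(i,j). if i = 0 \<and> j = 0 then 1 else 0)"

definition ptrace :: "nat \<Rightarrow> nat \<Rightarrow> complex mat \<Rightarrow> complex mat" where
  "ptrace dK dB X = mat dK dK (\<lambda>(i,j). \<Sum>l<dB. X $$ (i * dB + l, j * dB + l))"

text \<open>(Phi tensor id_{L(X)}) applied to X on (input) tensor (ancilla), ancilla dimension = din,
  index convention (p, k) \<mapsto> p * din + k.\<close>
definition tensor_id :: "nat \<Rightarrow> (complex mat \<Rightarrow> complex mat) \<Rightarrow> complex mat \<Rightarrow> complex mat" where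
  "tensor_id din \<Phi> X = (let dout = dim_row (\<Phi> (0\<^sub>m din din)) in
     mat (dout * din) (dout * din)
       (\<lambda>(i,j). \<Phi> (mat din din (\<lambda>(p,q). X $$ (p * din + i mod din, q * din + j mod din)))
                   $$ (i div din, j div din)))"

definition diamond_norm :: "nat \<Rightarrow> (complex mat \<Rightarrow> complex mat) \<Rightarrow> real" where
  "diamond_norm din \<Phi> = Sup {trace_norm (tensor_id din \<Phi> X) / trace_norm X | X.
      X \<in> carrier_mat (din * din) (din * din) \<and> X \<noteq> 0\<^sub>m (din * din) (din * din)}"

definition qbit :: "nat \<Rightarrow> nat \<Rightarrow> nat \<Rightarrow> bool" where
  "qbit N q i \<longleftrightarrow> (i div 2 ^ (N - 1 - q)) mod 2 = 1"

definition qflip :: "nat \<Rightarrow> nat \<Rightarrow> nat \<Rightarrow> nat" where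
  "qflip N q i = (if qbit N q i then i - 2 ^ (N - 1 - q) else i + 2 ^ (N - 1 - q))"

definition Zgate :: "nat \<Rightarrow> nat \<Rightarrow> complex mat" where
  "Zgate N q = mat (2^N) (2^N) (\<lambda>(i,j). if i = j then (if qbit N q i then -1 else 1) else 0)"

definition Xgate :: "nat \<Rightarrow> nat \<Rightarrow> complex mat" where
  "Xgate N q = mat (2^N) (2^N) (\<lambda>(i,j). if i = qflip N q j then 1 else 0)"

definition CZgate :: "nat \<Rightarrow> nat \<Rightarrow> nat \<Rightarrow> complex mat" where
  "CZgate N c t = mat (2^N) (2^N)
     (\<lambda>(i,j). if i = j then (if qbit N c i \<and> qbit N t i then -1 else 1) else 0)"

definition CXgate :: "nat \<Rightarrow> nat \<Rightarrow> nat \<Rightarrow> complex mat" where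
  "CXgate N c t = mat (2^N) (2^N)
     (\<lambda>(i,j). if i = (if qbit N c j then qflip N t j else j) then 1 else 0)"

definition conj_by :: "complex mat \<Rightarrow> complex mat \<Rightarrow> complex mat" where
  "conj_by U \<rho> = U * \<rho> * adj U"

definition half_apply :: "complex mat \<Rightarrow> complex mat \<Rightarrow> complex mat" where
  "half_apply U \<rho> = (1/2 :: complex) \<cdot>\<^sub>m (\<rho> + conj_by U \<rho>)"

definition seq :: "('a \<Rightarrow> 'a) list \<Rightarrow> 'a \<Rightarrow> 'a" where
  "seq fs x = fold (\<lambda>g y. g y) fs x"

text \<open>Z w.p. 1/2 followed by X w.p. 1/2 on qubit q (completely depolarizing).\<close>
definition Nchan :: "nat \<Rightarrow> nat \<Rightarrow> complex mat \<Rightarrow> complex mat" where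
  "Nchan N q = half_apply (Xgate N q) \<circ> half_apply (Zgate N q)"

definition ctrlN :: "nat \<Rightarrow> nat \<Rightarrow> nat \<Rightarrow> complex mat \<Rightarrow> complex mat" where
  "ctrlN N c t = half_apply (CXgate N c t) \<circ> half_apply (CZgate N c t)"

definition D_A :: "nat \<Rightarrow> nat \<Rightarrow> complex mat \<Rightarrow> complex mat" where
  "D_A m N = seq (map (\<lambda>q. half_apply (Zgate N q)) [0..<m])"

definition N_B :: "nat \<Rightarrow> nat \<Rightarrow> complex mat \<Rightarrow> complex mat" where
  "N_B nK N = seq (map (Nchan N) [nK..<N])"

definition M_stage :: "nat \<Rightarrow> nat \<Rightarrow> nat \<Rightarrow> (complex mat \<Rightarrow> complex mat) list" where
  "M_stage m N j = map (\<lambda>t. ctrlN N j t) (filter (\<lambda>t. t \<noteq> j) [0..<N])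
                 @ map (\<lambda>c. ctrlN N c j) (filter (\<lambda>c. c \<noteq> j) [0..<m])"

definition M_chan :: "nat \<Rightarrow> nat \<Rightarrow> complex mat \<Rightarrow> complex mat" where
  "M_chan m N = seq (concat (map (M_stage m N) [0..<m]))"

text \<open>Stinespring circuit: A = m qubits, H = n qubits, output K \<otimes> B with B = b qubits.\<close>
definition Qchan :: "nat \<Rightarrow> nat \<Rightarrow> nat \<Rightarrow> complex mat \<Rightarrow> complex mat \<Rightarrow> complex mat" where
  "Qchan m n b U \<rho> = ptrace (2 ^ (m + n - b)) (2 ^ b) (conj_by U (kron (proj0 (2 ^ m)) \<rho>))"

definition Cchan :: "nat \<Rightarrow> nat \<Rightarrow> nat \<Rightarrow> complex mat \<Rightarrow> complex mat \<Rightarrow> complex mat" where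
  "Cchan m n b U \<rho> = N_B (m + n - b) (m + n) (conj_by U (M_chan m (m + n) (D_A m (m + n) \<rho>)))"

text \<open>Enlarge the ancilla by k unused qubits E: A' = A \<otimes> E, new unitary U \<otimes> id_E
  from A \<otimes> E \<otimes> H to K \<otimes> B \<otimes> E (so E becomes part of the discarded register).\<close>
definition enlarge :: "nat \<Rightarrow> nat \<Rightarrow> complex mat \<Rightarrow> complex mat" where
  "enlarge n k U = mat (dim_row U * 2 ^ k) (dim_col U * 2 ^ k)
     (\<lambda>(i,j). if i mod 2 ^ k = (j div 2 ^ n) mod 2 ^ k
              then U $$ (i div 2 ^ k, (j div 2 ^ n) div 2 ^ k * 2 ^ n + j mod 2 ^ n) else 0)"

end

theory Submission
  imports Defs "Jordan_Normal_Form.Spectral_Radius" "HOL-Analysis.L2_Norm"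
begin

text \<open>After \<open>D\<^sub>A\<close> the input is a sum of blocks \<open>|a><a|\<close> tensored with operators on H and the
  reference. The block \<open>a = 0\<close> is untouched by M, and there the circuit acts as Q followed by a maximally mixed
  state on B. If \<open>a \<noteq> 0\<close>, then at some stage a set control depolarises all other qubits, and
  the second half of the stage leaves a state within trace distance \<open>2 / 2^m\<close> of the maximally mixed one; the
  remaining stages are unital contractions and preserve this. Maximally mixed states are fixed by conjugation with
  both unitaries and cancel in the difference, so \<open>C1 - C2\<close> is, up to \<open>4 / 2^m\<close>, the channel
  difference \<open>Q1 - Q2\<close> on the block \<open>a = 0\<close>. Feeding in only that block gives the lower bound; for the
  upper bound the larger reference is reduced to the dimension of H by Schmidt decomposition.\<close>

section \<open>Contractions and the trace norm by duality\<close>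

text \<open>The constant comes from the second half of a stage. Depolarising all but a set qubit
  \<open>j\<close> leaves \<open>j\<close> in state 1 and the rest maximally mixed; the second half
  then randomises \<open>j\<close> unless the other \<open>m - 1\<close> ancillas are all 0, an
  event of weight \<open>2 / 2^m\<close>. This is the whole deviation. Adding worst-case errors over
  the \<open>2^m - 1\<close> nonzero blocks would destroy the gain; pinching bounds the sum of the
  block norms by the norm of the input, so the error is paid once per circuit.

  \<open>trace_norm\<close> is a definite description of a positive square root and is hard to
  estimate directly. Its dual form, a supremum over contractions, makes the triangle inequality,
  compression and pinching elementary; a singular value decomposition shows that the two agree.

  \<open>diamond_norm\<close> is a real supremum, informative only for nonempty bounded sets, hence
  an a priori bound. It also ties the reference to the input dimension, \<open>2^n\<close> for the Q
  difference but \<open>2^(m+n)\<close> for the C difference; this mismatch forces the reduction of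
  the reference.\<close>

type_synonym 'i mx = "'i \<Rightarrow> 'i \<Rightarrow> complex"

abbreviation qmats :: "nat \<Rightarrow> complex mat set" where
  "qmats N \<equiv> carrier_mat (2 ^ N) (2 ^ N)"

abbreviation (input) Qdiff :: "nat \<Rightarrow> nat \<Rightarrow> nat \<Rightarrow> complex mat \<Rightarrow> complex mat \<Rightarrow> complex mat \<Rightarrow> complex mat" where
  "Qdiff m n b U1 U2 \<equiv> (\<lambda>\<rho>. Qchan m n b U1 \<rho> - Qchan m n b U2 \<rho>)"

abbreviation (input) Cdiff :: "nat \<Rightarrow> nat \<Rightarrow> nat \<Rightarrow> complex mat \<Rightarrow> complex mat \<Rightarrow> complex mat \<Rightarrow> complex mat" where
  "Cdiff m n b U1 U2 \<equiv> (\<lambda>\<rho>. Cchan m n b U1 \<rho> - Cchan m n b U2 \<rho>)"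

text \<open>Operator norm at most 1, stated for rectangular matrices so that isometries,
  compressions and normalised singular vectors are all instances.\<close>

definition contr :: "'i set \<Rightarrow> 'j set \<Rightarrow> ('i \<Rightarrow> 'j \<Rightarrow> complex) \<Rightarrow> bool" where
  "contr I J W \<longleftrightarrow>
     (\<forall>v. (\<Sum>i\<in>I. (cmod (\<Sum>j\<in>J. W i j * v j))\<^sup>2) \<le> (\<Sum>j\<in>J. (cmod (v j))\<^sup>2))"

text \<open>The trace norm in its dual form, for matrices indexed by an arbitrary finite set; product and
  power set indices replace the digit arithmetic of Kronecker products.\<close>
definition tn :: "'i set \<Rightarrow> 'i mx \<Rightarrow> real" where
  "tn I X = Sup {cmod (\<Sum>i\<in>I. \<Sum>j\<in>I. W i j * X j i) | W. contr I I W}"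

lemma Cauchy_Schwarz_sum:
  fixes f g :: "'i \<Rightarrow> complex"
  shows "(cmod (\<Sum>i\<in>I. f i * g i))\<^sup>2 \<le> (\<Sum>i\<in>I. (cmod (f i))\<^sup>2) * (\<Sum>i\<in>I. (cmod (g i))\<^sup>2)"
proof -
  have "cmod (\<Sum>i\<in>I. f i * g i) \<le> (\<Sum>i\<in>I. \<bar>cmod (f i)\<bar> * \<bar>cmod (g i)\<bar>)"
    by (rule order_trans[OF norm_sum]) (simp add: norm_mult)
  also have "\<dots> \<le> L2_set (\<lambda>i. cmod (f i)) I * L2_set (\<lambda>i. cmod (g i)) I"
    by (rule L2_set_mult_ineq)
  finally have "(cmod (\<Sum>i\<in>I. f i * g i))\<^sup>2
      \<le> (L2_set (\<lambda>i. cmod (f i)) I * L2_set (\<lambda>i. cmod (g i)) I)\<^sup>2"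
    by (intro power_mono) auto
  also have "\<dots> = (\<Sum>i\<in>I. (cmod (f i))\<^sup>2) * (\<Sum>i\<in>I. (cmod (g i))\<^sup>2)"
    by (simp add: L2_set_def power_mult_distrib sum_nonneg)
  finally show ?thesis .
qed

lemma sum_swap3:
  "(\<Sum>i\<in>A. \<Sum>j\<in>B. \<Sum>k\<in>C. f i j k) = (\<Sum>k\<in>C. \<Sum>i\<in>A. \<Sum>j\<in>B. f i j k)"
proof -
  have "(\<Sum>i\<in>A. \<Sum>j\<in>B. \<Sum>k\<in>C. f i j k) = (\<Sum>i\<in>A. \<Sum>k\<in>C. \<Sum>j\<in>B. f i j k)"
    by (rule sum.cong[OF refl], rule sum.swap)
  also have "\<dots> = (\<Sum>k\<in>C. \<Sum>i\<in>A. \<Sum>j\<in>B. f i j k)" by (rule sum.swap)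
  finally show ?thesis .
qed

lemma sum_swap4:
  "(\<Sum>i\<in>A. \<Sum>j\<in>B. \<Sum>k\<in>C. \<Sum>l\<in>D. f i j k l) = (\<Sum>l\<in>D. \<Sum>k\<in>C. \<Sum>i\<in>A. \<Sum>j\<in>B. f i j k l)"
proof -
  have "(\<Sum>i\<in>A. \<Sum>j\<in>B. \<Sum>k\<in>C. \<Sum>l\<in>D. f i j k l) = (\<Sum>i\<in>A. \<Sum>l\<in>D. \<Sum>j\<in>B. \<Sum>k\<in>C. f i j k l)"
    by (rule sum.cong[OF refl], rule sum_swap3)
  also have "\<dots> = (\<Sum>l\<in>D. \<Sum>i\<in>A. \<Sum>j\<in>B. \<Sum>k\<in>C. f i j k l)" by (rule sum.swap)
  also have "\<dots> = (\<Sum>l\<in>D. \<Sum>k\<in>C. \<Sum>i\<in>A. \<Sum>j\<in>B. f i j k l)"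
    by (rule sum.cong[OF refl], rule sum_swap3)
  finally show ?thesis .
qed

lemma contrD:
  "contr I J W \<Longrightarrow> (\<Sum>i\<in>I. (cmod (\<Sum>j\<in>J. W i j * v j))\<^sup>2) \<le> (\<Sum>j\<in>J. (cmod (v j))\<^sup>2)"
  by (simp add: contr_def)

lemma contr_comp:
  assumes "contr I J V" "contr J K W"
  shows "contr I K (\<lambda>i k. \<Sum>j\<in>J. V i j * W j k)"
  unfolding contr_def
proof
  fix v :: "'c \<Rightarrow> complex"
  have "(\<Sum>k\<in>K. (\<Sum>j\<in>J. V i j * W j k) * v k) = (\<Sum>j\<in>J. V i j * (\<Sum>k\<in>K. W j k * v k))" for i
    by (simp add: sum_distrib_right sum_distrib_left mult.assoc) (rule sum.swap)
  thus "(\<Sum>i\<in>I. (cmod (\<Sum>k\<in>K. (\<Sum>j\<in>J. V i j * W j k) * v k))\<^sup>2) \<le> (\<Sum>j\<in>K. (cmod (v j))\<^sup>2)"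
    using order_trans[OF contrD[OF assms(1)] contrD[OF assms(2)]] by simp
qed

lemma contr_cnj:
  assumes "contr I J W"
  shows "contr I J (\<lambda>i j. cnj (W i j))"
  unfolding contr_def
proof
  fix v :: "'b \<Rightarrow> complex"
  have "cmod (\<Sum>j\<in>J. cnj (W i j) * v j) = cmod (\<Sum>j\<in>J. W i j * cnj (v j))" for i
    by (subst complex_mod_cnj[symmetric]) simp
  thus "(\<Sum>i\<in>I. (cmod (\<Sum>j\<in>J. cnj (W i j) * v j))\<^sup>2) \<le> (\<Sum>j\<in>J. (cmod (v j))\<^sup>2)"
    using contrD[OF assms, of "\<lambda>j. cnj (v j)"] by simp
qed

text \<open>With \<open>y\<close> the transpose applied to \<open>v\<close>, the squared norm
  \<open>A\<close> of \<open>y\<close> is the pairing of \<open>v\<close> with \<open>W\<close>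
  applied to \<open>cnj y\<close>. Cauchy-Schwarz and contractivity of \<open>W\<close> bound the
  square of \<open>A\<close> by \<open>B * A\<close>, and one factor cancels.\<close>

lemma contr_transpose:
  assumes "contr I J W"
  shows "contr J I (\<lambda>j i. W i j)"
  unfolding contr_def
proof
  fix v :: "'a \<Rightarrow> complex"
  define y where "y j = (\<Sum>i\<in>I. W i j * v i)" for j
  define A where "A = (\<Sum>j\<in>J. (cmod (y j))\<^sup>2)"
  define B where "B = (\<Sum>i\<in>I. (cmod (v i))\<^sup>2)"
  have A0: "A \<ge> 0" "B \<ge> 0" by (auto simp: A_def B_def sum_nonneg)
  have "of_real A = (\<Sum>j\<in>J. cnj (y j) * y j)"
    by (simp add: A_def complex_norm_square mult.commute del: of_real_power)
  also have "\<dots> = (\<Sum>i\<in>I. v i * (\<Sum>j\<in>J. W i j * cnj (y j)))"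
    unfolding y_def by (simp add: sum_distrib_left sum_distrib_right, subst sum.swap) (simp add: mult_ac)
  finally have "A = cmod (\<Sum>i\<in>I. v i * (\<Sum>j\<in>J. W i j * cnj (y j)))"
    using A0 by (metis abs_of_nonneg norm_of_real)
  hence "A\<^sup>2 \<le> B * (\<Sum>i\<in>I. (cmod (\<Sum>j\<in>J. W i j * cnj (y j)))\<^sup>2)"
    unfolding B_def using Cauchy_Schwarz_sum by simp
  also have "\<dots> \<le> B * A"
    using contrD[OF assms, of "\<lambda>j. cnj (y j)"] A0 by (intro mult_left_mono) (simp_all add: A_def)
  finally have "A \<le> B" using A0 by (cases "A = 0") (auto simp: power2_eq_square)
  thus "(\<Sum>j\<in>J. (cmod (\<Sum>i\<in>I. W i j * v i))\<^sup>2) \<le> (\<Sum>i\<in>I. (cmod (v i))\<^sup>2)"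
    by (simp add: A_def B_def y_def)
qed

lemma contr_entry:
  assumes "contr I J W" "finite I" "finite J" "i \<in> I" "j \<in> J"
  shows "cmod (W i j) \<le> 1"
proof -
  have "(\<Sum>k\<in>J. W r k * (if k = j then 1 else 0)) = W r j" for r
    using assms by (subst sum.remove[of J j]) (auto intro!: sum.neutral)
  moreover have "(\<Sum>k\<in>J. (cmod (if k = j then 1 else 0))\<^sup>2) = 1"
    using assms by (subst sum.remove[of J j]) (auto intro!: sum.neutral)
  ultimately have "(\<Sum>r\<in>I. (cmod (W r j))\<^sup>2) \<le> 1"
    using contrD[OF assms(1), of "\<lambda>k. if k = j then 1 else 0"] by simp
  moreover have "(cmod (W i j))\<^sup>2 \<le> (\<Sum>r\<in>I. (cmod (W r j))\<^sup>2)"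
    using assms by (intro member_le_sum) auto
  ultimately have "(cmod (W i j))\<^sup>2 \<le> 1\<^sup>2" by simp
  thus ?thesis by (rule power2_le_imp_le) simp
qed

text \<open>A zero-one matrix with a single 1 per column, in distinct rows, is an isometry; its
  transpose later serves as the compression to the image of \<open>f\<close>.\<close>

lemma contr_inj:
  assumes "finite I" "finite J" "inj_on f J" "f ` J \<subseteq> I"
  shows "contr I J (\<lambda>i j. if i = f j then 1 else 0)"
  unfolding contr_def
proof
  fix v :: "'b \<Rightarrow> complex"
  let ?y = "\<lambda>i. (\<Sum>j\<in>J. (if i = f j then 1 else 0) * v j)"
  have y: "?y (f j) = v j" if "j \<in> J" for j
    using assms that by (subst sum.remove[of J j]) (auto intro!: sum.neutral simp: inj_on_def split: if_splits)
  have "(\<Sum>i\<in>I. (cmod (?y i))\<^sup>2) = (\<Sum>i\<in>f ` J. (cmod (?y i))\<^sup>2)"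
    using assms by (intro sum.mono_neutral_right) (auto intro!: sum.neutral)
  also have "\<dots> = (\<Sum>j\<in>J. (cmod (v j))\<^sup>2)"
    using assms y by (simp add: sum.reindex)
  finally show "(\<Sum>i\<in>I. (cmod (?y i))\<^sup>2) \<le> (\<Sum>j\<in>J. (cmod (v j))\<^sup>2)" by simp
qed

lemma contr_zero: "contr I J (\<lambda>i j. 0)"
  by (simp add: contr_def sum_nonneg)

lemma contr_scale:
  assumes "contr I J W" "\<And>i. i \<in> I \<Longrightarrow> cmod (c i) \<le> 1"
  shows "contr I J (\<lambda>i j. c i * W i j)"
  unfolding contr_def
proof
  fix v :: "'b \<Rightarrow> complex"
  have "(\<Sum>i\<in>I. (cmod (\<Sum>j\<in>J. c i * W i j * v j))\<^sup>2) = (\<Sum>i\<in>I. (cmod (c i) * cmod (\<Sum>j\<in>J. W i j * v j))\<^sup>2)"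
    by (simp add: mult.assoc norm_mult flip: sum_distrib_left)
  also have "\<dots> \<le> (\<Sum>i\<in>I. (cmod (\<Sum>j\<in>J. W i j * v j))\<^sup>2)"
    using assms(2) by (intro sum_mono power_mono) (auto intro: mult_left_le_one_le)
  also have "\<dots> \<le> (\<Sum>j\<in>J. (cmod (v j))\<^sup>2)" by (rule contrD[OF assms(1)])
  finally show "(\<Sum>i\<in>I. (cmod (\<Sum>j\<in>J. c i * W i j * v j))\<^sup>2) \<le> (\<Sum>j\<in>J. (cmod (v j))\<^sup>2)" .
qed

lemma contr_tensor_right:
  assumes "contr I J V" "finite I" "finite J" "finite K"
  shows "contr (K \<times> I) (K \<times> J) (\<lambda>a b. if fst a = fst b then V (snd a) (snd b) else 0)"
  unfolding contr_def
proof
  fix v :: "'c \<times> 'b \<Rightarrow> complex"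
  let ?lhs = "\<Sum>a\<in>K\<times>I. (cmod (\<Sum>b\<in>K\<times>J. (if fst a = fst b then V (snd a) (snd b) else 0) * v b))\<^sup>2"
  have y: "(\<Sum>b\<in>K\<times>J. (if fst (k, i) = fst b then V (snd (k, i)) (snd b) else 0) * v b)
      = (\<Sum>j\<in>J. V i j * v (k, j))" if "k \<in> K" for i k
  proof -
    have "(\<Sum>b\<in>K\<times>J. (if fst (k, i) = fst b then V (snd (k, i)) (snd b) else 0) * v b)
       = (\<Sum>l\<in>K. if l = k then (\<Sum>j\<in>J. V i j * v (k, j)) else 0)"
      by (auto intro!: sum.cong simp: sum.cartesian_product' split: prod.split)
    thus ?thesis using assms that by simp
  qed
  have "?lhs
    = (\<Sum>k\<in>K. \<Sum>i\<in>I. (cmod (\<Sum>j\<in>J. V i j * v (k, j)))\<^sup>2)"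
    by (subst sum.cartesian_product) (auto intro!: sum.cong simp: y[simplified])
  also have "\<dots> \<le> (\<Sum>k\<in>K. \<Sum>j\<in>J. (cmod (v (k, j)))\<^sup>2)"
    by (intro sum_mono contrD assms)
  also have "\<dots> = (\<Sum>b\<in>K\<times>J. (cmod (v b))\<^sup>2)"
    by (subst sum.cartesian_product) (auto intro!: sum.cong)
  finally show "?lhs
    \<le> (\<Sum>b\<in>K\<times>J. (cmod (v b))\<^sup>2)" .
qed

text \<open>The Gram matrix of the columns is diagonal with entries at most 1. Columns may be short
  or zero, which is what normalising a rank-deficient decomposition produces.\<close>

lemma contr_orthogonal_columns:
  assumes "finite I" "finite J"
    and orth: "\<And>i j. i \<in> J \<Longrightarrow> j \<in> J \<Longrightarrow> i \<noteq> j \<Longrightarrow> (\<Sum>r\<in>I. W r i * cnj (W r j)) = 0"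
    and le: "\<And>j. j \<in> J \<Longrightarrow> (\<Sum>r\<in>I. (cmod (W r j))\<^sup>2) \<le> 1"
  shows "contr I J W"
  unfolding contr_def
proof
  fix v :: "'b \<Rightarrow> complex"
  have "complex_of_real (\<Sum>r\<in>I. (cmod (\<Sum>j\<in>J. W r j * v j))\<^sup>2)
     = (\<Sum>r\<in>I. (\<Sum>i\<in>J. W r i * v i) * cnj (\<Sum>j\<in>J. W r j * v j))"
    by (simp add: complex_norm_square del: of_real_power)
  also have "\<dots> = (\<Sum>r\<in>I. \<Sum>i\<in>J. \<Sum>j\<in>J. (v i * cnj (v j)) * (W r i * cnj (W r j)))"
    by (simp add: sum_product mult_ac)
  also have "\<dots> = (\<Sum>i\<in>J. \<Sum>j\<in>J. (v i * cnj (v j)) * (\<Sum>r\<in>I. W r i * cnj (W r j)))"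
    by (subst sum.swap, subst sum.swap) (simp add: sum_distrib_left sum.swap[of _ I])
  also have "\<dots> = (\<Sum>i\<in>J. \<Sum>j\<in>J. if j = i then (v i * cnj (v i)) * (\<Sum>r\<in>I. W r i * cnj (W r i)) else 0)"
    using orth by (intro sum.cong refl) auto
  also have "\<dots> = (\<Sum>i\<in>J. (v i * cnj (v i)) * (\<Sum>r\<in>I. W r i * cnj (W r i)))"
    using assms(2) by simp
  also have "\<dots> = complex_of_real (\<Sum>i\<in>J. (cmod (v i))\<^sup>2 * (\<Sum>r\<in>I. (cmod (W r i))\<^sup>2))"
    by (simp only: of_real_sum of_real_mult complex_norm_square)
  finally have "(\<Sum>r\<in>I. (cmod (\<Sum>j\<in>J. W r j * v j))\<^sup>2)
      = (\<Sum>i\<in>J. (cmod (v i))\<^sup>2 * (\<Sum>r\<in>I. (cmod (W r i))\<^sup>2))"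
    using of_real_eq_iff by blast
  also have "\<dots> \<le> (\<Sum>i\<in>J. (cmod (v i))\<^sup>2 * 1)"
    by (intro sum_mono mult_left_mono le) auto
  finally show "(\<Sum>r\<in>I. (cmod (\<Sum>j\<in>J. W r j * v j))\<^sup>2) \<le> (\<Sum>j\<in>J. (cmod (v j))\<^sup>2)" by simp
qed

section \<open>Norm properties, compression and pinching for \<open>tn\<close>\<close>

lemma tn_bdd:
  assumes "finite I"
  shows "bdd_above {cmod (\<Sum>i\<in>I. \<Sum>j\<in>I. W i j * X j i) | W. contr I I W}"
proof (rule bdd_aboveI, safe)
  fix W :: "'a mx" assume W: "contr I I W"
  have "cmod (\<Sum>i\<in>I. \<Sum>j\<in>I. W i j * X j i) \<le> (\<Sum>i\<in>I. \<Sum>j\<in>I. cmod (W i j) * cmod (X j i))"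
    by (intro order_trans[OF norm_sum] sum_mono) (simp add: norm_mult)
  also have "\<dots> \<le> (\<Sum>i\<in>I. \<Sum>j\<in>I. 1 * cmod (X j i))"
    using contr_entry[OF W assms assms] by (intro sum_mono mult_right_mono) auto
  finally show "cmod (\<Sum>i\<in>I. \<Sum>j\<in>I. W i j * X j i) \<le> (\<Sum>i\<in>I. \<Sum>j\<in>I. cmod (X j i))" by simp
qed

lemma tn_upper:
  assumes "finite I" "contr I I W"
  shows "cmod (\<Sum>i\<in>I. \<Sum>j\<in>I. W i j * X j i) \<le> tn I X"
  unfolding tn_def using assms(2) by (intro cSup_upper[OF _ tn_bdd[OF assms(1)]]) blast

lemma tn_least:
  assumes "\<And>W. contr I I W \<Longrightarrow> cmod (\<Sum>i\<in>I. \<Sum>j\<in>I. W i j * X j i) \<le> c"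
  shows "tn I X \<le> c"
  unfolding tn_def using assms contr_zero by (intro cSup_least) blast+

lemma tn_nonneg: "finite I \<Longrightarrow> 0 \<le> tn I X"
  using tn_upper[OF _ contr_zero, of I X] by simp

lemma tn_cong:
  assumes "\<And>i j. i \<in> I \<Longrightarrow> j \<in> I \<Longrightarrow> X i j = Y i j"
  shows "tn I X = tn I Y"
  unfolding tn_def by (simp add: assms cong: sum.cong)

lemma tn_triangle:
  assumes "finite I"
  shows "tn I (\<lambda>i j. X i j + Y i j) \<le> tn I X + tn I Y"
proof (rule tn_least)
  fix W :: "'a mx" assume W: "contr I I W"
  show "cmod (\<Sum>i\<in>I. \<Sum>j\<in>I. W i j * (X j i + Y j i)) \<le> tn I X + tn I Y"
    using tn_upper[OF assms W, of X] tn_upper[OF assms W, of Y]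
    by (simp add: distrib_left sum.distrib) (smt (verit) norm_triangle_ineq)
qed

lemma tn_scale_le:
  assumes "finite I"
  shows "tn I (\<lambda>i j. c * X i j) \<le> cmod c * tn I X"
proof (rule tn_least)
  fix W :: "'a mx" assume W: "contr I I W"
  have "(\<Sum>i\<in>I. \<Sum>j\<in>I. W i j * (c * X j i)) = c * (\<Sum>i\<in>I. \<Sum>j\<in>I. W i j * X j i)"
    by (simp add: sum_distrib_left mult_ac)
  thus "cmod (\<Sum>i\<in>I. \<Sum>j\<in>I. W i j * (c * X j i)) \<le> cmod c * tn I X"
    using tn_upper[OF assms W, of X] by (simp add: norm_mult mult_left_mono)
qed

lemma tn_scale:
  assumes "finite I"
  shows "tn I (\<lambda>i j. c * X i j) = cmod c * tn I X"
proof (rule antisym[OF tn_scale_le[OF assms]])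
  show "cmod c * tn I X \<le> tn I (\<lambda>i j. c * X i j)"
  proof (cases "c = 0")
    case False
    have "tn I X = tn I (\<lambda>i j. inverse c * (c * X i j))"
      using False by (simp flip: mult.assoc)
    also have "\<dots> \<le> cmod (inverse c) * tn I (\<lambda>i j. c * X i j)" by (rule tn_scale_le[OF assms])
    finally show ?thesis using False by (simp add: norm_inverse norm_divide field_simps)
  qed (use tn_nonneg[OF assms] in simp)
qed

lemma tn_zero: "finite I \<Longrightarrow> tn I (\<lambda>i j. 0) = 0"
  using tn_scale[of I 0] by simp

lemma tn_diff:
  assumes "finite I"
  shows "tn I (\<lambda>i j. X i j - Y i j) \<le> tn I X + tn I Y"
  using tn_triangle[OF assms, of X "\<lambda>i j. (-1) * Y i j"] tn_scale[OF assms, of "-1" Y] by simp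

lemma tn_sum:
  assumes "finite I" "finite F"
  shows "tn I (\<lambda>i j. \<Sum>a\<in>F. X a i j) \<le> (\<Sum>a\<in>F. tn I (X a))"
  using assms(2)
proof (induction F rule: finite_induct)
  case (insert a F)
  show ?case
    using tn_triangle[OF assms(1), of "X a" "\<lambda>i j. \<Sum>a\<in>F. X a i j"] insert by simp
qed (simp add: tn_zero assms)

text \<open>Duality moves both factors onto the test operator: the transpose of \<open>W\<close>
  times \<open>Z\<close> times \<open>V\<close> is again a contraction. The right factor enters
  without conjugation, so a conjugation map supplies \<open>cnj\<close> of its matrix as
  \<open>W\<close>.\<close>

lemma tn_conj:
  assumes "finite I" "finite J" "contr I J V" "contr I J W"
  shows "tn I (\<lambda>i i'. \<Sum>j\<in>J. \<Sum>j'\<in>J. V i j * X j j' * W i' j') \<le> tn J X"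
proof (rule tn_least)
  fix Z :: "'a mx" assume Z: "contr I I Z"
  have c: "contr J J (\<lambda>j' j. \<Sum>i\<in>I. W i j' * (\<Sum>i'\<in>I. Z i i' * V i' j))"
    by (rule contr_comp[OF contr_transpose[OF assms(4)] contr_comp[OF Z assms(3)]])
  have "(\<Sum>i\<in>I. \<Sum>i'\<in>I. Z i i' * (\<Sum>j\<in>J. \<Sum>j'\<in>J. V i' j * X j j' * W i j'))
    = (\<Sum>i\<in>I. \<Sum>i'\<in>I. \<Sum>j\<in>J. \<Sum>j'\<in>J. W i j' * (Z i i' * V i' j) * X j j')"
    by (simp add: sum_distrib_left mult_ac)
  also have "\<dots> = (\<Sum>j'\<in>J. \<Sum>j\<in>J. \<Sum>i\<in>I. \<Sum>i'\<in>I. W i j' * (Z i i' * V i' j) * X j j')"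
    by (rule sum_swap4)
  also have "\<dots> = (\<Sum>j'\<in>J. \<Sum>j\<in>J. (\<Sum>i\<in>I. W i j' * (\<Sum>i'\<in>I. Z i i' * V i' j)) * X j j')"
    by (simp add: sum_distrib_left sum_distrib_right)
  finally show "cmod (\<Sum>i\<in>I. \<Sum>i'\<in>I. Z i i' * (\<Sum>j\<in>J. \<Sum>j'\<in>J. V i' j * X j j' * W i j')) \<le> tn J X"
    using tn_upper[OF assms(2) c] by simp
qed

text \<open>Conjugation by the transposed zero-one isometry of \<open>f\<close> picks out entries.
  Restriction to a subset, relabelling and permutation of basis states are all instances.\<close>

lemma tn_compress:
  assumes "finite I" "inj_on f J" "f ` J \<subseteq> I"
  shows "tn J (\<lambda>j j'. X (f j) (f j')) \<le> tn I X"
proof -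
  have J: "finite J" using assms finite_subset inj_on_finite by blast
  have c: "contr J I (\<lambda>j i. if i = f j then 1 else 0)"
    by (rule contr_transpose[OF contr_inj[OF assms(1) J assms(2,3)]])
  have "tn J (\<lambda>j j'. X (f j) (f j'))
     = tn J (\<lambda>j j'. \<Sum>i\<in>I. \<Sum>i'\<in>I. (if i = f j then 1 else 0) * X i i' * (if i' = f j' then 1 else 0))"
  proof (rule tn_cong)
    fix j j' assume "j \<in> J" "j' \<in> J"
    hence m: "f j \<in> I" "f j' \<in> I" using assms by auto
    have "(\<Sum>i\<in>I. \<Sum>i'\<in>I. (if i = f j then 1 else 0) * X i i' * (if i' = f j' then 1 else 0))
      = (\<Sum>i\<in>I. if i = f j then (\<Sum>i'\<in>I. if i' = f j' then X i i' else 0) else 0)"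
      by (intro sum.cong refl) (auto intro!: sum.cong)
    thus "X (f j) (f j') = (\<Sum>i\<in>I. \<Sum>i'\<in>I. (if i = f j then 1 else 0) * X i i' * (if i' = f j' then 1 else 0))"
      using m assms(1) by simp
  qed
  also have "\<dots> \<le> tn I X" by (rule tn_conj[OF J assms(1) c c])
  finally show ?thesis .
qed

lemma tn_bij:
  assumes "finite I" "bij_betw f J I"
  shows "tn J (\<lambda>j j'. X (f j) (f j')) = tn I X"
proof (rule antisym)
  show "tn J (\<lambda>j j'. X (f j) (f j')) \<le> tn I X"
    using assms by (intro tn_compress) (auto simp: bij_betw_def)
  let ?g = "inv_into J f"
  have g: "bij_betw ?g I J" using assms by (simp add: bij_betw_inv_into)
  have "tn I X = tn I (\<lambda>i i'. X (f (?g i)) (f (?g i')))"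
    using assms by (intro tn_cong) (simp add: bij_betw_inv_into_right)
  also have "\<dots> \<le> tn J (\<lambda>j j'. X (f j) (f j'))"
    using assms g bij_betw_finite by (intro tn_compress[of J ?g I "\<lambda>j j'. X (f j) (f j')"]) (auto simp: bij_betw_def)
  finally show "tn I X \<le> tn J (\<lambda>j j'. X (f j) (f j'))" .
qed

lemma tn_diag:
  assumes "finite I" "\<And>i. i \<in> I \<Longrightarrow> cmod (c i) \<le> 1" "\<And>i. i \<in> I \<Longrightarrow> cmod (d i) \<le> 1"
  shows "tn I (\<lambda>i j. c i * X i j * d j) \<le> tn I X"
proof (rule tn_least)
  fix W :: "'a mx" assume W: "contr I I W"
  have "contr I I (\<lambda>i j. d i * W i j)" by (rule contr_scale[OF W assms(3)])
  from contr_transpose[OF contr_scale[OF contr_transpose[OF this] assms(2)]]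
  have "contr I I (\<lambda>i j. c j * (d i * W i j))" .
  from tn_upper[OF assms(1) this, of X]
  show "cmod (\<Sum>i\<in>I. \<Sum>j\<in>I. W i j * (c j * X j i * d i)) \<le> tn I X"
    by (simp add: mult_ac)
qed

lemma tn_rank1:
  assumes "finite I"
  shows "tn I (\<lambda>i j. u i * w j) \<le> sqrt (\<Sum>i\<in>I. (cmod (u i))\<^sup>2) * sqrt (\<Sum>i\<in>I. (cmod (w i))\<^sup>2)"
proof (rule tn_least)
  fix W :: "'a mx" assume W: "contr I I W"
  have "(\<Sum>i\<in>I. \<Sum>j\<in>I. W i j * (u j * w i)) = (\<Sum>i\<in>I. w i * (\<Sum>j\<in>I. W i j * u j))"
    by (simp add: sum_distrib_left mult_ac)
  hence "(cmod (\<Sum>i\<in>I. \<Sum>j\<in>I. W i j * (u j * w i)))\<^sup>2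
     \<le> (\<Sum>i\<in>I. (cmod (w i))\<^sup>2) * (\<Sum>i\<in>I. (cmod (\<Sum>j\<in>I. W i j * u j))\<^sup>2)"
    using Cauchy_Schwarz_sum by metis
  also have "\<dots> \<le> (\<Sum>i\<in>I. (cmod (w i))\<^sup>2) * (\<Sum>i\<in>I. (cmod (u i))\<^sup>2)"
    by (intro mult_left_mono contrD[OF W] sum_nonneg) auto
  finally show "cmod (\<Sum>i\<in>I. \<Sum>j\<in>I. W i j * (u j * w i))
      \<le> sqrt (\<Sum>i\<in>I. (cmod (u i))\<^sup>2) * sqrt (\<Sum>i\<in>I. (cmod (w i))\<^sup>2)"
    by (simp add: real_le_rsqrt mult.commute flip: real_sqrt_mult)
qed

text \<open>A matrix unit is a contraction and pairs with \<open>X\<close> to a single entry; this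
  makes the norm of a nonzero operator positive.\<close>

lemma tn_entry:
  assumes "finite I" "i \<in> I" "j \<in> I"
  shows "cmod (X i j) \<le> tn I X"
proof -
  define W :: "'a mx" where "W r s = (if r = j \<and> s = i then 1 else 0)" for r s
  have "contr I I W"
    unfolding contr_def
  proof
    fix v :: "'a \<Rightarrow> complex"
    have "(\<Sum>s\<in>I. W r s * v s) = (\<Sum>s\<in>I. if s = i then (if r = j then v i else 0) else 0)" for r
      by (intro sum.cong) (auto simp: W_def)
    hence "(cmod (\<Sum>s\<in>I. W r s * v s))\<^sup>2 = (if r = j then (cmod (v i))\<^sup>2 else 0)" for r
      using assms by simp
    thus "(\<Sum>r\<in>I. (cmod (\<Sum>s\<in>I. W r s * v s))\<^sup>2) \<le> (\<Sum>s\<in>I. (cmod (v s))\<^sup>2)"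
      using assms member_le_sum[of i I "\<lambda>s. (cmod (v s))\<^sup>2"] by simp
  qed
  moreover have "(\<Sum>r\<in>I. \<Sum>s\<in>I. W r s * X s r) = (\<Sum>r\<in>I. if r = j then (\<Sum>s\<in>I. if s = i then X s r else 0) else 0)"
    by (intro sum.cong refl) (auto simp: W_def intro!: sum.cong)
  ultimately show ?thesis using tn_upper[of I W X] assms by simp
qed

text \<open>A direct sum of contractions; labels outside \<open>Z\<close> contribute a zero
  block.\<close>

lemma contr_block:
  assumes "finite I" "finite Z" "\<And>z. z \<in> Z \<Longrightarrow> contr {p\<in>I. g p = z} {p\<in>I. g p = z} (W z)"
  shows "contr I I (\<lambda>i j. if g i = g j \<and> g i \<in> Z then W (g i) i j else 0)"
  unfolding contr_def
proof
  fix v :: "'a \<Rightarrow> complex"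
  let ?B = "\<lambda>z. {p\<in>I. g p = z}"
  let ?y = "\<lambda>i. (\<Sum>j\<in>I. (if g i = g j \<and> g i \<in> Z then W (g i) i j else 0) * v j)"
  have y0: "?y i = 0" if "g i \<notin> Z" for i using that by simp
  have y1: "?y i = (\<Sum>j\<in>?B z. W z i j * v j)" if "z \<in> Z" "i \<in> ?B z" for i z
    using that assms(1) by (auto simp: sum.inter_filter intro!: sum.cong)
  have "(\<Sum>i\<in>I. (cmod (?y i))\<^sup>2) = (\<Sum>i\<in>(\<Union>z\<in>Z. ?B z). (cmod (?y i))\<^sup>2)"
    using assms by (intro sum.mono_neutral_right) (auto simp: y0)
  also have "\<dots> = (\<Sum>z\<in>Z. \<Sum>i\<in>?B z. (cmod (?y i))\<^sup>2)"
    using assms by (intro sum.UNION_disjoint) auto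
  also have "\<dots> = (\<Sum>z\<in>Z. \<Sum>i\<in>?B z. (cmod (\<Sum>j\<in>?B z. W z i j * v j))\<^sup>2)"
    using y1 by (intro sum.cong refl) presburger
  also have "\<dots> \<le> (\<Sum>z\<in>Z. \<Sum>j\<in>?B z. (cmod (v j))\<^sup>2)"
    by (intro sum_mono contrD assms)
  also have "\<dots> = (\<Sum>i\<in>(\<Union>z\<in>Z. ?B z). (cmod (v i))\<^sup>2)"
    using assms by (intro sum.UNION_disjoint[symmetric]) auto
  also have "\<dots> \<le> (\<Sum>i\<in>I. (cmod (v i))\<^sup>2)"
    using assms by (intro sum_mono2) auto
  finally show "(\<Sum>i\<in>I. (cmod (?y i))\<^sup>2) \<le> (\<Sum>i\<in>I. (cmod (v i))\<^sup>2)" .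
qed

text \<open>Multiplying a near-optimal test operator by a phase makes its pairing real, so that
  near-optimal values on different blocks can be added without cancellation.\<close>

lemma tn_attained_approx:
  assumes "finite I" "\<epsilon> > 0"
  shows "\<exists>W. contr I I W \<and> (\<exists>t. (\<Sum>i\<in>I. \<Sum>j\<in>I. W i j * X j i) = of_real t \<and> tn I X < t + \<epsilon>)"
proof -
  let ?S = "{cmod (\<Sum>i\<in>I. \<Sum>j\<in>I. W i j * X j i) | W. contr I I W}"
  have "?S \<noteq> {}" using contr_zero by blast
  moreover have "tn I X - \<epsilon> < Sup ?S" using assms(2) by (simp add: tn_def)
  ultimately obtain W where W: "contr I I W" "tn I X - \<epsilon> < cmod (\<Sum>i\<in>I. \<Sum>j\<in>I. W i j * X j i)"
    using less_cSup_iff[OF _ tn_bdd[OF assms(1)]] by blast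
  define s where "s = (\<Sum>i\<in>I. \<Sum>j\<in>I. W i j * X j i)"
  define c where "c = cnj (sgn s)"
  have c: "cmod c \<le> 1" by (simp add: c_def norm_sgn)
  have "c * s = of_real (cmod s)"
    by (cases "s = 0") (simp_all add: c_def sgn_eq mult.commute flip: complex_norm_square,
      simp add: complex_norm_square[symmetric] power2_eq_square)
  moreover have "(\<Sum>i\<in>I. \<Sum>j\<in>I. (c * W i j) * X j i) = c * s"
    by (simp add: s_def sum_distrib_left mult.assoc)
  ultimately have "(\<Sum>i\<in>I. \<Sum>j\<in>I. (c * W i j) * X j i) = of_real (cmod s)" by simp
  moreover have "contr I I (\<lambda>i j. c * W i j)" by (rule contr_scale[OF W(1) c])
  moreover have "tn I X < cmod s + \<epsilon>" using W(2) by (simp add: s_def)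
  ultimately show ?thesis by blast
qed

text \<open>Near-optimal test operators on the diagonal blocks are glued into one block diagonal
  contraction, which ignores the off-diagonal blocks of \<open>X\<close> and pairs to the
  sum.\<close>

lemma tn_pinch:
  assumes "finite I" "finite Z"
  shows "(\<Sum>z\<in>Z. tn {p\<in>I. g p = z} X) \<le> tn I X"
proof (rule field_le_epsilon)
  fix e :: real assume e: "e > 0"
  let ?B = "\<lambda>z. {p\<in>I. g p = z}"
  \<comment> \<open>Splits \<open>e\<close> over the blocks; the \<open>+ 1\<close> keeps the
    divisor positive for empty \<open>Z\<close>.\<close>
  define d where "d = e / (card Z + 1)"
  have d: "d > 0" using e by (simp add: d_def)
  define good where "good z W t \<longleftrightarrow> contr (?B z) (?B z) W
    \<and> (\<Sum>i\<in>?B z. \<Sum>j\<in>?B z. W i j * X j i) = of_real t \<and> tn (?B z) X < t + d" for z W t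
  have "\<forall>z. \<exists>W t. good z W t"
    using tn_attained_approx[OF _ d, of "?B _" X] assms(1) unfolding good_def by simp
  then obtain W t where good: "\<And>z. good z (W z) (t z)" by metis
  have W: "contr (?B z) (?B z) (W z)"
    and t: "(\<Sum>i\<in>?B z. \<Sum>j\<in>?B z. W z i j * X j i) = of_real (t z)" "tn (?B z) X < t z + d" for z
    using good[of z] by (simp_all add: good_def)
  let ?V = "\<lambda>i j. if g i = g j \<and> g i \<in> Z then W (g i) i j else 0"
  have "(\<Sum>i\<in>I. \<Sum>j\<in>I. ?V i j * X j i) = (\<Sum>i\<in>(\<Union>z\<in>Z. ?B z). \<Sum>j\<in>I. ?V i j * X j i)"
    using assms by (intro sum.mono_neutral_right) auto
  also have "\<dots> = (\<Sum>z\<in>Z. \<Sum>i\<in>?B z. \<Sum>j\<in>I. ?V i j * X j i)"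
    using assms by (intro sum.UNION_disjoint) auto
  also have "\<dots> = (\<Sum>z\<in>Z. \<Sum>i\<in>?B z. \<Sum>j\<in>?B z. W z i j * X j i)"
    using assms by (intro sum.cong refl sum.mono_neutral_cong_right) auto
  also have "\<dots> = of_real (\<Sum>z\<in>Z. t z)" by (simp add: t)
  finally have "(\<Sum>i\<in>I. \<Sum>j\<in>I. ?V i j * X j i) = of_real (\<Sum>z\<in>Z. t z)" .
  moreover have "contr I I ?V" by (rule contr_block[OF assms W])
  ultimately have "\<bar>\<Sum>z\<in>Z. t z\<bar> \<le> tn I X" using tn_upper[OF assms(1), of ?V X] by (metis norm_of_real)
  hence "(\<Sum>z\<in>Z. t z) \<le> tn I X" by simp
  moreover have "(\<Sum>z\<in>Z. tn (?B z) X) \<le> (\<Sum>z\<in>Z. t z + d)"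
    by (intro sum_mono less_imp_le t)
  moreover have "card Z * d \<le> e" using e by (simp add: d_def field_simps)
  ultimately show "(\<Sum>z\<in>Z. tn (?B z) X) \<le> tn I X + e" by (simp add: sum.distrib)
qed

lemma contr_subset:
  assumes "contr I I W" "finite I" "J \<subseteq> I"
  shows "contr J J W"
  unfolding contr_def
proof
  fix v :: "'a \<Rightarrow> complex"
  let ?v = "\<lambda>j. if j \<in> J then v j else 0"
  have e: "(\<Sum>j\<in>I. W i j * ?v j) = (\<Sum>j\<in>J. W i j * v j)" for i
    using assms by (intro sum.mono_neutral_cong_right) auto
  have "(\<Sum>i\<in>J. (cmod (\<Sum>j\<in>J. W i j * v j))\<^sup>2) \<le> (\<Sum>i\<in>I. (cmod (\<Sum>j\<in>I. W i j * ?v j))\<^sup>2)"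
    unfolding e using assms by (intro sum_mono2) auto
  also have "\<dots> \<le> (\<Sum>j\<in>I. (cmod (?v j))\<^sup>2)" by (rule contrD[OF assms(1)])
  also have "\<dots> = (\<Sum>j\<in>J. (cmod (v j))\<^sup>2)"
    using assms by (intro sum.mono_neutral_cong_right) auto
  finally show "(\<Sum>i\<in>J. (cmod (\<Sum>j\<in>J. W i j * v j))\<^sup>2) \<le> (\<Sum>j\<in>J. (cmod (v j))\<^sup>2)" .
qed

lemma tn_subset:
  assumes "finite I" "J \<subseteq> I"
  shows "tn J X \<le> tn I X"
  using tn_compress[OF assms(1), of "\<lambda>x. x" J X] assms by simp

lemma tn_support:
  assumes "finite I" "J \<subseteq> I" "\<And>i j. i \<in> I \<Longrightarrow> j \<in> I \<Longrightarrow> i \<notin> J \<or> j \<notin> J \<Longrightarrow> X i j = 0"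
  shows "tn I X = tn J X"
proof (rule antisym[OF _ tn_subset[OF assms(1,2)]], rule tn_least)
  fix W :: "'a mx" assume W: "contr I I W"
  have J: "finite J" using assms finite_subset by blast
  have WJ: "contr J J W" by (rule contr_subset[OF W assms(1,2)])
  have "(\<Sum>i\<in>I. \<Sum>j\<in>I. W i j * X j i) = (\<Sum>i\<in>J. \<Sum>j\<in>I. W i j * X j i)"
    using assms by (intro sum.mono_neutral_right) (auto intro!: sum.neutral)
  also have "\<dots> = (\<Sum>i\<in>J. \<Sum>j\<in>J. W i j * X j i)"
    using assms by (intro sum.cong refl sum.mono_neutral_right) auto
  finally show "cmod (\<Sum>i\<in>I. \<Sum>j\<in>I. W i j * X j i) \<le> tn J X"
    using tn_upper[OF J WJ] by simp
qed

text \<open>Pinching becomes an equality: with no off-diagonal blocks, the triangle inequality over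
  the blocks gives the reverse bound.\<close>

lemma tn_block_diagonal:
  assumes "finite I" "finite Z" "g ` I \<subseteq> Z"
    and "\<And>p q. p \<in> I \<Longrightarrow> q \<in> I \<Longrightarrow> g p \<noteq> g q \<Longrightarrow> X p q = 0"
  shows "tn I X = (\<Sum>z\<in>Z. tn {p\<in>I. g p = z} X)"
proof (rule antisym[OF _ tn_pinch[OF assms(1,2)]])
  have "tn I X = tn I (\<lambda>p q. \<Sum>z\<in>Z. if g p = z \<and> g q = z then X p q else 0)"
  proof (rule tn_cong)
    fix p q assume "p \<in> I" "q \<in> I"
    hence "(\<Sum>z\<in>Z. if g p = z \<and> g q = z then X p q else 0) = (\<Sum>z\<in>Z. if g p = z then X p q else 0)"
      using assms(4) by (intro sum.cong) auto
    also have "\<dots> = X p q" using assms(2,3) \<open>p \<in> I\<close> by (subst sum.delta') auto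
    finally show "X p q = (\<Sum>z\<in>Z. if g p = z \<and> g q = z then X p q else 0)" by simp
  qed
  also have "\<dots> \<le> (\<Sum>z\<in>Z. tn I (\<lambda>p q. if g p = z \<and> g q = z then X p q else 0))"
    by (rule tn_sum[OF assms(1,2)])
  also have "\<dots> = (\<Sum>z\<in>Z. tn {p\<in>I. g p = z} X)"
  proof (rule sum.cong[OF refl])
    fix z
    have "tn I (\<lambda>p q. if g p = z \<and> g q = z then X p q else 0)
      = tn {p\<in>I. g p = z} (\<lambda>p q. if g p = z \<and> g q = z then X p q else 0)"
      using assms by (intro tn_support) auto
    thus "tn I (\<lambda>p q. if g p = z \<and> g q = z then X p q else 0) = tn {p\<in>I. g p = z} X"
      using tn_cong[of "{p\<in>I. g p = z}" "\<lambda>p q. if g p = z \<and> g q = z then X p q else 0" X] by simp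
  qed
  finally show "tn I X \<le> (\<Sum>z\<in>Z. tn {p\<in>I. g p = z} X)" .
qed

text \<open>The partial trace sees only the diagonal blocks, whose norms add up to at most the whole
  by pinching.\<close>

lemma tn_partial_trace:
  assumes "finite I" "finite R"
  shows "tn R (\<lambda>k l. \<Sum>S\<in>I. X (S, k) (S, l)) \<le> tn (I \<times> R) X"
proof -
  have "tn R (\<lambda>k l. \<Sum>S\<in>I. X (S, k) (S, l)) \<le> (\<Sum>S\<in>I. tn R (\<lambda>k l. X (S, k) (S, l)))"
    by (rule tn_sum[OF assms(2,1)])
  also have "\<dots> \<le> (\<Sum>S\<in>I. tn {p\<in>I\<times>R. fst p = S} X)"
    using assms by (intro sum_mono tn_compress[of _ "\<lambda>k. (_, k)"]) (auto intro: inj_onI)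
  also have "\<dots> \<le> tn (I \<times> R) X" using assms by (intro tn_pinch) auto
  finally show ?thesis .
qed

section \<open>Singular value decomposition\<close>

definition orthonormal_columns :: "'i set \<Rightarrow> 'i mx \<Rightarrow> bool" where
  "orthonormal_columns I U \<longleftrightarrow>
     (\<forall>i\<in>I. \<forall>j\<in>I. (\<Sum>r\<in>I. cnj (U r i) * U r j) = (if i = j then 1 else 0))"

text \<open>Enumerating \<open>I\<close> carries the problem to a complex square matrix of positive
  dimension, which has a nonempty spectrum.\<close>

lemma ex_eigenvector:
  fixes G :: "'i mx"
  assumes "finite I" "I \<noteq> {}"
  shows "\<exists>v k. (\<exists>i\<in>I. v i \<noteq> 0) \<and> (\<forall>i\<in>I. (\<Sum>j\<in>I. G i j * v j) = k * v i)"
proof -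
  define n where "n = card I"
  have n: "n > 0" using assms by (simp add: n_def card_gt_0_iff)
  obtain f where f: "bij_betw f {0..<n} I"
    using ex_bij_betw_nat_finite[OF assms(1)] n_def by blast
  let ?g = "inv_into {0..<n} f"
  define A where "A = mat n n (\<lambda>(a, b). G (f a) (f b))"
  have A: "A \<in> carrier_mat n n" by (simp add: A_def)
  then obtain k v where "eigenvector A v k"
    using spectrum_non_empty[OF A n] unfolding spectrum_def eigenvalue_def by auto
  hence v: "v \<in> carrier_vec n" "v \<noteq> 0\<^sub>v n" "A *\<^sub>v v = k \<cdot>\<^sub>v v"
    using A unfolding eigenvector_def by auto
  have e: "(\<Sum>b\<in>{0..<n}. G (f a) (f b) * v $ b) = k * v $ a" if "a < n" for a
  proof -
    have "(A *\<^sub>v v) $ a = (\<Sum>b\<in>{0..<n}. G (f a) (f b) * v $ b)"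
      using v(1) that by (auto simp: A_def scalar_prod_def intro!: sum.cong)
    thus ?thesis using v that by simp
  qed
  have gf: "?g (f a) = a" if "a < n" for a
    using f that by (simp add: bij_betw_def inv_into_f_f)
  have fg: "f (?g i) = i" "?g i < n" if "i \<in> I" for i
    using f that bij_betw_inv_into_right[OF f] bij_betwE[OF bij_betw_inv_into[OF f]] by auto
  have "(\<Sum>j\<in>I. G i j * v $ (?g j)) = k * v $ (?g i)" if "i \<in> I" for i
  proof -
    have "(\<Sum>j\<in>I. G i j * v $ (?g j)) = (\<Sum>b\<in>{0..<n}. G i (f b) * v $ (?g (f b)))"
      by (rule sum.reindex_bij_betw[OF f, symmetric])
    also have "\<dots> = (\<Sum>b\<in>{0..<n}. G (f (?g i)) (f b) * v $ b)"
      using fg[OF that] gf by (intro sum.cong) auto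
    finally show ?thesis using e[OF fg(2)[OF that]] by simp
  qed
  moreover have "\<exists>i\<in>I. v $ (?g i) \<noteq> 0"
  proof -
    obtain a where "a < n" "v $ a \<noteq> 0" using v(1,2) by (auto simp: vec_eq_iff)
    thus ?thesis using gf bij_betwE[OF f] by (intro bexI[of _ "f a"]) auto
  qed
  ultimately show ?thesis by (intro exI[of _ "\<lambda>i. v $ (?g i)"]) auto
qed

text \<open>A Householder reflection; the phase of \<open>p\<close> is chosen so that the reflection vector
  \<open>w\<close> never vanishes.\<close>
lemma ex_unitary_with_column:
  fixes p :: "'i \<Rightarrow> complex"
  assumes "finite I" "x \<in> I" "(\<Sum>i\<in>I. (cmod (p i))\<^sup>2) = 1"
  shows "\<exists>U c. orthonormal_columns I U \<and> (\<forall>r s. cnj (U r s) = U s r) \<and> (\<forall>i\<in>I. U i x = c * p i)"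
proof -
  define a where "a = cmod (p x)"
  define c where "c = (if p x = 0 then 1 else - cnj (sgn (p x)))"
  have c: "cmod c = 1" by (simp add: c_def norm_sgn)
  define q where "q i = c * p i" for i
  have q0: "q x = - of_real a"
  proof (cases "p x = 0")
    case False
    have "cnj (p x) * p x = of_real (a * a)"
      by (simp add: a_def mult.commute complex_norm_square[symmetric] power2_eq_square flip: of_real_mult)
    thus ?thesis using False by (simp add: q_def c_def sgn_eq a_def)
  qed (simp add: q_def a_def)
  have a0: "a \<ge> 0" by (simp add: a_def)
  define w where "w i = q i - (if i = x then 1 else 0)" for i
  \<comment> \<open>\<open>\<beta>\<close> is both half the squared norm of \<open>w\<close> and
    \<open>- w x\<close>. The former makes \<open>U\<close> the reflection
    \<open>1 - 2 w w^H / |w|^2\<close>; the latter makes its column \<open>x\<close> equal to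
    \<open>e_x + w = q\<close>.\<close>
  define \<beta> where "\<beta> = 1 + a"
  have \<beta>: "\<beta> > 0" using a0 by (simp add: \<beta>_def)
  have wx: "w x = - of_real \<beta>" by (simp add: w_def q0 \<beta>_def)
  have "(\<Sum>i\<in>I. (cmod (w i))\<^sup>2) = (\<Sum>i\<in>I. (cmod (q i))\<^sup>2 + (if i = x then 1 + 2 * a else 0))"
  proof (rule sum.cong[OF refl])
    fix i
    have "cmod (- of_real a - 1) = a + 1"
      using a0 norm_of_real[of "- a - 1", where 'a = complex] by simp
    thus "(cmod (w i))\<^sup>2 = (cmod (q i))\<^sup>2 + (if i = x then 1 + 2 * a else 0)"
      using a0 by (auto simp: w_def q0 power2_eq_square algebra_simps)
  qed
  also have "\<dots> = 1 + (1 + 2 * a)"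
    using assms c by (simp add: sum.distrib q_def norm_mult)
  finally have "(\<Sum>i\<in>I. (cmod (w i))\<^sup>2) = 2 * \<beta>" by (simp add: \<beta>_def)
  hence "complex_of_real (\<Sum>i\<in>I. (cmod (w i))\<^sup>2) = of_real (2 * \<beta>)" by (rule arg_cong)
  hence ww: "(\<Sum>i\<in>I. w i * cnj (w i)) = 2 * of_real \<beta>"
    by (simp add: complex_norm_square del: of_real_power)
  define U where "U r s = (if r = s then 1 else 0) - w r * cnj (w s) / of_real \<beta>" for r s
  have herm: "cnj (U r s) = U s r" for r s by (simp add: U_def)
  have "U i x = c * p i" for i
  proof -
    have "cnj (w x) = - of_real \<beta>" by (simp add: wx)
    hence "U i x = (if i = x then 1 else 0) + w i" using \<beta> by (simp add: U_def)
    thus ?thesis by (simp add: w_def q_def)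
  qed
  moreover have "orthonormal_columns I U"
    unfolding orthonormal_columns_def
  proof (intro ballI)
    fix i j assume ij: "i \<in> I" "j \<in> I"
    have "(\<Sum>r\<in>I. cnj (U r i) * U r j)
      = (\<Sum>r\<in>I. (if r = i then (if i = j then 1 else 0) - w i * cnj (w j) / of_real \<beta> else 0)
         - (if r = j then w i * cnj (w j) / of_real \<beta> else 0)
         + (w i * cnj (w j) / (of_real \<beta> * of_real \<beta>)) * (w r * cnj (w r)))"
      by (intro sum.cong refl) (simp add: herm, auto simp: U_def algebra_simps)
    also have "\<dots> = (if i = j then 1 else 0) - w i * cnj (w j) / of_real \<beta> - w i * cnj (w j) / of_real \<beta>
      + (w i * cnj (w j) / (of_real \<beta> * of_real \<beta>)) * (2 * of_real \<beta>)"
      unfolding sum.distrib sum_subtractf sum_distrib_left[symmetric] ww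
      using assms(1) ij by simp
    also have "\<dots> = (if i = j then 1 else 0)"
      using \<beta> by (simp add: field_simps)
    finally show "(\<Sum>r\<in>I. cnj (U r i) * U r j) = (if i = j then 1 else 0)" .
  qed
  ultimately show ?thesis using herm by blast
qed

lemma orthonormal_columns_mult:
  assumes "finite I" "orthonormal_columns I U" "orthonormal_columns I V"
  shows "orthonormal_columns I (\<lambda>r i. \<Sum>s\<in>I. U r s * V s i)"
  unfolding orthonormal_columns_def
proof (intro ballI)
  fix i j assume ij: "i \<in> I" "j \<in> I"
  have "(\<Sum>r\<in>I. cnj (\<Sum>s\<in>I. U r s * V s i) * (\<Sum>s\<in>I. U r s * V s j))
      = (\<Sum>r\<in>I. \<Sum>s\<in>I. \<Sum>t\<in>I. cnj (U r s) * U r t * (cnj (V s i) * V t j))"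
    by (simp only: cnj_sum complex_cnj_mult sum_product) (simp only: mult_ac)
  also have "\<dots> = (\<Sum>s\<in>I. \<Sum>t\<in>I. (\<Sum>r\<in>I. cnj (U r s) * U r t) * (cnj (V s i) * V t j))"
    unfolding sum_distrib_right by (rule sum_swap3[symmetric])
  also have "\<dots> = (\<Sum>s\<in>I. \<Sum>t\<in>I. if s = t then cnj (V s i) * V t j else 0)"
    using assms(2) unfolding orthonormal_columns_def by (intro sum.cong refl) auto
  also have "\<dots> = (if i = j then 1 else 0)"
    using assms(1,3) ij unfolding orthonormal_columns_def by simp
  finally show "(\<Sum>r\<in>I. cnj (\<Sum>s\<in>I. U r s * V s i) * (\<Sum>s\<in>I. U r s * V s j)) = (if i = j then 1 else 0)" .
qed

text \<open>A singular value decomposition with the singular values left inside \<open>b\<close> as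
  row norms, so no singular vectors have to be completed when some of them vanish. The induction
  splits off one row at a time: an eigenvector of the Gram matrix of the rows, placed in column
  \<open>x\<close> of a unitary \<open>U\<close>, makes row \<open>x\<close> of the rotated matrix
  orthogonal to all others.\<close>

lemma ex_orthogonal_rows:
  fixes A :: "'i \<Rightarrow> 'j \<Rightarrow> complex"
  assumes "finite I" "finite J"
  shows "\<exists>P b. orthonormal_columns I P \<and> (\<forall>r\<in>I. \<forall>c\<in>J. A r c = (\<Sum>i\<in>I. P r i * b i c))
    \<and> (\<forall>i\<in>I. \<forall>j\<in>I. i \<noteq> j \<longrightarrow> (\<Sum>c\<in>J. b i c * cnj (b j c)) = 0)"
  using assms(1)
proof (induction I arbitrary: A rule: finite_induct)
  case empty
  show ?case by (simp add: orthonormal_columns_def)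
next
  case (insert x I)
  let ?K = "insert x I"
  have K: "finite ?K" "?K \<noteq> {}" "x \<in> ?K" using insert by auto
  define G where "G r t = (\<Sum>c\<in>J. A r c * cnj (A t c))" for r t
  obtain v k where v: "\<exists>i\<in>?K. v i \<noteq> 0" "\<And>i. i \<in> ?K \<Longrightarrow> (\<Sum>j\<in>?K. G i j * v j) = k * v i"
    using ex_eigenvector[OF K(1,2), of G] by blast
  define N where "N = (\<Sum>i\<in>?K. (cmod (v i))\<^sup>2)"
  have N: "N > 0"
    unfolding N_def using v(1) K(1) by (metis (no_types, lifting) norm_eq_zero sum_pos2 zero_le_power2 zero_less_power2)
  have "(\<Sum>i\<in>?K. (cmod (v i / of_real (sqrt N)))\<^sup>2) = 1"
    using N by (simp add: norm_divide power_divide N_def[symmetric] del: sum.insert flip: sum_divide_distrib)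
  from ex_unitary_with_column[OF K(1,3) this]
  obtain U c where U: "orthonormal_columns ?K U" and herm: "\<And>r s. cnj (U r s) = U s r"
    and Ux: "\<And>i. i \<in> ?K \<Longrightarrow> U i x = c * (v i / of_real (sqrt N))" by blast
  have rows: "(\<Sum>s\<in>?K. U r s * cnj (U t s)) = (if r = t then 1 else 0)" if "r \<in> ?K" "t \<in> ?K" for r t
    using U that unfolding orthonormal_columns_def herm by blast
  have eig: "(\<Sum>t\<in>?K. G r t * U t x) = k * U r x" if "r \<in> ?K" for r
  proof -
    have "(\<Sum>t\<in>?K. G r t * U t x) = (\<Sum>t\<in>?K. (c / of_real (sqrt N)) * (G r t * v t))"
      by (intro sum.cong refl) (simp add: Ux del: insert_iff)
    also have "\<dots> = (c / of_real (sqrt N)) * (k * v r)"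
      by (simp only: v(2)[OF that] flip: sum_distrib_left)
    finally show ?thesis using that by (simp add: Ux del: sum.insert insert_iff)
  qed
  define A' where "A' s c = (\<Sum>r\<in>?K. cnj (U r s) * A r c)" for s c
  have AA': "A r c = (\<Sum>s\<in>?K. U r s * A' s c)" if "r \<in> ?K" for r c
  proof -
    have "(\<Sum>s\<in>?K. U r s * A' s c) = (\<Sum>t\<in>?K. (\<Sum>s\<in>?K. U r s * cnj (U t s)) * A t c)"
      unfolding A'_def sum_distrib_left sum_distrib_right
      by (subst sum.swap) (simp only: mult.assoc)
    also have "\<dots> = (\<Sum>t\<in>?K. if r = t then A t c else 0)"
      using rows[OF that] by (intro sum.cong refl) (simp del: sum.insert)
    also have "\<dots> = A r c" using K(1) that by (simp only: sum.delta' if_True)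
    finally show ?thesis by simp
  qed
  \<comment> \<open>\<open>G\<close> maps column \<open>x\<close> of \<open>U\<close> to a multiple
    of itself, and distinct columns of \<open>U\<close> are orthogonal.\<close>
  have orthx: "(\<Sum>c\<in>J. A' s c * cnj (A' x c)) = 0" if "s \<in> I" for s
  proof -
    have "(\<Sum>c\<in>J. A' s c * cnj (A' x c))
      = (\<Sum>c\<in>J. \<Sum>r\<in>?K. \<Sum>t\<in>?K. cnj (U r s) * (A r c * cnj (A t c) * U t x))"
      unfolding A'_def by (simp only: cnj_sum complex_cnj_mult complex_cnj_cnj sum_product) (simp only: mult_ac)
    also have "\<dots> = (\<Sum>r\<in>?K. \<Sum>t\<in>?K. \<Sum>c\<in>J. cnj (U r s) * (A r c * cnj (A t c) * U t x))"
      by (simp only: sum.swap[of _ _ J])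
    also have "\<dots> = (\<Sum>r\<in>?K. cnj (U r s) * (\<Sum>t\<in>?K. G r t * U t x))"
      by (simp only: G_def sum_distrib_left sum_distrib_right)
    also have "\<dots> = (\<Sum>r\<in>?K. cnj (U r s) * (k * U r x))"
      using eig by (intro sum.cong refl) (simp only:)
    also have "\<dots> = k * (\<Sum>r\<in>?K. cnj (U r s) * U r x)"
      by (simp only: sum_distrib_left mult_ac)
    also have "\<dots> = 0"
      using U that insert.hyps(2) unfolding orthonormal_columns_def by auto
    finally show ?thesis .
  qed
  obtain P' b' where P': "orthonormal_columns I P'"
    and dec: "\<And>r c. r \<in> I \<Longrightarrow> c \<in> J \<Longrightarrow> A' r c = (\<Sum>i\<in>I. P' r i * b' i c)"
    and orth: "\<And>i j. i \<in> I \<Longrightarrow> j \<in> I \<Longrightarrow> i \<noteq> j \<Longrightarrow> (\<Sum>c\<in>J. b' i c * cnj (b' j c)) = 0"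
    using insert.IH[of A'] by blast
  \<comment> \<open>Unitarity of \<open>P'\<close> inverts the decomposition, so each row of
    \<open>b'\<close> is a combination of the rows of \<open>A'\<close> in \<open>I\<close> and
    inherits their orthogonality to row \<open>x\<close>.\<close>
  have b': "b' i c = (\<Sum>s\<in>I. cnj (P' s i) * A' s c)" if "i \<in> I" "c \<in> J" for i c
  proof -
    have "(\<Sum>s\<in>I. cnj (P' s i) * A' s c) = (\<Sum>s\<in>I. cnj (P' s i) * (\<Sum>j\<in>I. P' s j * b' j c))"
      using that by (intro sum.cong refl) (simp add: dec)
    also have "\<dots> = (\<Sum>j\<in>I. (\<Sum>s\<in>I. cnj (P' s i) * P' s j) * b' j c)"
      by (simp only: sum_distrib_left sum_distrib_right, subst sum.swap) (simp only: mult.assoc)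
    also have "\<dots> = (\<Sum>j\<in>I. if i = j then b' j c else 0)"
      using P' that unfolding orthonormal_columns_def by (intro sum.cong refl) auto
    finally show ?thesis using that insert.hyps(1) by simp
  qed
  have orthb: "(\<Sum>c\<in>J. b' i c * cnj (A' x c)) = 0" if "i \<in> I" for i
  proof -
    have "(\<Sum>c\<in>J. b' i c * cnj (A' x c)) = (\<Sum>c\<in>J. \<Sum>s\<in>I. cnj (P' s i) * (A' s c * cnj (A' x c)))"
      using that by (intro sum.cong refl) (simp add: b' sum_distrib_right mult.assoc)
    also have "\<dots> = (\<Sum>s\<in>I. cnj (P' s i) * (\<Sum>c\<in>J. A' s c * cnj (A' x c)))"
      by (subst sum.swap) (simp only: sum_distrib_left)
    finally show ?thesis using orthx by simp
  qed
  define b where "b i = (if i = x then A' x else b' i)" for i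
  \<comment> \<open>The direct sum of 1 on \<open>x\<close> and \<open>P'\<close> on
    \<open>I\<close>, so that \<open>A = U A' = U V b\<close>.\<close>
  define V where "V s i = (if s = x \<or> i = x then if s = i then 1 else 0 else P' s i)" for s i
  define P where "P r i = (\<Sum>s\<in>?K. U r s * V s i)" for r i
  have nx: "i \<noteq> x" if "i \<in> I" for i using that insert.hyps(2) by auto
  have V: "orthonormal_columns ?K V"
    unfolding orthonormal_columns_def
  proof (intro ballI)
    fix i j assume ij: "i \<in> ?K" "j \<in> ?K"
    have "(\<Sum>s\<in>I. cnj (V s i) * V s j) = (if i = x \<or> j = x then 0 else \<Sum>s\<in>I. cnj (P' s i) * P' s j)"
      using nx by (auto simp: V_def intro!: sum.neutral sum.cong)
    also have "\<dots> = (if i = j \<and> i \<noteq> x then 1 else 0)"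
      using P' ij unfolding orthonormal_columns_def by auto
    finally show "(\<Sum>s\<in>?K. cnj (V s i) * V s j) = (if i = j then 1 else 0)"
      using insert.hyps by (auto simp: V_def)
  qed
  have "orthonormal_columns ?K P"
    unfolding P_def by (rule orthonormal_columns_mult[OF K(1) U V])
  moreover have "A r c = (\<Sum>i\<in>?K. P r i * b i c)" if "r \<in> ?K" "c \<in> J" for r c
  proof -
    have "A' s c = (\<Sum>i\<in>?K. V s i * b i c)" if "s \<in> ?K" for s
    proof -
      have "(\<Sum>i\<in>I. V s i * b i c) = (if s = x then 0 else A' s c)"
        using nx dec[of s c] that \<open>c \<in> J\<close> insert.hyps(2) by (auto simp: V_def b_def intro!: sum.neutral sum.cong)
      thus ?thesis using insert.hyps by (simp add: V_def b_def)
    qed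
    hence "A r c = (\<Sum>s\<in>?K. U r s * (\<Sum>i\<in>?K. V s i * b i c))"
      unfolding AA'[OF \<open>r \<in> ?K\<close>] by (intro sum.cong refl) presburger
    also have "\<dots> = (\<Sum>i\<in>?K. P r i * b i c)"
      unfolding P_def sum_distrib_left sum_distrib_right by (subst sum.swap) (simp only: mult.assoc)
    finally show ?thesis .
  qed
  moreover have "(\<Sum>c\<in>J. b i c * cnj (b j c)) = 0" if "i \<in> ?K" "j \<in> ?K" "i \<noteq> j" for i j
  proof -
    have "(\<Sum>c\<in>J. A' x c * cnj (b' j c)) = 0" if "j \<in> I" for j
    proof -
      have "(\<Sum>c\<in>J. A' x c * cnj (b' j c)) = cnj (\<Sum>c\<in>J. b' j c * cnj (A' x c))"
        by (simp add: mult.commute)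
      thus ?thesis using orthb[OF that] by simp
    qed
    thus ?thesis using that orthb orth nx by (auto simp: b_def)
  qed
  ultimately show ?case by blast
qed

lemma orthonormal_columns_norm:
  assumes "orthonormal_columns I P" "j \<in> I"
  shows "(\<Sum>r\<in>I. (cmod (P r j))\<^sup>2) = 1"
proof -
  have "complex_of_real (\<Sum>r\<in>I. (cmod (P r j))\<^sup>2) = (\<Sum>r\<in>I. cnj (P r j) * P r j)"
    by (simp add: complex_norm_square mult.commute del: of_real_power)
  also have "\<dots> = 1" using assms unfolding orthonormal_columns_def by auto
  finally show ?thesis by (simp only: of_real_eq_1_iff)
qed

lemma orthonormal_columns_contr:
  assumes "orthonormal_columns I P" "finite I"
  shows "contr I I P"
proof (rule contr_orthogonal_columns[OF assms(2,2)])
  fix i j assume ij: "i \<in> I" "j \<in> I" "i \<noteq> j"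
  have "(\<Sum>r\<in>I. cnj (P r j) * P r i) = (if j = i then 1 else 0)"
    using assms(1) ij(1,2) unfolding orthonormal_columns_def by blast
  thus "(\<Sum>r\<in>I. P r i * cnj (P r j)) = 0" using ij(3) by (simp add: mult.commute)
qed (simp add: orthonormal_columns_norm[OF assms(1)])

definition rnorm :: "'j set \<Rightarrow> ('j \<Rightarrow> complex) \<Rightarrow> real" where
  "rnorm J b = sqrt (\<Sum>c\<in>J. (cmod (b c))\<^sup>2)"

lemma rnorm_nonneg: "0 \<le> rnorm J b"
  by (simp add: rnorm_def sum_nonneg)

lemma rnorm_sq: "(rnorm J b)\<^sup>2 = (\<Sum>c\<in>J. (cmod (b c))\<^sup>2)"
  by (simp add: rnorm_def sum_nonneg)

lemma rnorm_sq_complex: "(\<Sum>c\<in>J. b c * cnj (b c)) = complex_of_real (rnorm J b * rnorm J b)"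
  using rnorm_sq[of J b, symmetric]
  by (simp only: power2_eq_square flip: of_real_sum complex_norm_square)

lemma rnorm_zero:
  assumes "finite J" "rnorm J b = 0" "c \<in> J"
  shows "b c = 0"
  using assms by (simp add: rnorm_def sum_nonneg_eq_0_iff)

text \<open>Holds for a zero row as well: division by zero returns 0, and norm 0 forces the entry
  itself to vanish.\<close>

lemma normalize_row:
  assumes "finite J" "c \<in> J"
  shows "b c = of_real (rnorm J b) * (b c / of_real (rnorm J b))"
  using rnorm_zero[OF assms(1) _ assms(2)] by (cases "rnorm J b = 0") auto

text \<open>A zero row normalises to zero, hence the columns have norm at most 1 rather than equal
  to 1.\<close>

lemma normalized_rows_contr:
  assumes "finite I" "finite J"
    and "\<And>i j. i \<in> I \<Longrightarrow> j \<in> I \<Longrightarrow> i \<noteq> j \<Longrightarrow> (\<Sum>c\<in>J. b i c * cnj (b j c)) = 0"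
  shows "contr J I (\<lambda>c i. b i c / of_real (rnorm J (b i)))"
proof (rule contr_orthogonal_columns[OF assms(2,1)])
  fix i j assume ij: "i \<in> I" "j \<in> I" "i \<noteq> j"
  have "(\<Sum>r\<in>J. b i r / of_real (rnorm J (b i)) * cnj (b j r / of_real (rnorm J (b j))))
      = (\<Sum>r\<in>J. b i r * cnj (b j r)) / (of_real (rnorm J (b i)) * of_real (rnorm J (b j)))"
    by (simp add: sum_divide_distrib)
  thus "(\<Sum>r\<in>J. b i r / of_real (rnorm J (b i)) * cnj (b j r / of_real (rnorm J (b j)))) = 0"
    using assms(3)[OF ij] by simp
next
  fix j
  have "(\<Sum>r\<in>J. (cmod (b j r / of_real (rnorm J (b j))))\<^sup>2) = (rnorm J (b j))\<^sup>2 / (rnorm J (b j))\<^sup>2"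
    by (simp add: norm_divide power_divide rnorm_nonneg rnorm_sq flip: sum_divide_distrib)
  thus "(\<Sum>r\<in>J. (cmod (b j r / of_real (rnorm J (b j))))\<^sup>2) \<le> 1" by simp
qed

text \<open>Both sides are the sum of the singular values. The upper bound adds up rank-one terms;
  the lower bound tests against the adjoint of the polar factor, built from \<open>P\<close> and the
  normalised rows.\<close>

lemma tn_orthogonal_rows:
  fixes A P b :: "'i mx"
  assumes fin: "finite I" and P: "orthonormal_columns I P"
    and dec: "\<And>r c. r \<in> I \<Longrightarrow> c \<in> I \<Longrightarrow> A r c = (\<Sum>i\<in>I. P r i * b i c)"
    and orth: "\<And>i j. i \<in> I \<Longrightarrow> j \<in> I \<Longrightarrow> i \<noteq> j \<Longrightarrow> (\<Sum>c\<in>I. b i c * cnj (b j c)) = 0"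
  shows "tn I A = (\<Sum>i\<in>I. rnorm I (b i))"
proof (rule antisym)
  have "tn I A = tn I (\<lambda>r c. \<Sum>i\<in>I. P r i * b i c)" by (rule tn_cong) (rule dec)
  also have "\<dots> \<le> (\<Sum>i\<in>I. tn I (\<lambda>r c. P r i * b i c))" by (rule tn_sum[OF fin fin])
  also have "\<dots> \<le> (\<Sum>i\<in>I. rnorm I (\<lambda>r. P r i) * rnorm I (b i))"
    unfolding rnorm_def by (intro sum_mono tn_rank1 fin)
  also have "\<dots> = (\<Sum>i\<in>I. rnorm I (b i))"
    by (intro sum.cong refl) (simp add: rnorm_def orthonormal_columns_norm[OF P])
  finally show "tn I A \<le> (\<Sum>i\<in>I. rnorm I (b i))" .
  define v where "v i c = b i c / of_real (rnorm I (b i))" for i c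
  have vb: "(\<Sum>c\<in>I. cnj (v i c) * b i c) = of_real (rnorm I (b i))" for i
  proof -
    have "(\<Sum>c\<in>I. cnj (v i c) * b i c) = (\<Sum>c\<in>I. b i c * cnj (b i c)) / of_real (rnorm I (b i))"
      by (simp add: v_def sum_divide_distrib mult.commute)
    thus ?thesis by (simp add: rnorm_sq_complex)
  qed
  have "contr I I (\<lambda>c i. cnj (v i c))"
    unfolding v_def by (rule contr_cnj[OF normalized_rows_contr[OF fin fin orth]])
  moreover have "contr I I (\<lambda>i r. cnj (P r i))"
    by (rule contr_transpose[OF contr_cnj[OF orthonormal_columns_contr[OF P fin]]])
  ultimately have W: "contr I I (\<lambda>c r. \<Sum>i\<in>I. cnj (v i c) * cnj (P r i))" by (rule contr_comp)
  have "(\<Sum>c\<in>I. \<Sum>r\<in>I. (\<Sum>i\<in>I. cnj (v i c) * cnj (P r i)) * A r c)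
    = (\<Sum>c\<in>I. \<Sum>r\<in>I. \<Sum>i\<in>I. \<Sum>j\<in>I. (cnj (P r i) * P r j) * (cnj (v i c) * b j c))"
    by (intro sum.cong refl) (simp only: dec sum_product, simp only: mult_ac)
  also have "\<dots> = (\<Sum>j\<in>I. \<Sum>i\<in>I. \<Sum>c\<in>I. \<Sum>r\<in>I. (cnj (P r i) * P r j) * (cnj (v i c) * b j c))"
    by (rule sum_swap4)
  also have "\<dots> = (\<Sum>j\<in>I. \<Sum>i\<in>I. (\<Sum>r\<in>I. cnj (P r i) * P r j) * (\<Sum>c\<in>I. cnj (v i c) * b j c))"
    by (simp only: sum_distrib_left sum_distrib_right)
  also have "\<dots> = (\<Sum>j\<in>I. \<Sum>i\<in>I. if i = j then (\<Sum>c\<in>I. cnj (v i c) * b i c) else 0)"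
    using P unfolding orthonormal_columns_def by (intro sum.cong refl) auto
  also have "\<dots> = of_real (\<Sum>i\<in>I. rnorm I (b i))" using fin by (simp add: vb)
  finally have "cmod (\<Sum>c\<in>I. \<Sum>r\<in>I. (\<Sum>i\<in>I. cnj (v i c) * cnj (P r i)) * A r c)
      = \<bar>\<Sum>i\<in>I. rnorm I (b i)\<bar>" by (simp only: norm_of_real)
  thus "(\<Sum>i\<in>I. rnorm I (b i)) \<le> tn I A"
    using tn_upper[OF fin W, of A] by simp
qed

section \<open>Positive square roots, and the agreement of \<open>trace_norm\<close> with
  \<open>tn\<close>\<close>

lemma psd_kernel:
  fixes R :: "'i mx"
  assumes fin: "finite I" and herm: "\<And>i j. i \<in> I \<Longrightarrow> j \<in> I \<Longrightarrow> cnj (R j i) = R i j"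
    and pos: "\<And>v. 0 \<le> Re (\<Sum>i\<in>I. \<Sum>j\<in>I. cnj (v i) * R i j * v j)"
    and zero: "Re (\<Sum>i\<in>I. \<Sum>j\<in>I. cnj (x i) * R i j * x j) = 0" and "i \<in> I"
  shows "(\<Sum>j\<in>I. R i j * x j) = 0"
proof (rule ccontr)
  assume nz: "(\<Sum>j\<in>I. R i j * x j) \<noteq> 0"
  define y where "y i = (\<Sum>j\<in>I. R i j * x j)" for i
  define n where "n = (\<Sum>i\<in>I. (cmod (y i))\<^sup>2)"
  define q where "q = Re (\<Sum>i\<in>I. \<Sum>j\<in>I. cnj (y i) * R i j * y j)"
  have n: "n > 0"
    unfolding n_def using nz \<open>i \<in> I\<close> fin by (intro sum_pos2[of I i]) (auto simp: y_def)
  have yx: "(\<Sum>i\<in>I. \<Sum>j\<in>I. cnj (y i) * R i j * x j) = of_real n"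
    by (simp only: mult.assoc sum_distrib_left[symmetric] y_def[symmetric])
      (simp add: n_def complex_norm_square mult.commute del: of_real_power)
  have xy: "(\<Sum>i\<in>I. \<Sum>j\<in>I. cnj (x i) * R i j * y j) = of_real n"
  proof -
    have "cnj (\<Sum>i\<in>I. \<Sum>j\<in>I. cnj (y i) * R i j * x j) = (\<Sum>i\<in>I. \<Sum>j\<in>I. cnj (x j) * R j i * y i)"
      using herm by (simp add: mult_ac)
    also have "\<dots> = (\<Sum>i\<in>I. \<Sum>j\<in>I. cnj (x i) * R i j * y j)" by (rule sum.swap)
    finally show ?thesis by (simp add: yx)
  qed
  \<comment> \<open>Evaluates the quadratic form at \<open>x + t * y\<close> with
    \<open>y = R x\<close>. The constant term is 0 by assumption, so the linear term
    \<open>2 * t * n\<close> with \<open>n > 0\<close> dominates for small negative \<open>t\<close>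
    and contradicts positivity.\<close>
  have "0 \<le> 2 * t * n + t\<^sup>2 * q" for t :: real
  proof -
    let ?v = "\<lambda>i. x i + of_real t * y i"
    have "(\<Sum>i\<in>I. \<Sum>j\<in>I. cnj (?v i) * R i j * ?v j)
      = (\<Sum>i\<in>I. \<Sum>j\<in>I. cnj (x i) * R i j * x j + of_real t * (cnj (x i) * R i j * y j)
        + of_real t * (cnj (y i) * R i j * x j) + of_real (t\<^sup>2) * (cnj (y i) * R i j * y j))"
      by (simp add: algebra_simps power2_eq_square)
    also have "\<dots> = (\<Sum>i\<in>I. \<Sum>j\<in>I. cnj (x i) * R i j * x j) + of_real t * of_real n
        + of_real t * of_real n + of_real (t\<^sup>2) * (\<Sum>i\<in>I. \<Sum>j\<in>I. cnj (y i) * R i j * y j)"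
      by (simp only: sum.distrib flip: sum_distrib_left) (simp only: xy yx)
    finally have "Re (\<Sum>i\<in>I. \<Sum>j\<in>I. cnj (?v i) * R i j * ?v j) = 2 * t * n + t\<^sup>2 * q"
      using zero by (simp add: q_def del: of_real_power)
    thus ?thesis using pos[of ?v] by simp
  qed
  \<comment> \<open>This \<open>t\<close> is small enough that the quadratic term takes back at most
    half of the linear gain.\<close>
  from this[of "- n / (\<bar>q\<bar> + 1)"]
  have "0 \<le> - 2 * n\<^sup>2 / (\<bar>q\<bar> + 1) + n\<^sup>2 * (q / (\<bar>q\<bar> + 1)\<^sup>2)"
    by (simp add: power_divide power2_eq_square)
  also have "\<dots> \<le> - 2 * n\<^sup>2 / (\<bar>q\<bar> + 1) + n\<^sup>2 * (1 / (\<bar>q\<bar> + 1))"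
  proof -
    have "q / (\<bar>q\<bar> + 1)\<^sup>2 \<le> 1 / (\<bar>q\<bar> + 1)"
      by (simp add: power2_eq_square divide_simps) (use abs_ge_self[of q] in \<open>simp add: add_nonneg_pos\<close>)
    thus ?thesis by (intro add_left_mono mult_left_mono) auto
  qed
  also have "\<dots> = - n\<^sup>2 / (\<bar>q\<bar> + 1)" by (simp add: divide_inverse)
  also have "\<dots> < 0" using n by (simp add: divide_less_0_iff add_nonneg_pos)
  finally show False by simp
qed

lemma adj_carrier[simp]: "A \<in> carrier_mat n m \<Longrightarrow> adj A \<in> carrier_mat m n"
  by (simp add: adj_def)

lemma adj_index: "A \<in> carrier_mat n m \<Longrightarrow> i < m \<Longrightarrow> j < n \<Longrightarrow> adj A $$ (i, j) = cnj (A $$ (j, i))"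
  by (simp add: adj_def)

lemma mat_mult_index:
  assumes "A \<in> carrier_mat n m" "B \<in> carrier_mat m l" "i < n" "j < l"
  shows "(A * B) $$ (i, j) = (\<Sum>k<m. A $$ (i, k) * B $$ (k, j))"
  using assms by (auto simp: scalar_prod_def lessThan_atLeast0 intro!: sum.cong)

lemma psd_iff:
  assumes "R \<in> carrier_mat d d"
  shows "psd R \<longleftrightarrow> (\<forall>i<d. \<forall>j<d. cnj (R $$ (j, i)) = R $$ (i, j)) \<and>
    (\<forall>v. 0 \<le> Re (\<Sum>i<d. \<Sum>j<d. cnj (v i) * R $$ (i, j) * v j))"
proof -
  have "adj R = R \<longleftrightarrow> (\<forall>i<d. \<forall>j<d. cnj (R $$ (j, i)) = R $$ (i, j))"
    using assms by (auto simp: adj_def mat_eq_iff)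
  moreover have q: "conjugate v \<bullet> (R *\<^sub>v v) = (\<Sum>i<d. \<Sum>j<d. cnj (v $ i) * R $$ (i, j) * v $ j)"
    if "v \<in> carrier_vec d" for v
    using assms that
    by (auto simp: scalar_prod_def lessThan_atLeast0 sum_distrib_left mult.assoc intro!: sum.cong)
  moreover have "(\<forall>v\<in>carrier_vec d. 0 \<le> Re (\<Sum>i<d. \<Sum>j<d. cnj (v $ i) * R $$ (i, j) * v $ j))
    \<longleftrightarrow> (\<forall>v. 0 \<le> Re (\<Sum>i<d. \<Sum>j<d. cnj (v i) * R $$ (i, j) * v j))"
  proof safe
    fix v :: "nat \<Rightarrow> complex"
    assume *: "\<forall>v\<in>carrier_vec d. 0 \<le> Re (\<Sum>i<d. \<Sum>j<d. cnj (v $ i) * R $$ (i, j) * v $ j)"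
    have "(\<Sum>i<d. \<Sum>j<d. cnj (vec d v $ i) * R $$ (i, j) * vec d v $ j)
       = (\<Sum>i<d. \<Sum>j<d. cnj (v i) * R $$ (i, j) * v j)" by (intro sum.cong refl) simp
    thus "0 \<le> Re (\<Sum>i<d. \<Sum>j<d. cnj (v i) * R $$ (i, j) * v j)" using *[rule_format, of "vec d v"] by simp
  qed blast
  ultimately show ?thesis using assms unfolding psd_def by auto
qed

lemma mtrace_add: "A \<in> carrier_mat d d \<Longrightarrow> B \<in> carrier_mat d d \<Longrightarrow> mtrace (A + B) = mtrace A + mtrace B"
  by (simp add: mtrace_def sum.distrib)

lemma mtrace_minus: "A \<in> carrier_mat d d \<Longrightarrow> B \<in> carrier_mat d d \<Longrightarrow> mtrace (A - B) = mtrace A - mtrace B"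
  by (simp add: mtrace_def sum_subtractf)

lemma mtrace_comm:
  assumes "A \<in> carrier_mat d d" "B \<in> carrier_mat d d"
  shows "mtrace (A * B) = mtrace (B * A)"
proof -
  have "mtrace (A * B) = (\<Sum>i<d. \<Sum>k<d. A $$ (i, k) * B $$ (k, i))"
    using assms by (simp add: mtrace_def mat_mult_index[OF assms] del: index_mult_mat(1))
  also have "\<dots> = (\<Sum>i<d. \<Sum>k<d. B $$ (i, k) * A $$ (k, i))"
    by (subst sum.swap) (simp add: mult.commute)
  also have "\<dots> = mtrace (B * A)"
    using assms by (simp add: mtrace_def mat_mult_index[OF assms(2,1)] del: index_mult_mat(1))
  finally show ?thesis .
qed

text \<open>As \<open>D\<close> is self-adjoint, the trace is the sum of the quadratic forms of
  \<open>R\<close> over the columns of \<open>D\<close>; if it vanishes, every column lies in the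
  kernel of \<open>R\<close>.\<close>

lemma psd_sandwich:
  assumes R: "R \<in> carrier_mat d d" "psd R" and D: "D \<in> carrier_mat d d" "adj D = D"
  shows "0 \<le> Re (mtrace (D * R * D))"
    and "Re (mtrace (D * R * D)) = 0 \<Longrightarrow> R * D = 0\<^sub>m d d"
proof -
  have herm: "D $$ (t, i) = cnj (D $$ (i, t))" if "i < d" "t < d" for i t
    using D adj_index[OF D(1), of t i] that by simp
  have Rh: "\<And>i j. i < d \<Longrightarrow> j < d \<Longrightarrow> cnj (R $$ (j, i)) = R $$ (i, j)"
    and Rp: "\<And>v. 0 \<le> Re (\<Sum>i<d. \<Sum>j<d. cnj (v i) * R $$ (i, j) * v j)"
    using R psd_iff[OF R(1)] by auto
  define f where "f t = Re (\<Sum>i<d. \<Sum>j<d. cnj (D $$ (i, t)) * R $$ (i, j) * D $$ (j, t))" for t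
  have "mtrace (D * R * D) = mtrace (D * (R * D))" using R D by (simp add: assoc_mult_mat[of D d d R d D d])
  also have "\<dots> = (\<Sum>t<d. (\<Sum>i<d. D $$ (t, i) * (\<Sum>j<d. R $$ (i, j) * D $$ (j, t))))"
    using R(1) D(1) by (simp add: mtrace_def mat_mult_index[of D d d "R * D" d]
       mat_mult_index[of R d d D d] del: index_mult_mat(1))
  also have "\<dots> = (\<Sum>t<d. \<Sum>i<d. \<Sum>j<d. cnj (D $$ (i, t)) * R $$ (i, j) * D $$ (j, t))"
  proof (intro sum.cong refl)
    fix t i assume "t \<in> {..<d}" "i \<in> {..<d}"
    hence "D $$ (t, i) = cnj (D $$ (i, t))" using herm[of i t] by simp
    thus "D $$ (t, i) * (\<Sum>j<d. R $$ (i, j) * D $$ (j, t))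
        = (\<Sum>j<d. cnj (D $$ (i, t)) * R $$ (i, j) * D $$ (j, t))"
      by (simp only: sum_distrib_left mult.assoc)
  qed
  finally have tr: "Re (mtrace (D * R * D)) = (\<Sum>t<d. f t)" by (simp add: f_def)
  have f0: "0 \<le> f t" for t unfolding f_def by (rule Rp)
  show "0 \<le> Re (mtrace (D * R * D))" using f0 tr by (simp add: sum_nonneg)
  assume "Re (mtrace (D * R * D)) = 0"
  hence "(\<Sum>t<d. f t) = 0" using tr by simp
  hence ft: "f t = 0" if "t < d" for t using that f0 by (simp add: sum_nonneg_eq_0_iff)
  have "(R * D) $$ (i, t) = 0" if "i < d" "t < d" for i t
  proof -
    have "(\<Sum>j<d. R $$ (i, j) * D $$ (j, t)) = 0"
      by (rule psd_kernel[of "{..<d}" "\<lambda>i j. R $$ (i, j)" "\<lambda>j. D $$ (j, t)"])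
        (use Rh Rp ft[OF that(2)] that in \<open>auto simp: f_def\<close>)
    thus ?thesis using mat_mult_index[OF R(1) D(1) that] by simp
  qed
  thus "R * D = 0\<^sub>m d d" using R(1) D(1) by (intro eq_matI) auto
qed

text \<open>With \<open>D = R1 - R2\<close>, equal squares make the trace of \<open>D * (R1 + R2) * D\<close> vanish.\<close>
lemma psd_sqrt_unique:
  assumes R1: "R1 \<in> carrier_mat d d" "psd R1" and R2: "R2 \<in> carrier_mat d d" "psd R2"
    and eq: "R1 * R1 = R2 * R2"
  shows "R1 = R2"
proof -
  define D where "D = R1 - R2"
  have D: "D \<in> carrier_mat d d" unfolding D_def using R2(1) by (rule minus_carrier_mat)
  have h: "\<And>i j. i < d \<Longrightarrow> j < d \<Longrightarrow> cnj (R1 $$ (j, i)) = R1 $$ (i, j)"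
     "\<And>i j. i < d \<Longrightarrow> j < d \<Longrightarrow> cnj (R2 $$ (j, i)) = R2 $$ (i, j)"
    using R1 R2 psd_iff[OF R1(1)] psd_iff[OF R2(1)] by auto
  have Dh: "adj D = D"
    by (rule eq_matI) (use D R1 R2 h in \<open>auto simp: adj_def D_def\<close>)
  note c = R1(1) R2(1) D
  have "mtrace (D * R1 * D) + mtrace (D * R2 * D) = mtrace (D * R1 * D + D * R2 * D)"
    using c by (intro mtrace_add[symmetric]) auto
  also have "D * R1 * D + D * R2 * D = (D * R1 + D * R2) * D"
    using c by (intro add_mult_distrib_mat[symmetric]) auto
  \<comment> \<open>The squares cancel, and what remains is a commutator whose product with
    \<open>D\<close> has trace zero by cyclicity.\<close>
  also have "D * R1 + D * R2 = R1 * R2 - R2 * R1"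
  proof -
    have "D * R1 = R1 * R1 - R2 * R1" "D * R2 = R1 * R2 - R2 * R2"
      unfolding D_def using c by (auto intro!: minus_mult_distrib_mat)
    moreover have "(C - B) + (A - C) = A - B"
      if "A \<in> carrier_mat d d" "B \<in> carrier_mat d d" "C \<in> carrier_mat d d" for A B C :: "complex mat"
      using that by (intro eq_matI) auto
    ultimately show ?thesis using c unfolding eq by simp
  qed
  also have "mtrace ((R1 * R2 - R2 * R1) * D) = mtrace (R1 * R2 * D) - mtrace (R2 * R1 * D)"
    using c by (subst minus_mult_distrib_mat[of _ d d _ _ d]) (auto intro!: mtrace_minus)
  also have "mtrace (R1 * R2 * D) = mtrace (R1 * R2 * R1) - mtrace (R1 * R2 * R2)"
    unfolding D_def using c by (subst mult_minus_distrib_mat[of _ d d _ d]) (auto intro!: mtrace_minus)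
  also have "mtrace (R2 * R1 * D) = mtrace (R2 * R1 * R1) - mtrace (R2 * R1 * R2)"
    unfolding D_def using c by (subst mult_minus_distrib_mat[of _ d d _ d]) (auto intro!: mtrace_minus)
  also have "mtrace (R1 * R2 * R1) = mtrace (R2 * R1 * R1)"
    using c mtrace_comm[of "R1 * R2" d R1] mtrace_comm[of "R1 * R1" d R2]
    by (simp add: assoc_mult_mat[of R1 d d R1 d R2 d] assoc_mult_mat[of R2 d d R1 d R1 d])
  also have "mtrace (R1 * R2 * R2) = mtrace (R2 * R1 * R2)"
    using c mtrace_comm[of "R1 * R2" d R2]
    by (simp add: assoc_mult_mat[of R2 d d R1 d R2 d])
  finally have "mtrace (D * R1 * D) + mtrace (D * R2 * D) = 0" by simp
  hence "Re (mtrace (D * R1 * D)) + Re (mtrace (D * R2 * D)) = 0"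
    by (metis plus_complex.sel(1) zero_complex.sel(1))
  hence z: "R1 * D = 0\<^sub>m d d" "R2 * D = 0\<^sub>m d d"
    using psd_sandwich[OF R1 D Dh] psd_sandwich[OF R2 D Dh] by auto
  have "D * D = R1 * D - R2 * D"
    unfolding D_def using c by (intro minus_mult_distrib_mat) auto
  hence "adj D * D = 0\<^sub>m d d" using z Dh by simp
  have "D $$ (i, j) = 0" if "i < d" "j < d" for i j
  proof -
    have "0 = (adj D * D) $$ (j, j)" using \<open>adj D * D = 0\<^sub>m d d\<close> that by simp
    also have "\<dots> = (\<Sum>k<d. cnj (D $$ (k, j)) * D $$ (k, j))"
      using that D by (subst mat_mult_index[of "adj D" d d D d]) (auto simp: adj_index)
    also have "\<dots> = of_real (\<Sum>k<d. (cmod (D $$ (k, j)))\<^sup>2)"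
      by (simp add: complex_norm_square mult.commute del: of_real_power)
    finally have "(\<Sum>k<d. (cmod (D $$ (k, j)))\<^sup>2) = 0" using of_real_eq_0_iff by metis
    thus ?thesis using that by (simp add: sum_nonneg_eq_0_iff)
  qed
  thus "R1 = R2" using R1 R2 by (intro eq_matI) (auto simp: D_def)
qed

text \<open>The decomposition gives the square root of \<open>adj A * A\<close> explicitly:
  \<open>R\<close> has the eigenvalues \<open>s i\<close> on the conjugated normalised rows.
  Uniqueness of the root evaluates the definite description, and the trace of \<open>R\<close> is
  the sum of the \<open>s i\<close>.\<close>

lemma trace_norm_eq_tn:
  assumes A: "A \<in> carrier_mat d d"
  shows "trace_norm A = tn {..<d} (\<lambda>i j. A $$ (i, j))"
proof -
  let ?I = "{..<d}"
  obtain P b where P: "orthonormal_columns ?I P"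
    and dec: "\<And>r c. r \<in> ?I \<Longrightarrow> c \<in> ?I \<Longrightarrow> A $$ (r, c) = (\<Sum>i\<in>?I. P r i * b i c)"
    and orth: "\<And>i j. i \<in> ?I \<Longrightarrow> j \<in> ?I \<Longrightarrow> i \<noteq> j \<Longrightarrow> (\<Sum>c\<in>?I. b i c * cnj (b j c)) = 0"
    using ex_orthogonal_rows[of ?I ?I "\<lambda>r c. A $$ (r, c)"] by blast
  define s where "s i = rnorm ?I (b i)" for i
  define v where "v i c = b i c / of_real (s i)" for i c
  have s0: "0 \<le> s i" for i by (simp add: s_def rnorm_nonneg)
  have bb: "(\<Sum>c\<in>?I. b i c * cnj (b j c)) = (if i = j then of_real (s i * s i) else 0)"
    if "i < d" "j < d" for i j
    using orth that rnorm_sq_complex[of "b i" ?I] by (auto simp: s_def)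
  have bv: "b i c = of_real (s i) * v i c" if "c < d" for i c
    unfolding v_def s_def using normalize_row[of ?I c "b i"] that by simp
  define R where "R = mat d d (\<lambda>(c, c'). \<Sum>i<d. of_real (s i) * cnj (v i c) * v i c')"
  have Rc: "R \<in> carrier_mat d d" by (simp add: R_def)
  have Ri: "R $$ (c, c') = (\<Sum>i<d. of_real (s i) * cnj (v i c) * v i c')" if "c < d" "c' < d" for c c'
    using that by (simp add: R_def)
  have psd: "psd R"
    unfolding psd_iff[OF Rc]
  proof (intro conjI allI impI)
    fix i j assume "i < d" "j < d"
    thus "cnj (R $$ (j, i)) = R $$ (i, j)" by (simp add: Ri mult_ac)
  next
    fix x :: "nat \<Rightarrow> complex"
    have "(\<Sum>i<d. \<Sum>j<d. cnj (x i) * R $$ (i, j) * x j)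
      = (\<Sum>i<d. \<Sum>j<d. \<Sum>k<d. of_real (s k) * (cnj (v k i * x i) * (v k j * x j)))"
      by (intro sum.cong refl) (simp add: Ri sum_distrib_left sum_distrib_right mult_ac)
    also have "\<dots> = (\<Sum>k<d. of_real (s k) * (cnj (\<Sum>i<d. v k i * x i) * (\<Sum>j<d. v k j * x j)))"
      by (simp only: cnj_sum sum_product, simp only: sum_distrib_left)
        (rule sum_swap3)
    also have "\<dots> = of_real (\<Sum>k<d. s k * (cmod (\<Sum>i<d. v k i * x i))\<^sup>2)"
      by (simp add: complex_norm_square mult.commute del: of_real_power cnj_sum)
    finally show "0 \<le> Re (\<Sum>i<d. \<Sum>j<d. cnj (x i) * R $$ (i, j) * x j)"
      using s0 by (simp add: sum_nonneg)
  qed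
  have RR: "R * R = adj A * A"
  proof (rule eq_matI)
    fix c c' assume "c < dim_row (adj A * A)" "c' < dim_col (adj A * A)"
    hence cc: "c < d" "c' < d" using A by (simp_all add: adj_def)
    have "(R * R) $$ (c, c') = (\<Sum>e<d. (\<Sum>i<d. of_real (s i) * cnj (v i c) * v i e) * (\<Sum>j<d. of_real (s j) * cnj (v j e) * v j c'))"
      using cc by (simp add: mat_mult_index[OF Rc Rc] Ri del: index_mult_mat(1))
    also have "\<dots> = (\<Sum>e<d. \<Sum>i<d. \<Sum>j<d. (cnj (v i c) * v j c') * (b i e * cnj (b j e)))"
      by (intro sum.cong refl) (simp add: sum_product bv mult_ac)
    also have "\<dots> = (\<Sum>i<d. \<Sum>j<d. (cnj (v i c) * v j c') * (\<Sum>e<d. b i e * cnj (b j e)))"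
      by (subst sum.swap, rule sum.cong[OF refl], subst sum.swap) (simp only: sum_distrib_left)
    also have "\<dots> = (\<Sum>i<d. \<Sum>j<d. if i = j then cnj (b i c) * b i c' else 0)"
      by (intro sum.cong refl, subst bb) (use cc in \<open>auto simp: bv\<close>)
    also have "\<dots> = (\<Sum>i<d. cnj (b i c) * b i c')" by simp
    finally have 1: "(R * R) $$ (c, c') = (\<Sum>i<d. cnj (b i c) * b i c')" .
    have "(adj A * A) $$ (c, c') = (\<Sum>r<d. cnj (\<Sum>i<d. P r i * b i c) * (\<Sum>i<d. P r i * b i c'))"
      using cc A by (simp add: mat_mult_index[of "adj A" d d A d] adj_index dec del: index_mult_mat(1))
    also have "\<dots> = (\<Sum>r<d. \<Sum>i<d. \<Sum>j<d. (cnj (b i c) * b j c') * (cnj (P r i) * P r j))"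
      by (simp only: cnj_sum sum_product) (simp only: complex_cnj_mult mult_ac)
    also have "\<dots> = (\<Sum>i<d. \<Sum>j<d. (cnj (b i c) * b j c') * (\<Sum>r<d. cnj (P r i) * P r j))"
      by (subst sum.swap, rule sum.cong[OF refl], subst sum.swap) (simp only: sum_distrib_left)
    also have "\<dots> = (\<Sum>i<d. \<Sum>j<d. if i = j then cnj (b i c) * b j c' else 0)"
      using P unfolding orthonormal_columns_def by (intro sum.cong refl) auto
    also have "\<dots> = (\<Sum>i<d. cnj (b i c) * b i c')" by simp
    finally show "(R * R) $$ (c, c') = (adj A * A) $$ (c, c')" using 1 by simp
  qed (use A Rc in \<open>auto simp: adj_def\<close>)
  have "(THE R. R \<in> carrier_mat (dim_col A) (dim_col A) \<and> psd R \<and> R * R = adj A * A) = R"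
  proof (rule the_equality)
    show "R \<in> carrier_mat (dim_col A) (dim_col A) \<and> psd R \<and> R * R = adj A * A"
      using A Rc psd RR by simp
  next
    fix R' assume R': "R' \<in> carrier_mat (dim_col A) (dim_col A) \<and> psd R' \<and> R' * R' = adj A * A"
    show "R' = R"
      by (rule psd_sqrt_unique[OF _ _ Rc psd]) (use R' A RR in simp_all)
  qed
  hence "trace_norm A = Re (mtrace R)" by (simp add: trace_norm_def)
  also have "mtrace R = (\<Sum>c<d. \<Sum>i<d. of_real (s i) * (v i c * cnj (v i c)))"
    using Rc by (simp add: mtrace_def Ri mult_ac)
  also have "\<dots> = (\<Sum>i<d. of_real (s i) * (\<Sum>c<d. v i c * cnj (v i c)))"
    by (subst sum.swap) (simp only: sum_distrib_left)
  also have "\<dots> = (\<Sum>i<d. of_real (s i))"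
  proof (rule sum.cong[OF refl])
    fix i assume i: "i \<in> {..<d}"
    have "(\<Sum>c<d. v i c * cnj (v i c)) = (\<Sum>c<d. b i c * cnj (b i c)) / of_real (s i * s i)"
      by (simp add: v_def sum_divide_distrib)
    \<comment> \<open>For \<open>s i = 0\<close> the division returns 0 and both sides
      vanish.\<close>
    thus "of_real (s i) * (\<Sum>c<d. v i c * cnj (v i c)) = complex_of_real (s i)"
      using i bb[of i i] by simp
  qed
  finally have "trace_norm A = (\<Sum>i<d. s i)" by simp
  also have "\<dots> = tn ?I (\<lambda>i j. A $$ (i, j))"
    using tn_orthogonal_rows[OF _ P dec orth] by (simp add: s_def)
  finally show ?thesis .
qed

section \<open>Reference systems and the diamond norm\<close>

text \<open>\<open>\<phi>\<close> tensored with the identity on a reference with basis \<open>'r\<close>.\<close>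
definition lift :: "('a mx \<Rightarrow> 'b \<Rightarrow> 'b \<Rightarrow> complex)
    \<Rightarrow> ('a \<times> 'r \<Rightarrow> 'a \<times> 'r \<Rightarrow> complex) \<Rightarrow> 'b \<times> 'r \<Rightarrow> 'b \<times> 'r \<Rightarrow> complex" where
  "lift \<phi> X = (\<lambda>p q. \<phi> (\<lambda>S T. X (S, snd p) (T, snd q)) (fst p) (fst q))"

lemma lift_comp: "lift (\<lambda>x. \<phi> (\<psi> x)) X = lift \<phi> (lift \<psi> X)"
  by (simp add: lift_def)

lemma sum_tensor_right:
  fixes F :: "'a \<times> 'b \<Rightarrow> complex"
  assumes "finite I" "x \<in> I"
  shows "(\<Sum>a\<in>I\<times>J. (if x = fst a then V (snd a) else 0) * F a) = (\<Sum>g\<in>J. V g * F (x, g))"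
proof -
  have "(\<Sum>a\<in>I\<times>J. (if x = fst a then V (snd a) else 0) * F a)
      = (\<Sum>i\<in>I. if i = x then (\<Sum>g\<in>J. V g * F (x, g)) else 0)"
    unfolding sum.cartesian_product' by (intro sum.cong) auto
  thus ?thesis using assms by simp
qed

text \<open>Contractions on the reference alone cannot increase the norm. The two sides may use
  different contractions, as the left and right vectors of a rank-one operator require.\<close>

lemma tn_conj_right:
  assumes "finite I" "finite J" "finite R" "contr R J V" "contr R J W"
  shows "tn (I \<times> R) (\<lambda>p q. \<Sum>g\<in>J. \<Sum>g'\<in>J. V (snd p) g * W (snd q) g' * Y (fst p, g) (fst q, g'))
      \<le> tn (I \<times> J) Y"
proof -
  let ?V = "\<lambda>V a b. if fst a = fst b then V (snd a) (snd b) else 0"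
  have "tn (I \<times> R) (\<lambda>p q. \<Sum>g\<in>J. \<Sum>g'\<in>J. V (snd p) g * W (snd q) g' * Y (fst p, g) (fst q, g'))
    = tn (I \<times> R) (\<lambda>p q. \<Sum>a\<in>I\<times>J. \<Sum>b\<in>I\<times>J. ?V V p a * Y a b * ?V W q b)"
  proof (rule tn_cong)
    fix p q assume pq: "p \<in> I \<times> R" "q \<in> I \<times> R"
    hence m: "fst p \<in> I" "fst q \<in> I" by auto
    have "(\<Sum>a\<in>I\<times>J. \<Sum>b\<in>I\<times>J. ?V V p a * Y a b * ?V W q b)
      = (\<Sum>a\<in>I\<times>J. ?V V p a * (\<Sum>b\<in>I\<times>J. ?V W q b * Y a b))"
      by (simp only: sum_distrib_left mult_ac)
    also have "\<dots> = (\<Sum>g\<in>J. V (snd p) g * (\<Sum>g'\<in>J. W (snd q) g' * Y (fst p, g) (fst q, g')))"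
      unfolding sum_tensor_right[OF assms(1) m(1), where V = "V (snd p)"]
      by (intro sum.cong refl arg_cong2[of _ _ _ _ "(*)"] sum_tensor_right[OF assms(1) m(2), where V = "W (snd q)"])
    finally show "(\<Sum>g\<in>J. \<Sum>g'\<in>J. V (snd p) g * W (snd q) g' * Y (fst p, g) (fst q, g'))
      = (\<Sum>a\<in>I\<times>J. \<Sum>b\<in>I\<times>J. ?V V p a * Y a b * ?V W q b)"
      by (simp only: sum_distrib_left mult.assoc)
  qed
  also have "\<dots> \<le> tn (I \<times> J) Y"
    using assms by (intro tn_conj contr_tensor_right) auto
  finally show ?thesis .
qed

lemma tn_conj_left:
  assumes "finite I" "finite J" "finite R" "contr I J V" "contr I J W"
  shows "tn (I \<times> R) (\<lambda>p q. \<Sum>g\<in>J. \<Sum>g'\<in>J. V (fst p) g * Y (g, snd p) (g', snd q) * W (fst q) g')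
      \<le> tn (J \<times> R) Y"
proof -
  have bij: "bij_betw prod.swap (R \<times> A) (A \<times> R)" for A :: "'x set"
    by (rule bij_betw_byWitness[where f' = prod.swap]) auto
  let ?Y = "\<lambda>p q. Y (prod.swap p) (prod.swap q)"
  have "tn (I \<times> R) (\<lambda>p q. \<Sum>g\<in>J. \<Sum>g'\<in>J. V (fst p) g * Y (g, snd p) (g', snd q) * W (fst q) g')
    = tn (R \<times> I) (\<lambda>p q. \<Sum>g\<in>J. \<Sum>g'\<in>J. V (snd p) g * W (snd q) g' * ?Y (fst p, g) (fst q, g'))"
    using tn_bij[OF _ bij[of I], of "\<lambda>p q. \<Sum>g\<in>J. \<Sum>g'\<in>J. V (fst p) g * Y (g, snd p) (g', snd q) * W (fst q) g'"]
      assms(1,3) by (simp add: mult_ac)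
  also have "\<dots> \<le> tn (R \<times> J) ?Y" by (rule tn_conj_right[OF assms(3,2,1,4,5)])
  also have "\<dots> = tn (J \<times> R) Y" using assms(2,3) by (intro tn_bij[OF _ bij]) simp
  finally show ?thesis .
qed

text \<open>Schmidt decomposition of \<open>u\<close> read as a \<open>J\<close> by \<open>R\<close>
  matrix: the normalised rows form the contraction \<open>V\<close> and the row norms go into
  \<open>u'\<close>, so the reference is fed from only \<open>J\<close> many directions and the norm
  does not grow.\<close>

lemma tensor_vector_factor:
  fixes u :: "'j \<times> 'r \<Rightarrow> complex"
  assumes "finite J" "finite R"
  shows "\<exists>V u'. contr R J V \<and> (\<forall>h\<in>J. \<forall>k\<in>R. u (h, k) = (\<Sum>g\<in>J. V k g * u' (h, g)))
    \<and> rnorm (J \<times> J) u' \<le> rnorm (J \<times> R) u"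
proof -
  obtain P B where P: "orthonormal_columns J P"
    and dec: "\<And>h k. h \<in> J \<Longrightarrow> k \<in> R \<Longrightarrow> u (h, k) = (\<Sum>g\<in>J. P h g * B g k)"
    and orth: "\<And>i j. i \<in> J \<Longrightarrow> j \<in> J \<Longrightarrow> i \<noteq> j \<Longrightarrow> (\<Sum>c\<in>R. B i c * cnj (B j c)) = 0"
    using ex_orthogonal_rows[OF assms, of "\<lambda>h k. u (h, k)"] by blast
  define V where "V k g = B g k / of_real (rnorm R (B g))" for k g
  define u' where "u' p = P (fst p) (snd p) * of_real (rnorm R (B (snd p)))" for p
  have "contr R J V"
    unfolding V_def using normalized_rows_contr[OF assms orth] by simp
  moreover have "u (h, k) = (\<Sum>g\<in>J. V k g * u' (h, g))" if "h \<in> J" "k \<in> R" for h k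
    unfolding dec[OF that]
  proof (rule sum.cong[OF refl])
    fix g
    have "P h g * B g k = P h g * (of_real (rnorm R (B g)) * (B g k / of_real (rnorm R (B g))))"
      by (rule arg_cong[OF normalize_row[OF assms(2) that(2)]])
    also have "\<dots> = V k g * u' (h, g)" by (simp only: V_def u'_def fst_conv snd_conv mult_ac)
    finally show "P h g * B g k = V k g * u' (h, g)" .
  qed
  moreover have "rnorm (J \<times> J) u' \<le> rnorm (J \<times> R) u"
  proof -
    have Bu: "B g k = (\<Sum>h\<in>J. cnj (P h g) * u (h, k))" if "g \<in> J" "k \<in> R" for g k
    proof -
      have "(\<Sum>h\<in>J. cnj (P h g) * u (h, k)) = (\<Sum>h\<in>J. \<Sum>j\<in>J. cnj (P h g) * P h j * B j k)"
        using that by (intro sum.cong refl) (simp add: dec sum_distrib_left mult.assoc)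
      also have "\<dots> = (\<Sum>j\<in>J. (\<Sum>h\<in>J. cnj (P h g) * P h j) * B j k)"
        by (subst sum.swap) (simp only: sum_distrib_right)
      also have "\<dots> = (\<Sum>j\<in>J. if j = g then B j k else 0)"
        using P that unfolding orthonormal_columns_def by (intro sum.cong refl) auto
      finally show ?thesis using that assms by simp
    qed
    have "(rnorm (J \<times> J) u')\<^sup>2 = (\<Sum>h\<in>J. \<Sum>g\<in>J. (cmod (P h g))\<^sup>2 * (rnorm R (B g))\<^sup>2)"
      unfolding rnorm_sq[of "J \<times> J"] sum.cartesian_product'
      by (simp add: u'_def norm_mult power_mult_distrib)
    also have "\<dots> = (\<Sum>g\<in>J. (rnorm R (B g))\<^sup>2)"
      by (subst sum.swap) (simp add: orthonormal_columns_norm[OF P] flip: sum_distrib_right)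
    also have "\<dots> = (\<Sum>k\<in>R. \<Sum>g\<in>J. (cmod (\<Sum>h\<in>J. cnj (P h g) * u (h, k)))\<^sup>2)"
      unfolding rnorm_sq by (subst sum.swap) (simp add: Bu)
    also have "\<dots> \<le> (\<Sum>k\<in>R. \<Sum>h\<in>J. (cmod (u (h, k)))\<^sup>2)"
      using contr_transpose[OF contr_cnj[OF orthonormal_columns_contr[OF P assms(1)]]]
      by (intro sum_mono contrD)
    also have "\<dots> = (rnorm (J \<times> R) u)\<^sup>2"
      unfolding rnorm_sq sum.cartesian_product' by (rule sum.swap)
    finally show ?thesis by (rule power2_le_imp_le) (rule rnorm_nonneg)
  qed
  ultimately show ?thesis by blast
qed

text \<open>A reference system as large as the input already realises the stabilised norm: after
  splitting the argument into rank-one operators, each of the two vectors factors through a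
  contraction on the reference.\<close>
lemma tn_lift_reduce:
  fixes J :: "'j set" and \<kappa> :: "'i \<Rightarrow> 'i \<Rightarrow> 'j \<Rightarrow> 'j \<Rightarrow> complex" and X :: "'j \<times> 'r \<Rightarrow> 'j \<times> 'r \<Rightarrow> complex"
  defines "\<phi> \<equiv> \<lambda>x S T. \<Sum>p\<in>J. \<Sum>p'\<in>J. \<kappa> S T p p' * x p p'"
  assumes fin: "finite I" "finite J" "finite R" and c: "0 \<le> c"
    and bound: "\<And>X :: 'j \<times> 'j \<Rightarrow> 'j \<times> 'j \<Rightarrow> complex. tn (I \<times> J) (lift \<phi> X) \<le> c * tn (J \<times> J) X"
  shows "tn (I \<times> R) (lift \<phi> X) \<le> c * tn (J \<times> R) X"
proof -
  have rank1: "tn (I \<times> R) (lift \<phi> (\<lambda>p q. u p * w q)) \<le> c * (rnorm (J \<times> R) u * rnorm (J \<times> R) w)"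
    for u w :: "'j \<times> 'r \<Rightarrow> complex"
  proof -
    obtain V u' where V: "contr R J V" and u: "\<And>h k. h \<in> J \<Longrightarrow> k \<in> R \<Longrightarrow> u (h, k) = (\<Sum>g\<in>J. V k g * u' (h, g))"
      and nu: "rnorm (J \<times> J) u' \<le> rnorm (J \<times> R) u"
      using tensor_vector_factor[OF fin(2,3), of u] by blast
    obtain W w' where W: "contr R J W" and w: "\<And>h k. h \<in> J \<Longrightarrow> k \<in> R \<Longrightarrow> w (h, k) = (\<Sum>g\<in>J. W k g * w' (h, g))"
      and nw: "rnorm (J \<times> J) w' \<le> rnorm (J \<times> R) w"
      using tensor_vector_factor[OF fin(2,3), of w] by blast
    have "tn (I \<times> R) (lift \<phi> (\<lambda>p q. u p * w q))
      = tn (I \<times> R) (\<lambda>p q. \<Sum>g\<in>J. \<Sum>g'\<in>J. V (snd p) g * W (snd q) g' * lift \<phi> (\<lambda>p q. u' p * w' q) (fst p, g) (fst q, g'))"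
    proof (rule tn_cong)
      fix p q assume pq: "p \<in> I \<times> R" "q \<in> I \<times> R"
      hence m: "snd p \<in> R" "snd q \<in> R" by auto
      have "lift \<phi> (\<lambda>p q. u p * w q) p q
        = (\<Sum>h\<in>J. \<Sum>h'\<in>J. \<kappa> (fst p) (fst q) h h' * (\<Sum>g\<in>J. \<Sum>g'\<in>J. V (snd p) g * u' (h, g) * (W (snd q) g' * w' (h', g'))))"
        unfolding lift_def \<phi>_def
        by (intro sum.cong refl) (simp add: u[OF _ m(1)] w[OF _ m(2)] sum_product)
      also have "\<dots> = (\<Sum>h\<in>J. \<Sum>h'\<in>J. \<Sum>g\<in>J. \<Sum>g'\<in>J. V (snd p) g * W (snd q) g' * (\<kappa> (fst p) (fst q) h h' * (u' (h, g) * w' (h', g'))))"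
        by (simp only: sum_distrib_left mult_ac)
      also have "\<dots> = (\<Sum>h\<in>J. \<Sum>h'\<in>J. \<Sum>g'\<in>J. \<Sum>g\<in>J. V (snd p) g * W (snd q) g' * (\<kappa> (fst p) (fst q) h h' * (u' (h, g) * w' (h', g'))))"
        by (rule sum.cong[OF refl], rule sum.cong[OF refl], rule sum.swap)
      also have "\<dots> = (\<Sum>g\<in>J. \<Sum>g'\<in>J. \<Sum>h\<in>J. \<Sum>h'\<in>J. V (snd p) g * W (snd q) g' * (\<kappa> (fst p) (fst q) h h' * (u' (h, g) * w' (h', g'))))"
        by (rule sum_swap4)
      finally show "lift \<phi> (\<lambda>p q. u p * w q) p q = (\<Sum>g\<in>J. \<Sum>g'\<in>J. V (snd p) g * W (snd q) g' * lift \<phi> (\<lambda>p q. u' p * w' q) (fst p, g) (fst q, g'))"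
        by (simp only: lift_def \<phi>_def fst_conv snd_conv sum_distrib_left)
    qed
    also have "\<dots> \<le> tn (I \<times> J) (lift \<phi> (\<lambda>p q. u' p * w' q))"
      by (rule tn_conj_right[OF fin V W])
    also have "\<dots> \<le> c * tn (J \<times> J) (\<lambda>p q. u' p * w' q)" by (rule bound)
    also have "\<dots> \<le> c * (rnorm (J \<times> J) u' * rnorm (J \<times> J) w')"
      unfolding rnorm_def using c fin by (intro mult_left_mono tn_rank1) auto
    also have "\<dots> \<le> c * (rnorm (J \<times> R) u * rnorm (J \<times> R) w)"
      using c nu nw by (intro mult_left_mono mult_mono rnorm_nonneg) auto
    finally show ?thesis .
  qed
  define K where "K = J \<times> R"
  have K: "finite K" using fin by (simp add: K_def)
  \<comment> \<open>Splitting along singular vectors costs nothing: the norms of the rank-one pieces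
    add up to exactly \<open>tn K X\<close>, so the constant \<open>c\<close> survives.\<close>
  obtain P b where P: "orthonormal_columns K P"
    and dec: "\<And>r c. r \<in> K \<Longrightarrow> c \<in> K \<Longrightarrow> X r c = (\<Sum>i\<in>K. P r i * b i c)"
    and orth: "\<And>i j. i \<in> K \<Longrightarrow> j \<in> K \<Longrightarrow> i \<noteq> j \<Longrightarrow> (\<Sum>c\<in>K. b i c * cnj (b j c)) = 0"
    using ex_orthogonal_rows[OF K K, of X] by blast
  have "tn (I \<times> R) (lift \<phi> X) = tn (I \<times> R) (\<lambda>p q. \<Sum>i\<in>K. lift \<phi> (\<lambda>r c. P r i * b i c) p q)"
  proof (rule tn_cong)
    fix p q assume pq: "p \<in> I \<times> R" "q \<in> I \<times> R"
    hence m: "snd p \<in> R" "snd q \<in> R" by auto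
    have "lift \<phi> X p q = (\<Sum>h\<in>J. \<Sum>h'\<in>J. \<kappa> (fst p) (fst q) h h' * (\<Sum>i\<in>K. P (h, snd p) i * b i (h', snd q)))"
      unfolding lift_def \<phi>_def using m by (intro sum.cong refl) (simp add: dec K_def)
    also have "\<dots> = (\<Sum>h\<in>J. \<Sum>h'\<in>J. \<Sum>i\<in>K. \<kappa> (fst p) (fst q) h h' * (P (h, snd p) i * b i (h', snd q)))"
      by (simp only: sum_distrib_left)
    also have "\<dots> = (\<Sum>i\<in>K. \<Sum>h\<in>J. \<Sum>h'\<in>J. \<kappa> (fst p) (fst q) h h' * (P (h, snd p) i * b i (h', snd q)))"
      by (rule sum_swap3)
    finally show "lift \<phi> X p q = (\<Sum>i\<in>K. lift \<phi> (\<lambda>r c. P r i * b i c) p q)"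
      by (simp only: lift_def \<phi>_def)
  qed
  also have "\<dots> \<le> (\<Sum>i\<in>K. tn (I \<times> R) (lift \<phi> (\<lambda>r c. P r i * b i c)))"
    using fin K by (intro tn_sum) auto
  also have "\<dots> \<le> (\<Sum>i\<in>K. c * (rnorm K (\<lambda>r. P r i) * rnorm K (b i)))"
    unfolding K_def by (intro sum_mono rank1)
  also have "\<dots> = c * (\<Sum>i\<in>K. rnorm K (b i))"
    unfolding sum_distrib_left
    by (intro sum.cong refl) (simp add: rnorm_def[of _ "\<lambda>r. P r _"] orthonormal_columns_norm[OF P])
  also have "\<dots> = c * tn K X"
    using tn_orthogonal_rows[OF K P dec orth] by simp
  finally show ?thesis by (simp only: K_def)
qed

section \<open>The diamond norm in terms of \<open>lift\<close> and \<open>tn\<close>\<close>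

definition op_of :: "nat \<Rightarrow> (complex mat \<Rightarrow> complex mat) \<Rightarrow> (nat \<Rightarrow> nat \<Rightarrow> complex) \<Rightarrow> nat \<Rightarrow> nat \<Rightarrow> complex" where
  "op_of d \<Phi> x i j = \<Phi> (mat d d (\<lambda>(p, q). x p q)) $$ (i, j)"

lemma bij_pair_code:
  assumes "0 < (e :: nat)"
  shows "bij_betw (\<lambda>p. fst p * e + snd p) ({..<d} \<times> {..<e}) {..<d * e}"
proof (rule bij_betw_byWitness[where f' = "\<lambda>i. (i div e, i mod e)"])
  show "(\<lambda>p. fst p * e + snd p) ` ({..<d} \<times> {..<e}) \<subseteq> {..<d * e}"
  proof safe
    fix a b assume "a < d" "b < e"
    hence "a * e + b < (a + 1) * e" by simp
    also have "\<dots> \<le> d * e" using \<open>a < d\<close> by (intro mult_right_mono) auto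
    finally show "fst (a, b) * e + snd (a, b) < d * e" by simp
  qed
qed (use assms in \<open>auto simp: less_mult_imp_div_less\<close>)

lemma tn_mat_pair:
  assumes "A \<in> carrier_mat (d * e) (d * e)" "0 < e"
  shows "trace_norm A = tn ({..<d} \<times> {..<e}) (\<lambda>p q. A $$ (fst p * e + snd p, fst q * e + snd q))"
  using tn_bij[OF _ bij_pair_code[OF assms(2), of d], of "\<lambda>i j. A $$ (i, j)"] trace_norm_eq_tn[OF assms(1)]
  by simp

text \<open>\<open>tensor_id\<close> reads the output dimension off the value at the zero matrix,
  hence the form of the second hypothesis.\<close>

lemma trace_norm_tensor_id:
  assumes din: "0 < din" and dout: "dim_row (\<Phi> (0\<^sub>m din din)) = dout"
  shows "trace_norm (tensor_id din \<Phi> X)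
    = tn ({..<dout} \<times> {..<din}) (lift (op_of din \<Phi>) (\<lambda>p q. X $$ (fst p * din + snd p, fst q * din + snd q)))"
proof -
  have c: "tensor_id din \<Phi> X \<in> carrier_mat (dout * din) (dout * din)"
    by (simp add: tensor_id_def Let_def dout)
  have lt: "fst p * din + snd p < dout * din" if "p \<in> {..<dout} \<times> {..<din}" for p
    using bij_betwE[OF bij_pair_code[OF din, of dout]] that by auto
  show ?thesis
    unfolding tn_mat_pair[OF c din]
    by (rule tn_cong) (use din lt in \<open>auto simp: tensor_id_def Let_def dout lift_def op_of_def\<close>)
qed

lemma mat_of_pairs:
  assumes "0 < e"
  shows "\<exists>A \<in> carrier_mat (d * e) (d * e). \<forall>p\<in>{..<d}\<times>{..<e}. \<forall>q\<in>{..<d}\<times>{..<e}.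
    A $$ (fst p * e + snd p, fst q * e + snd q) = X p q"
proof -
  have lt: "fst p * e + snd p < d * e" if "p \<in> {..<d} \<times> {..<e}" for p
    using bij_betwE[OF bij_pair_code[OF assms, of d]] that by auto
  let ?A = "mat (d * e) (d * e) (\<lambda>(i, j). X (i div e, i mod e) (j div e, j mod e))"
  have "?A $$ (fst p * e + snd p, fst q * e + snd q) = X p q"
    if "p \<in> {..<d} \<times> {..<e}" "q \<in> {..<d} \<times> {..<e}" for p q
    using lt[OF that(1)] lt[OF that(2)] that by auto
  thus ?thesis by (intro bexI[of _ ?A]) auto
qed

lemma trace_norm_pos:
  assumes "A \<in> carrier_mat d d" "A \<noteq> 0\<^sub>m d d"
  shows "0 < trace_norm A"
proof -
  obtain i j where "i < d" "j < d" "A $$ (i, j) \<noteq> 0"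
    using assms by (auto simp: mat_eq_iff)
  thus ?thesis
    using tn_entry[of "{..<d}" i j "\<lambda>i j. A $$ (i, j)"] trace_norm_eq_tn[OF assms(1)]
    by (smt (verit) finite_lessThan lessThan_iff zero_less_norm_iff)
qed

lemma diamond_norm_le:
  assumes din: "0 < din" and dout: "dim_row (\<Phi> (0\<^sub>m din din)) = dout"
    and bound: "\<And>X. tn ({..<dout} \<times> {..<din}) (lift (op_of din \<Phi>) X) \<le> c * tn ({..<din} \<times> {..<din}) X"
  shows "diamond_norm din \<Phi> \<le> c"
  unfolding diamond_norm_def
proof (rule cSup_least)
  \<comment> \<open>The supremum needs a nonempty set; the all-ones matrix is nonzero because
    \<open>din\<close> is positive.\<close>
  have "mat (din * din) (din * din) (\<lambda>_. 1 :: complex) $$ (0, 0) \<noteq> 0\<^sub>m (din * din) (din * din) $$ (0, 0)"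
    using din by simp
  hence "mat (din * din) (din * din) (\<lambda>_. 1 :: complex) \<noteq> 0\<^sub>m (din * din) (din * din)" by metis
  thus "{trace_norm (tensor_id din \<Phi> X) / trace_norm X |X.
      X \<in> carrier_mat (din * din) (din * din) \<and> X \<noteq> 0\<^sub>m (din * din) (din * din)} \<noteq> {}"
    using mat_carrier by blast
next
  fix r assume "r \<in> {trace_norm (tensor_id din \<Phi> X) / trace_norm X |X.
      X \<in> carrier_mat (din * din) (din * din) \<and> X \<noteq> 0\<^sub>m (din * din) (din * din)}"
  then obtain X where X: "X \<in> carrier_mat (din * din) (din * din)" "X \<noteq> 0\<^sub>m (din * din) (din * din)"
    and r: "r = trace_norm (tensor_id din \<Phi> X) / trace_norm X" by blast
  have "trace_norm (tensor_id din \<Phi> X) \<le> c * trace_norm X"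
    unfolding trace_norm_tensor_id[where \<Phi> = \<Phi> and din = din, OF din dout] tn_mat_pair[OF X(1) din] by (rule bound)
  thus "r \<le> c" using trace_norm_pos[OF X] by (simp add: r divide_le_eq)
qed

text \<open>A real supremum is an upper bound only for a bounded set, so an a priori constant
  \<open>c\<close> has to be supplied; any finite value will do.\<close>

lemma tn_lift_le_diamond_norm:
  assumes din: "0 < din" and dout: "dim_row (\<Phi> (0\<^sub>m din din)) = dout"
    and bound: "\<And>X. tn ({..<dout} \<times> {..<din}) (lift (op_of din \<Phi>) X) \<le> c * tn ({..<din} \<times> {..<din}) X"
  shows "tn ({..<dout} \<times> {..<din}) (lift (op_of din \<Phi>) X) \<le> diamond_norm din \<Phi> * tn ({..<din} \<times> {..<din}) X"
proof -
  let ?S = "{trace_norm (tensor_id din \<Phi> X) / trace_norm X |X.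
      X \<in> carrier_mat (din * din) (din * din) \<and> X \<noteq> 0\<^sub>m (din * din) (din * din)}"
  have bdd: "bdd_above ?S"
  proof (rule bdd_aboveI[of _ c], safe)
    fix X :: "complex mat"
    assume X: "X \<in> carrier_mat (din * din) (din * din)" "X \<noteq> 0\<^sub>m (din * din) (din * din)"
    have "trace_norm (tensor_id din \<Phi> X) \<le> c * trace_norm X"
      unfolding trace_norm_tensor_id[where \<Phi> = \<Phi> and din = din, OF din dout] tn_mat_pair[OF X(1) din] by (rule bound)
    thus "trace_norm (tensor_id din \<Phi> X) / trace_norm X \<le> c"
      using trace_norm_pos[OF X] by (simp add: divide_le_eq)
  qed
  obtain A where A: "A \<in> carrier_mat (din * din) (din * din)"
    and AX: "\<And>p q. p \<in> {..<din}\<times>{..<din} \<Longrightarrow> q \<in> {..<din}\<times>{..<din} \<Longrightarrow>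
      A $$ (fst p * din + snd p, fst q * din + snd q) = X p q"
    using mat_of_pairs[OF din, of din X] by blast
  have tX: "trace_norm A = tn ({..<din} \<times> {..<din}) X"
    unfolding tn_mat_pair[OF A din] by (rule tn_cong) (rule AX)
  have tL: "trace_norm (tensor_id din \<Phi> A) = tn ({..<dout} \<times> {..<din}) (lift (op_of din \<Phi>) X)"
    unfolding trace_norm_tensor_id[where \<Phi> = \<Phi> and din = din, OF din dout]
  proof (rule tn_cong)
    fix p q assume "p \<in> {..<dout} \<times> {..<din}" "q \<in> {..<dout} \<times> {..<din}"
    hence m: "snd p < din" "snd q < din" by auto
    have "mat din din (\<lambda>(S, T). A $$ (S * din + snd p, T * din + snd q)) = mat din din (\<lambda>(S, T). X (S, snd p) (T, snd q))"
      by (rule eq_matI) (use m AX[of "(_, snd p)" "(_, snd q)"] in auto)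
    thus "lift (op_of din \<Phi>) (\<lambda>p q. A $$ (fst p * din + snd p, fst q * din + snd q)) p q = lift (op_of din \<Phi>) X p q"
      by (simp add: lift_def op_of_def)
  qed
  show ?thesis
  proof (cases "A = 0\<^sub>m (din * din) (din * din)")
    case False
    have "trace_norm (tensor_id din \<Phi> A) / trace_norm A \<le> diamond_norm din \<Phi>"
      unfolding diamond_norm_def using A False by (intro cSup_upper[OF _ bdd]) blast
    thus ?thesis using trace_norm_pos[OF A False] by (simp add: divide_le_eq tX tL)
  next
    \<comment> \<open>The zero operator is excluded from the supremum; there the a priori bound
      already gives 0.\<close>
    case True
    have "tn ({..<din} \<times> {..<din}) X = tn ({..<din} \<times> {..<din}) (\<lambda>p q. 0)"
      unfolding tX[symmetric] tn_mat_pair[OF A din]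
      by (rule tn_cong) (use True bij_betwE[OF bij_pair_code[OF din, of din]] in auto)
    hence "tn ({..<din} \<times> {..<din}) X = 0" by (simp add: tn_zero)
    thus ?thesis using bound[of X] by simp
  qed
qed

section \<open>The elementary channels on subset-indexed operators\<close>

text \<open>From here on a basis state is the set of qubits that are in state 1. The prefix \<open>f\<close> marks the
  counterparts of \<open>Nchan\<close>, \<open>ctrlN\<close>, \<open>M_stage\<close>, \<open>M_chan\<close>, \<open>D_A\<close> and \<open>conj_by\<close> on operators
  indexed by such sets.\<close>
definition flip :: "nat \<Rightarrow> nat set \<Rightarrow> nat set" where
  "flip q S = (if q \<in> S then S - {q} else insert q S)"

text \<open>\<open>hZ\<close> and \<open>hX\<close> are \<open>half_apply\<close> for a real
  diagonal sign gate and for an involutive basis permutation; plain and controlled gates differ only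
  in \<open>s\<close> and \<open>\<pi>\<close>.\<close>

definition hZ :: "('a \<Rightarrow> complex) \<Rightarrow> 'a mx \<Rightarrow> 'a mx" where
  "hZ s x S T = (1/2) * (x S T + s S * x S T * s T)"

definition hX :: "('a \<Rightarrow> 'a) \<Rightarrow> 'a mx \<Rightarrow> 'a mx" where
  "hX \<pi> x S T = (1/2) * (x S T + x (\<pi> S) (\<pi> T))"

definition zsign :: "nat \<Rightarrow> nat set \<Rightarrow> complex" where
  "zsign q S = (if q \<in> S then -1 else 1)"

definition czsign :: "nat \<Rightarrow> nat \<Rightarrow> nat set \<Rightarrow> complex" where
  "czsign c t S = (if c \<in> S \<and> t \<in> S then -1 else 1)"

definition cflip :: "nat \<Rightarrow> nat \<Rightarrow> nat set \<Rightarrow> nat set" where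
  "cflip c t S = (if c \<in> S then flip t S else S)"

definition fN :: "nat \<Rightarrow> nat set mx \<Rightarrow> nat set mx" where
  "fN q = hX (flip q) \<circ> hZ (zsign q)"

definition fcN :: "nat \<Rightarrow> nat \<Rightarrow> nat set mx \<Rightarrow> nat set mx" where
  "fcN c t = hX (cflip c t) \<circ> hZ (czsign c t)"

definition fstage :: "nat \<Rightarrow> nat \<Rightarrow> nat
    \<Rightarrow> (nat set mx \<Rightarrow> nat set mx) list" where
  "fstage m N j = map (\<lambda>t. fcN j t) (filter (\<lambda>t. t \<noteq> j) [0..<N])
                @ map (\<lambda>c. fcN c j) (filter (\<lambda>c. c \<noteq> j) [0..<m])"

definition fM :: "nat \<Rightarrow> nat \<Rightarrow> nat list
    \<Rightarrow> nat set mx \<Rightarrow> nat set mx" where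
  "fM m N js = seq (concat (map (fstage m N) js))"

lemma seq_simps [simp]: "seq [] x = x" "seq (f # fs) x = seq fs (f x)"
  "seq (fs @ gs) x = seq gs (seq fs x)"
  by (simp_all add: seq_def)

lemma flip_flip [simp]: "flip q (flip q S) = S"
  by (auto simp: flip_def)

lemma flip_mem: "r \<in> flip q S \<longleftrightarrow> (if r = q then q \<notin> S else r \<in> S)"
  by (auto simp: flip_def)

lemma flip_Pow: "q < N \<Longrightarrow> S \<subseteq> {..<N} \<Longrightarrow> flip q S \<subseteq> {..<N}"
  by (auto simp: flip_def)

lemma cflip_cflip: "c \<noteq> t \<Longrightarrow> cflip c t (cflip c t S) = S"
  by (auto simp: cflip_def flip_mem)

lemma hZ_zsign: "hZ (zsign q) x S T = (if (q \<in> S) = (q \<in> T) then x S T else 0)"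
  by (auto simp: hZ_def zsign_def)

lemma hZ_czsign: "hZ (czsign c t) x S T = (if (c \<in> S \<and> t \<in> S) = (c \<in> T \<and> t \<in> T) then x S T else 0)"
  by (auto simp: hZ_def czsign_def)

lemma fN_apply: "fN q x S T = (if (q \<in> S) = (q \<in> T) then (x S T + x (flip q S) (flip q T)) / 2 else 0)"
  by (simp add: fN_def hX_def hZ_zsign flip_mem)

text \<open>The properties that the remaining stages must have: they pass through block sums, fix
  multiples of the identity and are contractive next to every finite reference. Unitality is an
  equation on all index sets, which \<open>fconj\<close> satisfies only below \<open>N\<close>; the
  unitaries are therefore treated separately.\<close>

definition good_op :: "'a set \<Rightarrow> ('a mx \<Rightarrow> 'a mx) \<Rightarrow> bool" where
  "good_op I \<phi> \<longleftrightarrow>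
     (\<forall>x y c d. \<phi> (\<lambda>S T. c * x S T + d * y S T) = (\<lambda>S T. c * \<phi> x S T + d * \<phi> y S T)) \<and>
     (\<forall>c. \<phi> (\<lambda>S T. if S = T then c else 0) = (\<lambda>S T. if S = T then c else 0)) \<and>
     (\<forall>(R :: nat set) X. finite R \<longrightarrow> tn (I \<times> R) (lift \<phi> X) \<le> tn (I \<times> R) X)"

lemma good_op_linear:
  "good_op I \<phi> \<Longrightarrow> \<phi> (\<lambda>S T. c * x S T + d * y S T) = (\<lambda>S T. c * \<phi> x S T + d * \<phi> y S T)"
  by (simp add: good_op_def)

lemma good_op_unital:
  "good_op I \<phi> \<Longrightarrow> \<phi> (\<lambda>S T. if S = T then c else 0) = (\<lambda>S T. if S = T then c else 0)"
  by (simp add: good_op_def)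

lemma good_op_tn:
  fixes R :: "nat set"
  shows "good_op I \<phi> \<Longrightarrow> finite R \<Longrightarrow> tn (I \<times> R) (lift \<phi> X) \<le> tn (I \<times> R) X"
  by (simp add: good_op_def)

lemma good_op_diff:
  assumes "good_op I \<phi>"
  shows "\<phi> (\<lambda>S T. x S T - y S T) = (\<lambda>S T. \<phi> x S T - \<phi> y S T)"
  using good_op_linear[OF assms, of 1 x "-1" y] by simp

lemma good_op_sum:
  assumes "good_op I \<phi>" "finite F"
  shows "\<phi> (\<lambda>S T. \<Sum>a\<in>F. x a S T) = (\<lambda>S T. \<Sum>a\<in>F. \<phi> (x a) S T)"
  using assms(2)
proof (induction F rule: finite_induct)
  case empty
  show ?case using good_op_linear[OF assms(1), of 0 _ 0] by simp
next
  case (insert a F)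
  show ?case
    using good_op_linear[OF assms(1), of 1 "x a" 1 "\<lambda>S T. \<Sum>a\<in>F. x a S T"] insert by simp
qed

lemma good_op_comp:
  assumes "good_op I \<phi>" "good_op I \<psi>"
  shows "good_op I (\<lambda>x. \<phi> (\<psi> x))"
  unfolding good_op_def
proof (intro conjI allI impI)
  fix R :: "nat set" and X assume R: "finite R"
  show "tn (I \<times> R) (lift (\<lambda>x. \<phi> (\<psi> x)) X) \<le> tn (I \<times> R) X"
    unfolding lift_comp by (rule order_trans[OF good_op_tn[OF assms(1) R] good_op_tn[OF assms(2) R]])
qed (simp_all add: good_op_linear[OF assms(1)] good_op_linear[OF assms(2)]
  good_op_unital[OF assms(1)] good_op_unital[OF assms(2)])

lemma good_op_seq:
  assumes "\<And>f. f \<in> set fs \<Longrightarrow> good_op I f"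
  shows "good_op I (seq fs)"
  using assms
proof (induction fs)
  case Nil
  show ?case by (simp add: good_op_def lift_def)
next
  case (Cons f fs)
  have "seq (f # fs) = (\<lambda>x. seq fs (f x))" by (rule ext) simp
  moreover have "good_op I (\<lambda>x. seq fs (f x))"
    by (rule good_op_comp[OF Cons.IH]) (use Cons.prems in auto)
  ultimately show ?case by simp
qed

lemma tn_average:
  assumes "finite I" "tn I Y \<le> tn I X"
  shows "tn I (\<lambda>p q. (1/2) * (X p q + Y p q)) \<le> tn I X"
proof -
  have "tn I (\<lambda>p q. (1/2) * (X p q + Y p q)) = (1/2) * tn I (\<lambda>p q. X p q + Y p q)"
    using tn_scale[OF assms(1), of "1/2"] by simp
  thus ?thesis using tn_triangle[OF assms(1), of X Y] assms(2) by simp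
qed

lemma good_op_hZ:
  assumes "finite I" "\<And>S. s S = 1 \<or> s S = -1"
  shows "good_op I (hZ s)"
  unfolding good_op_def
proof (intro conjI allI impI)
  fix x y c d
  show "hZ s (\<lambda>S T. c * x S T + d * y S T) = (\<lambda>S T. c * hZ s x S T + d * hZ s y S T)"
    by (intro ext) (simp add: hZ_def algebra_simps)
next
  fix c
  show "hZ s (\<lambda>S T. if S = T then c else 0) = (\<lambda>S T. if S = T then c else 0)"
  proof (intro ext)
    fix S T
    show "hZ s (\<lambda>S T. if S = T then c else 0) S T = (if S = T then c else 0)"
      using assms(2)[of S] by (auto simp: hZ_def)
  qed
next
  fix R :: "nat set" and X assume R: "finite R"
  have s: "cmod (s S) \<le> 1" for S using assms(2)[of S] by auto
  show "tn (I \<times> R) (lift (hZ s) X) \<le> tn (I \<times> R) X"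
    unfolding lift_def hZ_def prod.collapse
    using assms(1) R s by (intro tn_average tn_diag) auto
qed

lemma good_op_hX:
  assumes "finite I" "inj \<pi>" "\<pi> ` I \<subseteq> I"
  shows "good_op I (hX \<pi>)"
  unfolding good_op_def
proof (intro conjI allI impI)
  fix x y c d
  show "hX \<pi> (\<lambda>S T. c * x S T + d * y S T) = (\<lambda>S T. c * hX \<pi> x S T + d * hX \<pi> y S T)"
    by (intro ext) (simp add: hX_def algebra_simps)
next
  fix c
  show "hX \<pi> (\<lambda>S T. if S = T then c else 0) = (\<lambda>S T. if S = T then c else 0)"
    using assms(2) by (intro ext) (simp add: hX_def inj_eq)
next
  fix R :: "nat set" and X :: "'a \<times> nat \<Rightarrow> 'a \<times> nat \<Rightarrow> complex" assume R: "finite R"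
  let ?f = "\<lambda>p. (\<pi> (fst p), snd p)"
  have "inj_on ?f (I \<times> R)" "?f ` (I \<times> R) \<subseteq> I \<times> R"
    using assms(3) by (auto intro!: inj_onI dest: injD[OF assms(2)])
  hence "tn (I \<times> R) (\<lambda>p q. X (\<pi> (fst p), snd p) (\<pi> (fst q), snd q)) \<le> tn (I \<times> R) X"
    using tn_compress[of "I \<times> R" ?f "I \<times> R" X] assms(1) R by simp
  thus "tn (I \<times> R) (lift (hX \<pi>) X) \<le> tn (I \<times> R) X"
    unfolding lift_def hX_def prod.collapse
    using assms(1) R by (intro tn_average) auto
qed

lemma good_op_fN:
  assumes "q < N"
  shows "good_op (Pow {..<N}) (fN q)"
  unfolding fN_def comp_def
proof (rule good_op_comp[OF good_op_hX good_op_hZ])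
  show "inj (flip q)" by (rule inj_on_inverseI[of _ "flip q"]) simp
  show "flip q ` Pow {..<N} \<subseteq> Pow {..<N}" using flip_Pow[OF assms] by auto
qed (simp_all add: zsign_def)

lemma good_op_fcN:
  assumes "t < N" "c \<noteq> t"
  shows "good_op (Pow {..<N}) (fcN c t)"
  unfolding fcN_def comp_def
proof (rule good_op_comp[OF good_op_hX good_op_hZ])
  show "inj (cflip c t)" by (rule inj_on_inverseI[of _ "cflip c t"]) (simp add: cflip_cflip assms)
  show "cflip c t ` Pow {..<N} \<subseteq> Pow {..<N}" using flip_Pow[OF assms(1)] by (auto simp: cflip_def)
qed (simp_all add: czsign_def)

lemma good_op_fM: "set js \<subseteq> {..<m} \<Longrightarrow> m \<le> N \<Longrightarrow> good_op (Pow {..<N}) (fM m N js)"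
  unfolding fM_def fstage_def by (intro good_op_seq) (auto intro!: good_op_fcN)

lemma dephase_apply:
  "seq (map (\<lambda>q. hZ (zsign q)) qs) x S T = (if S \<inter> set qs = T \<inter> set qs then x S T else 0)"
proof (induction qs arbitrary: x)
  case (Cons q qs)
  have e: "seq (map (\<lambda>q. hZ (zsign q)) (q # qs)) x S T
      = (if S \<inter> set qs = T \<inter> set qs then hZ (zsign q) x S T else 0)"
    by (simp only: list.map seq_simps Cons.IH)
  show ?case unfolding e hZ_zsign[of q x S T] by auto
qed simp

text \<open>The right side is the partial trace over \<open>qs\<close> tensored with the maximally
  mixed state. Each further qubit splits the power set by membership of \<open>q\<close>.\<close>

lemma depolarize_apply:
  assumes "distinct qs"
  shows "seq (map fN qs) x S T = (if S \<inter> set qs = T \<inter> set qs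
    then (\<Sum>L\<in>Pow (set qs). x (S - set qs \<union> L) (T - set qs \<union> L)) / 2 ^ length qs else 0)"
  using assms
proof (induction qs arbitrary: x)
  case (Cons q qs)
  let ?B = "set qs"
  have q: "q \<notin> ?B" using Cons.prems by simp
  have split: "(S \<inter> set (q # qs) = T \<inter> set (q # qs)) = ((q \<in> S) = (q \<in> T) \<and> S \<inter> ?B = T \<inter> ?B)"
    by auto
  show ?case
  proof (cases "(q \<in> S) = (q \<in> T)")
    case False
    hence "fN q x (S - ?B \<union> L) (T - ?B \<union> L) = 0" if "L \<in> Pow ?B" for L
      using q that by (auto simp: fN_apply)
    thus ?thesis using Cons False split by simp
  next
    case True
    let ?g = "\<lambda>L. x (S - set (q # qs) \<union> L) (T - set (q # qs) \<union> L)"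
    \<comment> \<open>Whether or not \<open>q\<close> lies in \<open>S\<close>, the two summands are
      the values at \<open>L\<close> and at \<open>insert q L\<close>; only their order
      changes.\<close>
    have "fN q x (S - ?B \<union> L) (T - ?B \<union> L) = (?g L + ?g (insert q L)) / 2" if "L \<in> Pow ?B" for L
    proof (cases "q \<in> S")
      case qS: True
      have "S - ?B \<union> L = S - set (q # qs) \<union> insert q L" "T - ?B \<union> L = T - set (q # qs) \<union> insert q L"
        "flip q (S - ?B \<union> L) = S - set (q # qs) \<union> L" "flip q (T - ?B \<union> L) = T - set (q # qs) \<union> L"
        using qS True q that by (auto simp: flip_mem split: if_splits)
      thus ?thesis using qS True q that by (simp add: fN_apply)
    next
      case qS: False
      have "S - ?B \<union> L = S - set (q # qs) \<union> L" "T - ?B \<union> L = T - set (q # qs) \<union> L"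
        "flip q (S - ?B \<union> L) = S - set (q # qs) \<union> insert q L" "flip q (T - ?B \<union> L) = T - set (q # qs) \<union> insert q L"
        using qS True q that by (auto simp: flip_mem split: if_splits)
      thus ?thesis using qS True q that by (simp add: fN_apply)
    qed
    hence "(\<Sum>L\<in>Pow ?B. fN q x (S - ?B \<union> L) (T - ?B \<union> L)) = (\<Sum>L\<in>Pow ?B. ?g L + ?g (insert q L)) / 2"
      unfolding sum_divide_distrib by (rule sum.cong[OF refl])
    also have "(\<Sum>L\<in>Pow ?B. ?g L + ?g (insert q L)) = (\<Sum>L\<in>Pow ?B. ?g L) + (\<Sum>L\<in>insert q ` Pow ?B. ?g L)"
      using q by (subst sum.reindex) (auto simp: sum.distrib inj_on_def)
    also have "\<dots> = (\<Sum>L\<in>Pow (set (q # qs)). ?g L)"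
      using q by (simp only: list.set Pow_insert) (subst sum.union_disjoint, auto)
    finally have F: "(\<Sum>L\<in>Pow ?B. fN q x (S - ?B \<union> L) (T - ?B \<union> L)) = (\<Sum>L\<in>Pow (set (q # qs)). ?g L) / 2" .
    have e: "(\<Sum>L\<in>Pow ?B. fN q x (S - ?B \<union> L) (T - ?B \<union> L)) / 2 ^ length qs
        = (\<Sum>L\<in>Pow (set (q # qs)). ?g L) / 2 ^ length (q # qs)"
      unfolding F by simp
    have "seq (map fN (q # qs)) x S T = (if S \<inter> ?B = T \<inter> ?B
        then (\<Sum>L\<in>Pow ?B. fN q x (S - ?B \<union> L) (T - ?B \<union> L)) / 2 ^ length qs else 0)"
      using Cons by simp
    thus ?thesis unfolding e using True split by simp
  qed
qed simp

section \<open>Controlled gates and single stages of the mixing circuit\<close>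

lemma fcN_control_off:
  assumes "c \<noteq> t" "\<And>S T. x S T \<noteq> 0 \<Longrightarrow> c \<notin> S \<and> c \<notin> T"
  shows "fcN c t x = x"
proof (intro ext)
  fix S T
  have z: "x S T = 0" if "c \<in> S \<or> c \<in> T" for S T using assms(2) that by blast
  show "fcN c t x S T = x S T"
  proof (cases "c \<in> S \<or> c \<in> T")
    case True
    hence "x (cflip c t S) (cflip c t T) = 0"
      using assms(1) by (intro z) (auto simp: cflip_def flip_mem)
    thus ?thesis using z[OF True] by (simp add: fcN_def hX_def hZ_czsign)
  qed (simp add: fcN_def hX_def hZ_czsign cflip_def)
qed

text \<open>The gates keep the bit \<open>c\<close>, as \<open>t\<close> differs from
  \<open>c\<close>, so outside the support both sides vanish; on it the control is set and the gate
  is the plain one.\<close>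

lemma fcN_control_on:
  assumes "c \<noteq> t" "\<And>S T. x S T \<noteq> 0 \<Longrightarrow> c \<in> S \<and> c \<in> T"
  shows "fcN c t x = fN t x"
proof (intro ext)
  fix S T
  have z: "x S T = 0" if "c \<notin> S \<or> c \<notin> T" for S T using assms(2) that by blast
  show "fcN c t x S T = fN t x S T"
  proof (cases "c \<in> S \<and> c \<in> T")
    case True
    thus ?thesis using assms(1) by (simp add: fcN_def fN_def hX_def hZ_czsign hZ_zsign cflip_def flip_mem)
  next
    case False
    hence "x (flip t S) (flip t T) = 0" "x S T = 0" "x (cflip c t S) (cflip c t T) = 0"
      using assms(1) by (auto intro!: z simp: cflip_def flip_mem)
    thus ?thesis by (simp add: fcN_def fN_def hX_def hZ_czsign hZ_zsign)
  qed
qed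

lemma fN_support:
  assumes "\<And>S T. x S T \<noteq> 0 \<Longrightarrow> S \<inter> K = a \<and> T \<inter> K = a" "t \<notin> K" "fN t x S T \<noteq> 0"
  shows "S \<inter> K = a \<and> T \<inter> K = a"
proof -
  have "x S T \<noteq> 0 \<or> x (flip t S) (flip t T) \<noteq> 0"
    using assms(3) by (auto simp: fN_apply split: if_splits)
  moreover have "flip t S \<inter> K = S \<inter> K" "flip t T \<inter> K = T \<inter> K" using assms(2) by (auto simp: flip_mem split: if_splits)
  ultimately show ?thesis using assms(1)[of S T] assms(1)[of "flip t S" "flip t T"] by auto
qed

text \<open>Complete depolarisation is a projection, so several set controls with the same target
  act like one.\<close>

lemma fN_idem: "fN t (fN t x) = fN t x"
  by (intro ext) (simp add: fN_apply flip_mem field_simps)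

text \<open>The fixed bit pattern \<open>a\<close> on \<open>K\<close> decides each gate, and a gate
  with target \<open>j\<close> outside \<open>K\<close> never changes the pattern.\<close>

lemma fcN_target_seq:
  assumes "\<And>S T. x S T \<noteq> 0 \<Longrightarrow> S \<inter> K = a \<and> T \<inter> K = a" "set cs \<subseteq> K" "j \<notin> K"
  shows "seq (map (\<lambda>c. fcN c j) cs) x = (if set cs \<inter> a \<noteq> {} then fN j x else x)"
  using assms(1,2)
proof (induction cs arbitrary: x)
  case (Cons c cs)
  have c: "c \<in> K" "c \<noteq> j" using Cons.prems assms(3) by auto
  show ?case
  proof (cases "c \<in> a")
    case True
    have "fcN c j x = fN j x"
      using c True Cons.prems(1) by (intro fcN_control_on) auto
    moreover have "seq (map (\<lambda>c. fcN c j) cs) (fN j x) = (if set cs \<inter> a \<noteq> {} then fN j (fN j x) else fN j x)"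
    proof (rule Cons.IH)
      show "S \<inter> K = a \<and> T \<inter> K = a" if "fN j x S T \<noteq> 0" for S T
        by (rule fN_support[of x K a j]) (use Cons.prems(1) assms(3) that in blast)+
    qed (use Cons.prems in auto)
    ultimately show ?thesis using True by (simp add: fN_idem)
  next
    case False
    have "fcN c j x = x"
      using c False Cons.prems(1) by (intro fcN_control_off) auto
    thus ?thesis using Cons False by simp
  qed
qed simp

lemma fcN_control_seq_off:
  assumes "\<And>S T. x S T \<noteq> 0 \<Longrightarrow> j \<notin> S \<and> j \<notin> T" "j \<notin> set ts"
  shows "seq (map (fcN j) ts) x = x"
  using assms(2) by (induction ts) (auto simp: fcN_control_off[OF _ assms(1)])

text \<open>Depolarising the targets never touches \<open>j\<close>, so the control stays set
  throughout.\<close>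

lemma fcN_control_seq_on:
  assumes "\<And>S T. x S T \<noteq> 0 \<Longrightarrow> j \<in> S \<and> j \<in> T" "j \<notin> set ts"
  shows "seq (map (fcN j) ts) x = seq (map fN ts) x"
  using assms
proof (induction ts arbitrary: x)
  case (Cons t ts)
  have "j \<in> S \<and> j \<in> T" if "fN t x S T \<noteq> 0" for S T
    using fN_support[of x "{j}" "{j}" t S T] Cons.prems that by auto
  thus ?case using Cons fcN_control_on[of j t x] by simp
qed simp

text \<open>With \<open>j\<close> unset the first half does nothing, and \<open>a\<close> supplies
  another set ancilla that triggers the depolarisation of \<open>j\<close> in the second half. Since
  \<open>j\<close> is 0 on both sides of \<open>x\<close>, dephasing has no effect and the result is
  an even mixture of \<open>x\<close> and its flip.\<close>

lemma fstage_off: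
  assumes supp: "\<And>S T. x S T \<noteq> 0 \<Longrightarrow> S \<inter> {..<m} = a \<and> T \<inter> {..<m} = a"
    and j: "j < m" "j \<notin> a" and a: "a \<noteq> {}" "a \<subseteq> {..<m}"
  shows "seq (fstage m N j) x = (\<lambda>S T. (1/2) * x S T + (1/2) * x (flip j S) (flip j T))"
proof -
  have "seq (map (fcN j) (filter (\<lambda>t. t \<noteq> j) [0..<N])) x = x"
    using j by (intro fcN_control_seq_off) (auto dest!: supp)
  moreover have "seq (map (\<lambda>c. fcN c j) (filter (\<lambda>c. c \<noteq> j) [0..<m])) x
      = (if set (filter (\<lambda>c. c \<noteq> j) [0..<m]) \<inter> a \<noteq> {} then fN j x else x)"
    using j by (intro fcN_target_seq[where K = "{..<m} - {j}"]) (auto dest!: supp)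
  moreover have "set (filter (\<lambda>c. c \<noteq> j) [0..<m]) \<inter> a \<noteq> {}" using a j by auto
  moreover have "fN j x = (\<lambda>S T. (1/2) * x S T + (1/2) * x (flip j S) (flip j T))"
  proof (intro ext)
    fix S T
    have "x S T = 0" if "j \<in> S \<or> j \<in> T" for S T using supp[of S T] j that by auto
    thus "fN j x S T = (1/2) * x S T + (1/2) * x (flip j S) (flip j T)"
      by (auto simp: fN_apply flip_mem add_divide_distrib)
  qed
  ultimately show ?thesis unfolding fstage_def by simp
qed

text \<open>Every control in the mixing circuit is an ancilla, and all ancillas are 0 here.\<close>

lemma fM_zero_block:
  assumes "\<And>S T. x S T \<noteq> 0 \<Longrightarrow> S \<inter> {..<m} = {} \<and> T \<inter> {..<m} = {}" "set js \<subseteq> {..<m}"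
  shows "fM m N js x = x"
proof -
  have "seq fs x = x" if "\<And>f. f \<in> set fs \<Longrightarrow> f x = x" for fs :: "(nat set mx \<Rightarrow> nat set mx) list"
    using that by (induction fs) auto
  moreover have *: "fcN c t x = x" if "c < m" "c \<noteq> t" for c t
    using that assms(1) by (intro fcN_control_off) auto
  moreover have "f x = x" if f: "f \<in> set (concat (map (fstage m N) js))" for f
  proof -
    obtain j where j: "j \<in> set js" "f \<in> set (fstage m N j)" using f by auto
    hence "(\<exists>t. f = fcN j t \<and> t \<noteq> j) \<or> (\<exists>c. f = fcN c j \<and> c < m \<and> c \<noteq> j)"
      by (auto simp: fstage_def)
    moreover have "j < m" using j(1) assms(2) by auto
    ultimately show ?thesis using * by metis
  qed
  ultimately show ?thesis unfolding fM_def by blast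
qed

text \<open>On a diagonal operator a controlled gate is a classical random flip of \<open>j\<close>.
  The flip leaves the controls unchanged and averaging twice is averaging once, so only the presence
  of some set control matters.\<close>

lemma fcN_diagonal_seq:
  assumes "\<And>S T. S \<subseteq> {..<N} \<Longrightarrow> T \<subseteq> {..<N} \<Longrightarrow> y S T = (if S = T then g S else 0)"
    and "j \<notin> set cs" "j < N" "S \<subseteq> {..<N}" "T \<subseteq> {..<N}"
  shows "seq (map (\<lambda>c. fcN c j) cs) y S T
    = (if S = T then (if S \<inter> set cs \<noteq> {} then (g S + g (flip j S)) / 2 else g S) else 0)"
  using assms(1,2)
proof (induction cs arbitrary: y g)
  case Nil
  thus ?case using assms(4,5) by simp
next
  case (Cons c cs)
  have c: "c \<noteq> j" using Cons.prems by auto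
  define g' where "g' S = (if c \<in> S then (g S + g (flip j S)) / 2 else g S)" for S
  have "fcN c j y S T = (if S = T then g' S else 0)" if ST: "S \<subseteq> {..<N}" "T \<subseteq> {..<N}" for S T
  proof -
    have "cflip c j S \<subseteq> {..<N}" "cflip c j T \<subseteq> {..<N}"
      using ST assms(3) by (auto simp: cflip_def flip_mem split: if_splits)
    moreover have "cflip c j S = cflip c j T \<longleftrightarrow> S = T" by (metis c cflip_cflip)
    ultimately show ?thesis
      using Cons.prems(1) ST c unfolding fcN_def comp_def hX_def hZ_czsign
      by (auto simp: g'_def cflip_def)
  qed
  hence "seq (map (\<lambda>c. fcN c j) cs) (fcN c j y) S T
    = (if S = T then (if S \<inter> set cs \<noteq> {} then (g' S + g' (flip j S)) / 2 else g' S) else 0)"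
    using Cons.prems by (intro Cons.IH) auto
  thus ?case using c by (auto simp: g'_def flip_mem add.commute)
qed

text \<open>The first half leaves \<open>j\<close> set and the rest maximally mixed: a diagonal
  operator with doubled weight on the sets containing \<open>j\<close> and none elsewhere. The
  second half averages over \<open>j\<close> except where all other ancillas are 0; only there a
  deviation of plus or minus the trace over \<open>2 ^ N\<close> remains.\<close>

lemma fstage_on:
  assumes supp: "\<And>S T. x S T \<noteq> 0 \<Longrightarrow> j \<in> S \<and> j \<in> T"
    and j: "j < m" "m \<le> N" and ST: "S \<subseteq> {..<N}" "T \<subseteq> {..<N}"
  shows "seq (fstage m N j) x S T - (if S = T then (\<Sum>S\<in>Pow {..<N}. x S S) / 2 ^ N else 0)
    = (if S = T \<and> S \<inter> ({..<m} - {j}) = {}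
       then (if j \<in> S then 1 else -1) / 2 ^ N * (\<Sum>S\<in>Pow {..<N}. x S S) else 0)"
proof -
  let ?ts = "filter (\<lambda>t. t \<noteq> j) [0..<N]"
  let ?B = "{..<N} - {j}"
  let ?tr = "\<Sum>S\<in>Pow {..<N}. x S S"
  have B: "set ?ts = ?B" by auto
  have "length ?ts = card (set ?ts)" by (rule distinct_card[symmetric]) simp
  hence len: "length ?ts = N - 1" using j unfolding B by simp
  have pow: "(2::complex) ^ N = 2 * 2 ^ (N - 1)" using j by (cases N) auto
  define y where "y = seq (map (fcN j) ?ts) x"
  \<comment> \<open>The trace is spread evenly over half of the basis, hence the factor 2.\<close>
  have y: "y S T = (if S = T then (if j \<in> S then 2 * ?tr / 2 ^ N else 0) else 0)"
    if ST: "S \<subseteq> {..<N}" "T \<subseteq> {..<N}" for S T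
  proof -
    have "y = seq (map fN ?ts) x"
      unfolding y_def using supp by (intro fcN_control_seq_on) auto
    hence e: "y S T = (if S \<inter> ?B = T \<inter> ?B then (\<Sum>L\<in>Pow ?B. x (S - ?B \<union> L) (T - ?B \<union> L)) / 2 ^ (N - 1) else 0)"
      using depolarize_apply[of ?ts x S T] unfolding B len by simp
    show ?thesis
    proof (cases "j \<in> S \<and> j \<in> T")
      case True
      have SB: "S - ?B = {j}" "T - ?B = {j}" using ST True by auto
      have "S \<inter> ?B = T \<inter> ?B \<longleftrightarrow> S = T" using ST True by auto
      moreover have "(\<Sum>L\<in>Pow ?B. x ({j} \<union> L) ({j} \<union> L)) = ?tr"
      proof -
        have "(\<Sum>L\<in>Pow ?B. x ({j} \<union> L) ({j} \<union> L)) = (\<Sum>S\<in>insert j ` Pow ?B. x S S)"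
          by (subst sum.reindex) (auto simp: inj_on_def)
        also have "\<dots> = ?tr"
        proof (rule sum.mono_neutral_left)
          show "\<forall>S\<in>Pow {..<N} - insert j ` Pow ?B. x S S = 0"
          proof (rule ballI, rule ccontr)
            fix S assume S: "S \<in> Pow {..<N} - insert j ` Pow ?B" "x S S \<noteq> 0"
            hence "S = insert j (S - {j})" "S - {j} \<in> Pow ?B" using supp[OF S(2)] by auto
            thus False using S(1) by blast
          qed
        qed (use j in auto)
        finally show ?thesis .
      qed
      ultimately show ?thesis using True e unfolding SB by (simp add: pow)
    next
      case False
      have "x (S - ?B \<union> L) (T - ?B \<union> L) = 0" if "L \<in> Pow ?B" for L
      proof (rule ccontr)
        assume "x (S - ?B \<union> L) (T - ?B \<union> L) \<noteq> 0"
        hence "j \<in> S - ?B \<union> L \<and> j \<in> T - ?B \<union> L" by (rule supp)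
        moreover have "j \<notin> L" using that by blast
        ultimately show False using False by blast
      qed
      hence "y S T = 0" unfolding e by simp
      thus ?thesis using False by auto
    qed
  qed
  have "seq (fstage m N j) x S T = seq (map (\<lambda>c. fcN c j) (filter (\<lambda>c. c \<noteq> j) [0..<m])) y S T"
    by (simp add: fstage_def y_def)
  also have "\<dots> = (if S = T then (if S \<inter> set (filter (\<lambda>c. c \<noteq> j) [0..<m]) \<noteq> {}
     then ((if j \<in> S then 2 * ?tr / 2 ^ N else 0) + (if j \<in> flip j S then 2 * ?tr / 2 ^ N else 0)) / 2
     else (if j \<in> S then 2 * ?tr / 2 ^ N else 0)) else 0)"
    using j by (intro fcN_diagonal_seq[OF y _ _ ST]) auto
  also have "set (filter (\<lambda>c. c \<noteq> j) [0..<m]) = {..<m} - {j}" by auto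
  finally show ?thesis by (simp add: flip_mem)
qed

section \<open>Distance of the nonzero blocks from the maximally mixed state\<close>

definition mixed :: "nat \<Rightarrow> nat set mx \<Rightarrow> nat set mx" where
  "mixed N x S T = (if S = T then (\<Sum>S\<in>Pow {..<N}. x S S) / 2 ^ N else 0)"

lemma good_op_mixed: "good_op I \<phi> \<Longrightarrow> \<phi> (mixed N x) = mixed N x"
  using good_op_unital[of I \<phi> "(\<Sum>S\<in>Pow {..<N}. x S S) / 2 ^ N"] unfolding mixed_def by simp

lemma sum_flip:
  assumes "j < N"
  shows "(\<Sum>S\<in>Pow {..<N}. x (flip j S) (flip j S)) = (\<Sum>S\<in>Pow {..<N}. x S S :: complex)"
  by (rule sum.reindex_bij_witness[of _ "flip j" "flip j"]) (use flip_Pow[OF assms] in auto)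

lemma tn_slice:
  assumes "finite I" "finite R" "S \<in> I"
  shows "tn {p \<in> I \<times> R. fst p = S} X = tn R (\<lambda>k l. X (S, k) (S, l))"
proof -
  have "bij_betw (\<lambda>k. (S, k)) R {p \<in> I \<times> R. fst p = S}"
    using assms by (auto simp: bij_betw_def inj_on_def)
  from tn_bij[OF _ this, of X] show ?thesis using assms by simp
qed

text \<open>The operator is block diagonal in \<open>S\<close> with blocks \<open>t\<close> scaled
  by \<open>1 / 2^N\<close> up to sign. The surviving sets consist of non-ancilla qubits and
  possibly \<open>j\<close>, so there are \<open>2^(N - m + 1)\<close> of them.\<close>

lemma tn_diagonal_sign:
  fixes R :: "nat set"
  assumes "finite R" "m \<le> N" "j < m"
  shows "tn (Pow {..<N} \<times> R) (\<lambda>p q. if fst p = fst q \<and> fst p \<inter> ({..<m} - {j}) = {}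
      then (if j \<in> fst p then 1 else -1) / 2 ^ N * t (snd p) (snd q) else 0) \<le> 2 / 2 ^ m * tn R t"
    (is "tn (?I \<times> R) ?X \<le> _")
proof -
  let ?Z = "{S \<in> ?I. S \<inter> ({..<m} - {j}) = {}}"
  have "tn (?I \<times> R) ?X = (\<Sum>S\<in>?I. tn {p \<in> ?I \<times> R. fst p = S} ?X)"
    using assms(1) by (intro tn_block_diagonal) auto
  also have "\<dots> = (\<Sum>S\<in>?I. if S \<in> ?Z then 1 / 2 ^ N * tn R t else 0)"
  proof (rule sum.cong[OF refl])
    fix S assume S: "S \<in> ?I"
    have "tn {p \<in> ?I \<times> R. fst p = S} ?X = tn R (\<lambda>k l. ?X (S, k) (S, l))"
      by (rule tn_slice) (use assms(1) S in auto)
    also have "\<dots> = tn R (\<lambda>k l. (if S \<in> ?Z then (if j \<in> S then 1 else -1) / 2 ^ N else 0) * t k l)"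
      using S by (intro tn_cong) auto
    also have "\<dots> = (if S \<in> ?Z then 1 / 2 ^ N * tn R t else 0)"
      by (simp add: tn_scale[OF assms(1)] norm_divide norm_power)
    finally show "tn {p \<in> ?I \<times> R. fst p = S} ?X = (if S \<in> ?Z then 1 / 2 ^ N * tn R t else 0)" .
  qed
  also have "\<dots> = real (card ?Z) * (1 / 2 ^ N * tn R t)"
    by (simp add: sum.If_cases Int_def)
  also have "?Z = Pow (insert j {m..<N})"
    using assms(2,3) by (auto simp: disjoint_iff subset_iff not_le)
  also have "card (Pow (insert j {m..<N})) = 2 ^ (Suc (N - m))"
    using assms by (simp add: card_Pow)
  also have "real (2 ^ (Suc (N - m))) * (1 / 2 ^ N * tn R t) = 2 / 2 ^ m * tn R t"
  proof -
    have "(2 :: real) ^ N = 2 ^ m * 2 ^ (N - m)" using assms(2) by (simp flip: power_add)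
    thus ?thesis by simp
  qed
  finally show ?thesis by simp
qed

lemma fM_Cons: "fM m N (j # js) x = fM m N js (seq (fstage m N j) x)"
  by (simp add: fM_def)

text \<open>If the \<open>j\<close>-th ancilla is set at the start of stage \<open>j\<close>, that stage already produces an almost
  maximally mixed state; otherwise the stage only randomises the \<open>j\<close>-th ancilla, and
  the set ancilla responsible for \<open>a \<noteq> {}\<close> survives to its own stage.\<close>
lemma fM_nonzero_block:
  fixes R :: "nat set"
  assumes "finite R" "m \<le> N" "a \<subseteq> {..<m}" "a \<inter> {j..<m} \<noteq> {}" "j \<le> m"
    and "\<And>p q. X p q \<noteq> 0 \<Longrightarrow> fst p \<inter> {..<m} = a \<and> fst q \<inter> {..<m} = a"
  shows "tn (Pow {..<N} \<times> R) (\<lambda>p q. lift (fM m N [j..<m]) X p q - lift (mixed N) X p q)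
    \<le> 2 / 2 ^ m * tn (Pow {..<N} \<times> R) X"
  using assms(5,3,4,6)
proof (induction j arbitrary: a X rule: inc_induct)
  case base
  thus ?case by simp
next
  case (step j)
  let ?I = "Pow {..<N}"
  let ?M = "fM m N [Suc j..<m]"
  let ?\<delta> = "2 / 2 ^ m :: real"
  have fin: "finite (?I \<times> R)" using assms(1) by simp
  have j: "j < m" "j < N" using step.hyps assms(2) by auto
  have good: "good_op ?I ?M" using assms(2) by (intro good_op_fM) auto
  have M: "fM m N [j..<m] x = ?M (seq (fstage m N j) x)" for x
    using j(1) by (simp add: upt_conv_Cons fM_Cons)
  have supp: "S \<inter> {..<m} = a \<and> T \<inter> {..<m} = a" if "X (S, k) (T, l) \<noteq> 0" for S T k l
    using step.prems(3)[OF that] by simp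
  show ?case
  proof (cases "j \<in> a")
    case True
    let ?D = "\<lambda>p q. lift (seq (fstage m N j)) X p q - lift (mixed N) X p q"
    let ?t = "\<lambda>k l. \<Sum>S\<in>?I. X (S, k) (S, l)"
    \<comment> \<open>The remaining stages fix \<open>mixed N\<close>, so the deviation after stage
      \<open>j\<close> is merely passed through them and cannot grow.\<close>
    have "(\<lambda>p q. lift (fM m N [j..<m]) X p q - lift (mixed N) X p q) = lift ?M ?D"
      by (intro ext) (simp add: lift_def M good_op_diff[OF good] good_op_mixed[OF good])
    hence "tn (?I \<times> R) (\<lambda>p q. lift (fM m N [j..<m]) X p q - lift (mixed N) X p q) \<le> tn (?I \<times> R) ?D"
      using good_op_tn[OF good assms(1), of ?D] by simp
    also have "\<dots> = tn (?I \<times> R) (\<lambda>p q. if fst p = fst q \<and> fst p \<inter> ({..<m} - {j}) = {}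
      then (if j \<in> fst p then 1 else -1) / 2 ^ N * ?t (snd p) (snd q) else 0)"
    proof (rule tn_cong)
      fix p q assume pq: "p \<in> ?I \<times> R" "q \<in> ?I \<times> R"
      have on: "j \<in> S \<and> j \<in> T" if "X (S, snd p) (T, snd q) \<noteq> 0" for S T
        using supp[OF that] True by blast
      show "?D p q = (if fst p = fst q \<and> fst p \<inter> ({..<m} - {j}) = {}
          then (if j \<in> fst p then 1 else -1) / 2 ^ N * ?t (snd p) (snd q) else 0)"
        unfolding lift_def mixed_def
        by (rule fstage_on[OF on j(1) assms(2)]) (use pq in auto)
    qed
    also have "\<dots> \<le> ?\<delta> * tn R ?t" by (rule tn_diagonal_sign[OF assms(1,2) j(1)])
    also have "\<dots> \<le> ?\<delta> * tn (?I \<times> R) X"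
      using assms(1) by (intro mult_left_mono tn_partial_trace) auto
    finally show ?thesis .
  next
    case False
    define Y where "Y p q = X (flip j (fst p), snd p) (flip j (fst q), snd q)" for p q
    let ?D = "\<lambda>X p q. lift ?M X p q - lift (mixed N) X p q"
    have "a \<noteq> {}" using step.prems by auto
    have off: "seq (fstage m N j) (\<lambda>S T. X (S, k) (T, l))
        = (\<lambda>S T. (1/2) * X (S, k) (T, l) + (1/2) * Y (S, k) (T, l))" for k l
      unfolding Y_def fst_conv snd_conv
      by (rule fstage_off[OF supp j(1) False \<open>a \<noteq> {}\<close> step.prems(1)])
    have half: "mixed N (\<lambda>S T. X (S, k) (T, l)) S T
        = (1/2) * mixed N (\<lambda>S T. X (S, k) (T, l)) S T + (1/2) * mixed N (\<lambda>S T. Y (S, k) (T, l)) S T" for k l S T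
      using sum_flip[OF j(2), of "\<lambda>S T. X (S, k) (T, l)"] by (simp add: mixed_def Y_def)
    \<comment> \<open>The induction hypothesis serves both halves, with pattern \<open>a\<close> for
      \<open>X\<close> and \<open>insert j a\<close> for \<open>Y\<close>; the two weights 1/2 keep
      the bound unchanged.\<close>
    have "(\<lambda>p q. lift (fM m N [j..<m]) X p q - lift (mixed N) X p q)
      = (\<lambda>p q. (1/2) * ?D X p q + (1/2) * ?D Y p q)"
    proof (intro ext)
      fix p q
      have "lift (fM m N [j..<m]) X p q = (1/2) * lift ?M X p q + (1/2) * lift ?M Y p q"
        by (simp only: lift_def M off good_op_linear[OF good])
      moreover have "lift (mixed N) X p q = (1/2) * lift (mixed N) X p q + (1/2) * lift (mixed N) Y p q"
        unfolding lift_def by (rule half)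
      ultimately show "lift (fM m N [j..<m]) X p q - lift (mixed N) X p q
        = (1/2) * ?D X p q + (1/2) * ?D Y p q" by (simp add: algebra_simps)
    qed
    hence "tn (?I \<times> R) (\<lambda>p q. lift (fM m N [j..<m]) X p q - lift (mixed N) X p q)
      \<le> tn (?I \<times> R) (\<lambda>p q. (1/2) * ?D X p q) + tn (?I \<times> R) (\<lambda>p q. (1/2) * ?D Y p q)"
      using tn_triangle[OF fin] by simp
    also have "\<dots> = (1/2) * tn (?I \<times> R) (?D X) + (1/2) * tn (?I \<times> R) (?D Y)"
      by (simp only: tn_scale[OF fin]) simp
    also have "\<dots> \<le> (1/2) * (?\<delta> * tn (?I \<times> R) X) + (1/2) * (?\<delta> * tn (?I \<times> R) X)"
    proof (intro add_mono mult_left_mono)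
      show "tn (?I \<times> R) (?D X) \<le> ?\<delta> * tn (?I \<times> R) X"
      proof (rule step.IH[OF step.prems(1) _ step.prems(3)])
        obtain i where "i \<in> a" "j \<le> i" "i < m" using step.prems(2) by auto
        moreover have "i \<noteq> j" using \<open>i \<in> a\<close> False by blast
        ultimately show "a \<inter> {Suc j..<m} \<noteq> {}" by auto
      qed
      have "inj_on (\<lambda>p :: nat set \<times> nat. (flip j (fst p), snd p)) (?I \<times> R)"
        by (rule inj_on_inverseI[of _ "\<lambda>p. (flip j (fst p), snd p)"]) simp
      moreover have "(\<lambda>p. (flip j (fst p), snd p)) ` (?I \<times> R) \<subseteq> ?I \<times> R"
        by (rule image_subsetI) (simp add: mem_Times_iff flip_Pow[OF j(2)])
      ultimately have YX: "tn (?I \<times> R) Y \<le> tn (?I \<times> R) X"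
        unfolding Y_def by (rule tn_compress[OF fin])
      have "tn (?I \<times> R) (?D Y) \<le> ?\<delta> * tn (?I \<times> R) Y"
      proof (rule step.IH)
        show "insert j a \<subseteq> {..<m}" using step.prems(1) j(1) by simp
        obtain i where "i \<in> a" "j \<le> i" "i < m" using step.prems(2) by auto
        moreover have "i \<noteq> j" using \<open>i \<in> a\<close> False by blast
        ultimately show "insert j a \<inter> {Suc j..<m} \<noteq> {}" by auto
        fix p q assume "Y p q \<noteq> 0"
        hence *: "flip j (fst p) \<inter> {..<m} = a" "flip j (fst q) \<inter> {..<m} = a"
          unfolding Y_def using supp by blast+
        have "S \<inter> {..<m} = insert j a" if "flip j S \<inter> {..<m} = a" for S
        proof -
          have "j \<in> S" using that False j(1) by (auto simp: flip_def split: if_splits)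
          thus ?thesis using that j(1) by (auto simp: flip_def)
        qed
        thus "fst p \<inter> {..<m} = insert j a \<and> fst q \<inter> {..<m} = insert j a" using * by blast
      qed
      also have "\<dots> \<le> ?\<delta> * tn (?I \<times> R) X" using YX by (intro mult_left_mono) auto
      finally show "tn (?I \<times> R) (?D Y) \<le> ?\<delta> * tn (?I \<times> R) X" .
    qed auto
    finally show ?thesis by simp
  qed
qed

definition block :: "nat \<Rightarrow> nat set \<Rightarrow> (nat set \<times> nat \<Rightarrow> nat set \<times> nat \<Rightarrow> complex)
    \<Rightarrow> nat set \<times> nat \<Rightarrow> nat set \<times> nat \<Rightarrow> complex" where
  "block m a X p q = (if fst p \<inter> {..<m} = a \<and> fst q \<inter> {..<m} = a then X p q else 0)"

lemma tn_block:
  assumes "finite R"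
  shows "tn (Pow {..<N} \<times> R) (block m a X) = tn {p \<in> Pow {..<N} \<times> R. fst p \<inter> {..<m} = a} X"
proof -
  have "tn (Pow {..<N} \<times> R) (block m a X) = tn {p \<in> Pow {..<N} \<times> R. fst p \<inter> {..<m} = a} (block m a X)"
    using assms by (intro tn_support) (auto simp: block_def)
  also have "\<dots> = tn {p \<in> Pow {..<N} \<times> R. fst p \<inter> {..<m} = a} X"
    by (rule tn_cong) (simp add: block_def)
  finally show ?thesis .
qed

definition fD :: "nat \<Rightarrow> nat set mx \<Rightarrow> nat set mx" where
  "fD m = seq (map (\<lambda>q. hZ (zsign q)) [0..<m])"

lemma fD_apply: "fD m x S T = (if S \<inter> {..<m} = T \<inter> {..<m} then x S T else 0)"
  unfolding fD_def dephase_apply by (simp add: lessThan_atLeast0)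

lemma lift_fD_blocks: "lift (fD m) X p q = (\<Sum>a\<in>Pow {..<m}. block m a X p q)"
proof -
  have "(\<Sum>a\<in>Pow {..<m}. block m a X p q)
    = (\<Sum>a\<in>Pow {..<m}. if a = fst p \<inter> {..<m} then (if fst p \<inter> {..<m} = fst q \<inter> {..<m} then X p q else 0) else 0)"
    by (intro sum.cong) (auto simp: block_def)
  thus ?thesis by (simp add: lift_def fD_apply)
qed

text \<open>For \<open>m = 0\<close> the zero block is the only one and nothing is lost. The uniform
  value 2 there would make twice the error 4, too much for the case \<open>k = 0\<close> of the
  final estimate, where \<open>\<epsilon>\<close> may be as small as \<open>exp 1\<close>.\<close>

definition mixing_error :: "nat \<Rightarrow> real" where
  "mixing_error m = (if m = 0 then 0 else 2 / 2 ^ m)"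

text \<open>The mixed parts of all nonzero blocks collect into one operator \<open>e\<close> on the
  reference, tensored with the identity. The errors are proportional to the block norms and hence
  add up to a single multiple of the norm of \<open>X\<close>.\<close>

lemma fM_fD_decompose:
  fixes R :: "nat set"
  assumes "finite R" "m \<le> N"
  shows "\<exists>e. tn (Pow {..<N} \<times> R) (\<lambda>p q. lift (fM m N [0..<m]) (lift (fD m) X) p q
      - block m {} X p q - (if fst p = fst q then e (snd p) (snd q) else 0))
    \<le> mixing_error m * tn (Pow {..<N} \<times> R) X"
proof -
  let ?I = "Pow {..<N}"
  let ?M = "fM m N [0..<m]"
  let ?F = "Pow {..<m} - {{}}"
  have good: "good_op ?I ?M" using assms(2) by (intro good_op_fM) auto
  define e where "e k l = (\<Sum>a\<in>?F. (\<Sum>S\<in>?I. block m a X (S, k) (S, l)) / 2 ^ N)" for k l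
  have dec: "lift ?M (lift (fD m) X) p q - block m {} X p q - (if fst p = fst q then e (snd p) (snd q) else 0)
    = (\<Sum>a\<in>?F. lift ?M (block m a X) p q - lift (mixed N) (block m a X) p q)" for p q
  proof -
    have "lift ?M (lift (fD m) X) p q = (\<Sum>a\<in>Pow {..<m}. lift ?M (block m a X) p q)"
      unfolding lift_fD_blocks lift_def[of ?M] by (simp add: good_op_sum[OF good])
    also have "\<dots> = lift ?M (block m {} X) p q + (\<Sum>a\<in>?F. lift ?M (block m a X) p q)"
      by (subst sum.remove[of _ "{}"]) auto
    also have "lift ?M (block m {} X) p q = block m {} X p q"
      unfolding lift_def by (subst fM_zero_block) (auto simp: block_def split: if_splits)
    finally show ?thesis
      by (simp add: sum_subtractf lift_def[of "mixed N"] mixed_def e_def)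
  qed
  have "tn (?I \<times> R) (\<lambda>p q. \<Sum>a\<in>?F. lift ?M (block m a X) p q - lift (mixed N) (block m a X) p q)
    \<le> (\<Sum>a\<in>?F. tn (?I \<times> R) (\<lambda>p q. lift ?M (block m a X) p q - lift (mixed N) (block m a X) p q))"
    using assms by (intro tn_sum) auto
  also have "\<dots> \<le> (\<Sum>a\<in>?F. mixing_error m * tn (?I \<times> R) (block m a X))"
  proof (rule sum_mono)
    fix a assume a: "a \<in> ?F"
    hence "m \<noteq> 0" by auto
    thus "tn (?I \<times> R) (\<lambda>p q. lift ?M (block m a X) p q - lift (mixed N) (block m a X) p q)
        \<le> mixing_error m * tn (?I \<times> R) (block m a X)"
      unfolding mixing_error_def if_not_P[OF \<open>m \<noteq> 0\<close>]
      using a by (intro fM_nonzero_block[where a = a] assms) (auto simp: block_def lessThan_atLeast0 split: if_splits)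
  qed
  also have "\<dots> = mixing_error m * (\<Sum>a\<in>?F. tn {p \<in> ?I \<times> R. fst p \<inter> {..<m} = a} X)"
    by (simp add: sum_distrib_left tn_block[OF assms(1)])
  also have "\<dots> \<le> mixing_error m * tn (?I \<times> R) X"
    using assms by (intro mult_left_mono tn_pinch) (auto simp: mixing_error_def)
  finally show ?thesis by (intro exI[of _ e]) (simp only: dec)
qed

section \<open>Transfer to matrices\<close>

text \<open>Qubit 0 is the most significant bit, as in \<open>qbit\<close>; the recursion appends
  the next qubit as the least significant one.\<close>

fun code :: "nat \<Rightarrow> nat set \<Rightarrow> nat" where
  "code 0 S = 0"
| "code (Suc N) S = 2 * code N S + (if N \<in> S then 1 else 0)"

lemma code_less: "code N S < 2 ^ N"
  by (induction N) auto

lemma code_cong: "(\<And>q. q < N \<Longrightarrow> q \<in> S \<longleftrightarrow> q \<in> T) \<Longrightarrow> code N S = code N T"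
  by (induction N) auto

lemma code_div: "code (K + b) S div 2 ^ b = code K S"
proof (induction b)
  case (Suc b)
  have "code (K + Suc b) S div 2 ^ Suc b = (code (K + Suc b) S div 2) div 2 ^ b"
    by (simp only: power_Suc div_mult2_eq)
  also have "code (K + Suc b) S div 2 = code (K + b) S" by simp
  finally show ?case using Suc by simp
qed simp

lemma code_Un: "S \<inter> T = {} \<Longrightarrow> code N (S \<union> T) = code N S + code N T"
  by (induction N) auto

lemma code_high: "code (K + b) (S \<inter> {..<K}) = code K S * 2 ^ b"
proof (induction b)
  case 0
  show ?case by (simp, rule code_cong) auto
qed auto

lemma code_split: "code (K + b) S = code K S * 2 ^ b + code (K + b) (S \<inter> {K..})"
proof -
  have "S = (S \<inter> {..<K}) \<union> (S \<inter> {K..})" by auto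
  hence "code (K + b) S = code (K + b) (S \<inter> {..<K}) + code (K + b) (S \<inter> {K..})"
    using code_Un[of "S \<inter> {..<K}" "S \<inter> {K..}" "K + b"] by fastforce
  thus ?thesis by (simp add: code_high)
qed

lemma code_empty_iff: "code N S = 0 \<longleftrightarrow> S \<inter> {..<N} = {}"
proof (induction N)
  case (Suc N)
  have "S \<inter> {..<Suc N} = {} \<longleftrightarrow> S \<inter> {..<N} = {} \<and> N \<notin> S" by (auto simp: less_Suc_eq)
  thus ?case using Suc by simp
qed simp

lemma code_low_less:
  assumes "L \<subseteq> {K..}"
  shows "code (K + b) L < 2 ^ b"
proof -
  have "code (K + b) L div 2 ^ b = 0"
    unfolding code_div code_empty_iff using assms by auto
  thus ?thesis by (simp add: div_eq_0_iff)
qed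

lemma qbit_code:
  assumes "q < N"
  shows "qbit N q (code N S) \<longleftrightarrow> q \<in> S"
proof -
  have N: "N = Suc q + (N - 1 - q)" using assms by simp
  have "code N S div 2 ^ (N - 1 - q) = code (Suc q) S"
    using code_div[of "Suc q" "N - 1 - q" S] N by simp
  thus ?thesis by (simp add: qbit_def)
qed

text \<open>Stated over the integers because the change is negative when \<open>q\<close> is
  set.\<close>

lemma code_flip:
  "int (code (Suc q + d) (flip q S)) = int (code (Suc q + d) S) + (if q \<in> S then - (2 ^ d) else 2 ^ d)"
proof (induction d)
  case 0
  have "code q (flip q S) = code q S" by (rule code_cong) (auto simp: flip_mem)
  thus ?case by (simp add: flip_mem)
next
  case (Suc d)
  thus ?case by (auto simp: flip_mem)
qed

lemma qflip_code:
  assumes "q < N"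
  shows "qflip N q (code N S) = code N (flip q S)"
proof -
  define d where "d = N - 1 - q"
  have N: "N = Suc q + d" using assms by (simp add: d_def)
  have *: "qflip N q (code N S) = (if q \<in> S then code N S - 2 ^ d else code N S + 2 ^ d)"
    by (simp add: qflip_def qbit_code[OF assms] d_def)
  show ?thesis
  proof (cases "q \<in> S")
    case True
    have "int (code N S) = int (code N (flip q S)) + int (2 ^ d)"
      using code_flip[of q d S] True unfolding N by simp
    hence "code N S = code N (flip q S) + 2 ^ d" by (simp only: of_nat_eq_iff flip: of_nat_add)
    thus ?thesis using True * by simp
  next
    case False
    have "int (code N (flip q S)) = int (code N S) + int (2 ^ d)"
      using code_flip[of q d S] False unfolding N by simp
    hence "code N (flip q S) = code N S + 2 ^ d" by (simp only: of_nat_eq_iff flip: of_nat_add)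
    thus ?thesis using False * by simp
  qed
qed

lemma code_inj: "inj_on (code N) (Pow {..<N})"
proof (rule inj_onI)
  fix S T assume "S \<in> Pow {..<N}" "T \<in> Pow {..<N}" "code N S = code N T"
  thus "S = T" using qbit_code[of _ N S] qbit_code[of _ N T] by auto
qed

lemma bij_code: "bij_betw (code N) (Pow {..<N}) {..<2 ^ N}"
proof -
  have "code N ` Pow {..<N} = {..<2 ^ N}"
    by (rule card_subset_eq) (auto simp: code_less card_image[OF code_inj] card_Pow)
  thus ?thesis using code_inj by (simp add: bij_betw_def)
qed

lemma bij_code_low: "bij_betw (code (K + b)) (Pow {K..<K + b}) {..<2 ^ b}"
proof -
  have inj: "inj_on (code (K + b)) (Pow {K..<K + b})"
    by (rule inj_on_subset[OF code_inj]) auto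
  have "code (K + b) ` Pow {K..<K + b} = {..<2 ^ b}"
    by (rule card_subset_eq) (auto simp: card_image[OF inj] card_Pow intro!: code_low_less)
  thus ?thesis using inj by (simp add: bij_betw_def)
qed

lemma code_mod_eq_iff:
  assumes "S \<subseteq> {..<K + b}" "T \<subseteq> {..<K + b}"
  shows "code (K + b) S mod 2 ^ b = code (K + b) T mod 2 ^ b \<longleftrightarrow> S \<inter> {K..<K + b} = T \<inter> {K..<K + b}"
proof -
  have "code (K + b) S mod 2 ^ b = code (K + b) (S \<inter> {K..<K + b})" if "S \<subseteq> {..<K + b}" for S
  proof -
    have "S \<inter> {K..} = S \<inter> {K..<K + b}" using that by auto
    hence "code (K + b) S = code K S * 2 ^ b + code (K + b) (S \<inter> {K..<K + b})"
      using code_split[of K b S] by simp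
    moreover have "code (K + b) (S \<inter> {K..<K + b}) < 2 ^ b" by (rule code_low_less) auto
    ultimately show ?thesis by simp
  qed
  thus ?thesis using assms inj_on_eq_iff[OF code_inj[of "K + b"], of "S \<inter> {K..<K + b}" "T \<inter> {K..<K + b}"]
    by auto
qed

lemma code_replace_low:
  assumes "L \<subseteq> {K..<K + b}" "S \<subseteq> {..<K + b}"
  shows "code (K + b) (S - {K..<K + b} \<union> L) = code K S * 2 ^ b + code (K + b) L"
proof -
  have "S - {K..<K + b} = S \<inter> {..<K}" using assms(2) by auto
  thus ?thesis using assms code_Un[of "S \<inter> {..<K}" L "K + b"] by (force simp: code_high)
qed

section \<open>Matrix channels represented on subset-indexed operators\<close>

definition emb :: "nat \<Rightarrow> complex mat \<Rightarrow> nat set \<Rightarrow> nat set \<Rightarrow> complex" where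
  "emb N \<rho> S T = \<rho> $$ (code N S, code N T)"

text \<open>An equation between functions on all sets: \<open>code N\<close> sees only the qubits
  below \<open>N\<close>, so no side condition on the indices has to be carried through
  compositions.\<close>

definition represents :: "nat \<Rightarrow> (complex mat \<Rightarrow> complex mat)
    \<Rightarrow> (nat set mx \<Rightarrow> nat set mx) \<Rightarrow> bool" where
  "represents N \<Phi> \<phi> \<longleftrightarrow>
     (\<forall>\<rho>\<in>qmats N. \<Phi> \<rho> \<in> qmats N \<and> emb N (\<Phi> \<rho>) = \<phi> (emb N \<rho>))"

lemma represents_comp:
  "represents N \<Phi> \<phi> \<Longrightarrow> represents N \<Psi> \<psi> \<Longrightarrow> represents N (\<lambda>\<rho>. \<Phi> (\<Psi> \<rho>)) (\<lambda>x. \<phi> (\<psi> x))"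
  by (simp add: represents_def)

lemma represents_seq:
  assumes "\<And>x. x \<in> set xs \<Longrightarrow> represents N (F x) (f x)"
  shows "represents N (seq (map F xs)) (seq (map f xs))"
  unfolding represents_def
proof
  fix \<rho> :: "complex mat" assume "\<rho> \<in> qmats N"
  thus "seq (map F xs) \<rho> \<in> qmats N \<and> emb N (seq (map F xs) \<rho>) = seq (map f xs) (emb N \<rho>)"
    using assms by (induction xs arbitrary: \<rho>) (simp_all add: represents_def)
qed

lemma represents_append:
  assumes "represents N (seq Fs) (seq fs)" "represents N (seq Gs) (seq gs)"
  shows "represents N (seq (Fs @ Gs)) (seq (fs @ gs))"
  using assms by (simp add: represents_def)

lemma seq_concat: "seq (concat (map F xs)) = seq (map (\<lambda>x. seq (F x)) xs)"
proof
  show "seq (concat (map F xs)) \<rho> = seq (map (\<lambda>x. seq (F x)) xs) \<rho>" for \<rho>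
    by (induction xs arbitrary: \<rho>) simp_all
qed

lemma conj_by_carrier:
  "U \<in> carrier_mat d d \<Longrightarrow> \<rho> \<in> carrier_mat d d \<Longrightarrow> conj_by U \<rho> \<in> carrier_mat d d"
  unfolding conj_by_def by (auto intro!: mult_carrier_mat)

lemma conj_by_index:
  assumes "U \<in> carrier_mat d d" "\<rho> \<in> carrier_mat d d" "i < d" "j < d"
  shows "conj_by U \<rho> $$ (i, j) = (\<Sum>p<d. \<Sum>q<d. U $$ (i, p) * \<rho> $$ (p, q) * cnj (U $$ (j, q)))"
proof -
  have "conj_by U \<rho> $$ (i, j) = (\<Sum>q<d. (\<Sum>p<d. U $$ (i, p) * \<rho> $$ (p, q)) * cnj (U $$ (j, q)))"
    unfolding conj_by_def using assms
    by (simp add: mat_mult_index[of "U * \<rho>" d d "adj U" d] mat_mult_index[of U d d \<rho> d] adj_index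
        del: index_mult_mat(1))
  also have "\<dots> = (\<Sum>q<d. \<Sum>p<d. U $$ (i, p) * \<rho> $$ (p, q) * cnj (U $$ (j, q)))"
    by (simp only: sum_distrib_right)
  also have "\<dots> = (\<Sum>p<d. \<Sum>q<d. U $$ (i, p) * \<rho> $$ (p, q) * cnj (U $$ (j, q)))"
    by (rule sum.swap)
  finally show ?thesis .
qed

lemma half_apply_carrier:
  "U \<in> carrier_mat d d \<Longrightarrow> \<rho> \<in> carrier_mat d d \<Longrightarrow> half_apply U \<rho> \<in> carrier_mat d d"
  unfolding half_apply_def using conj_by_carrier by auto

lemma half_apply_index:
  assumes "U \<in> carrier_mat d d" "\<rho> \<in> carrier_mat d d" "i < d" "j < d"
  shows "half_apply U \<rho> $$ (i, j) = (1/2) * (\<rho> $$ (i, j) + conj_by U \<rho> $$ (i, j))"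
  using assms conj_by_carrier[OF assms(1,2)] unfolding half_apply_def by auto

lemma sum_pick2:
  fixes f :: "nat \<Rightarrow> nat \<Rightarrow> complex"
  assumes "a < d" "b < d"
  shows "(\<Sum>p<d. \<Sum>q<d. (if p = a then u else 0) * f p q * (if q = b then v else 0)) = u * f a b * v"
proof -
  have q: "(\<Sum>q<d. g q * (if q = b then v else 0)) = g b * v" for g
  proof -
    have "(\<Sum>q<d. g q * (if q = b then v else 0)) = (\<Sum>q<d. if q = b then g b * v else 0)"
      by (intro sum.cong) auto
    thus ?thesis using assms(2) by simp
  qed
  have "(\<Sum>p<d. (if p = a then u else 0) * f p b * v) = (\<Sum>p<d. if p = a then u * f a b * v else 0)"
    by (intro sum.cong) auto
  thus ?thesis unfolding q using assms(1) by simp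
qed

lemma represents_hZ:
  assumes "G = mat (2 ^ N) (2 ^ N) (\<lambda>(i, j). if i = j then g i else 0)"
    and "\<And>S. g (code N S) = s S" "\<And>S. cnj (s S) = s S"
  shows "represents N (half_apply G) (hZ s)"
  unfolding represents_def
proof (intro ballI conjI)
  fix \<rho> :: "complex mat" assume \<rho>: "\<rho> \<in> qmats N"
  have G: "G \<in> qmats N" by (simp add: assms(1))
  show "half_apply G \<rho> \<in> qmats N" by (rule half_apply_carrier[OF G \<rho>])
  show "emb N (half_apply G \<rho>) = hZ s (emb N \<rho>)"
  proof (intro ext)
    fix S T
    note l = code_less[of N S] code_less[of N T]
    have "conj_by G \<rho> $$ (code N S, code N T) = (\<Sum>p<2 ^ N. \<Sum>q<2 ^ N.
        (if p = code N S then s S else 0) * \<rho> $$ (p, q) * (if q = code N T then s T else 0))"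
      unfolding conj_by_index[OF G \<rho> l]
      by (intro sum.cong refl) (use l assms in auto)
    also have "\<dots> = s S * \<rho> $$ (code N S, code N T) * s T" by (rule sum_pick2[OF l])
    finally show "emb N (half_apply G \<rho>) S T = hZ s (emb N \<rho>) S T"
      by (simp add: emb_def hZ_def half_apply_index[OF G \<rho> l])
  qed
qed

lemma represents_hX:
  assumes "G = mat (2 ^ N) (2 ^ N) (\<lambda>(i, j). if i = g j then 1 else 0)"
    and g: "\<And>S. g (code N S) = code N (\<pi> S)" and inv: "\<And>S. \<pi> (\<pi> S) = S"
  shows "represents N (half_apply G) (hX \<pi>)"
  unfolding represents_def
proof (intro ballI conjI)
  fix \<rho> :: "complex mat" assume \<rho>: "\<rho> \<in> qmats N"
  have G: "G \<in> qmats N" by (simp add: assms(1))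
  \<comment> \<open>The matrix gives the row as a function of the column; as \<open>\<pi>\<close> is
    an involution, the column is the same function of the row.\<close>
  have Gi: "G $$ (code N S, p) = (if p = code N (\<pi> S) then 1 else 0)" if p: "p < 2 ^ N" for S p
  proof -
    obtain P where P: "p = code N P" using bij_code[of N] p by (auto simp: bij_betw_def)
    have "code N S = code N (\<pi> P) \<longleftrightarrow> code N P = code N (\<pi> S)"
      by (metis g inv)
    thus ?thesis using p code_less[of N S] by (simp add: assms(1) P g)
  qed
  show "half_apply G \<rho> \<in> qmats N" by (rule half_apply_carrier[OF G \<rho>])
  show "emb N (half_apply G \<rho>) = hX \<pi> (emb N \<rho>)"
  proof (intro ext)
    fix S T
    note l = code_less[of N S] code_less[of N T]
    have "conj_by G \<rho> $$ (code N S, code N T) = (\<Sum>p<2 ^ N. \<Sum>q<2 ^ N.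
        (if p = code N (\<pi> S) then 1 else 0) * \<rho> $$ (p, q) * (if q = code N (\<pi> T) then 1 else 0))"
      unfolding conj_by_index[OF G \<rho> l]
      by (intro sum.cong refl) (auto simp: Gi)
    also have "\<dots> = 1 * \<rho> $$ (code N (\<pi> S), code N (\<pi> T)) * 1"
      by (rule sum_pick2) (rule code_less)+
    finally show "emb N (half_apply G \<rho>) S T = hX \<pi> (emb N \<rho>) S T"
      by (simp add: emb_def hX_def half_apply_index[OF G \<rho> l])
  qed
qed

lemma represents_Zgate: "q < N \<Longrightarrow> represents N (half_apply (Zgate N q)) (hZ (zsign q))"
  by (rule represents_hZ[OF Zgate_def]) (auto simp: qbit_code zsign_def)

lemma represents_Nchan:
  assumes "q < N"
  shows "represents N (Nchan N q) (fN q)"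
  unfolding Nchan_def fN_def comp_def
proof (rule represents_comp[OF represents_hX[OF Xgate_def] represents_Zgate[OF assms]])
  show "qflip N q (code N S) = code N (flip q S)" for S by (rule qflip_code[OF assms])
qed simp

lemma represents_ctrlN:
  assumes "c < N" "t < N" "c \<noteq> t"
  shows "represents N (ctrlN N c t) (fcN c t)"
  unfolding ctrlN_def fcN_def comp_def
proof (rule represents_comp[OF represents_hX[OF CXgate_def] represents_hZ[OF CZgate_def]])
  show "(if qbit N c (code N S) then qflip N t (code N S) else code N S) = code N (cflip c t S)" for S
    by (simp add: qbit_code[OF assms(1)] qflip_code[OF assms(2)] cflip_def)
  show "cflip c t (cflip c t S) = S" for S by (rule cflip_cflip[OF assms(3)])
  show "(if qbit N c (code N S) \<and> qbit N t (code N S) then -1 else 1) = czsign c t S" for S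
    by (simp add: qbit_code assms(1,2) czsign_def)
qed (simp add: czsign_def)

lemma represents_D_A: "m \<le> N \<Longrightarrow> represents N (D_A m N) (fD m)"
  unfolding D_A_def fD_def by (rule represents_seq) (auto intro!: represents_Zgate)

lemma represents_N_B: "represents N (N_B K N) (seq (map fN [K..<N]))"
  unfolding N_B_def by (rule represents_seq) (auto intro!: represents_Nchan)

lemma represents_M_chan: "m \<le> N \<Longrightarrow> represents N (M_chan m N) (fM m N [0..<m])"
  unfolding M_chan_def fM_def seq_concat M_stage_def fstage_def
  by (intro represents_seq represents_append) (auto intro!: represents_ctrlN)

definition fconj :: "nat \<Rightarrow> nat set mx
    \<Rightarrow> nat set mx \<Rightarrow> nat set mx" where
  "fconj N u x S T = (\<Sum>S'\<in>Pow {..<N}. \<Sum>T'\<in>Pow {..<N}. u S S' * x S' T' * cnj (u T T'))"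

lemma represents_conj_by:
  assumes U: "U \<in> qmats N"
  shows "represents N (conj_by U) (fconj N (emb N U))"
  unfolding represents_def
proof (intro ballI conjI ext)
  fix \<rho> :: "complex mat" assume \<rho>: "\<rho> \<in> qmats N"
  show "conj_by U \<rho> \<in> qmats N" by (rule conj_by_carrier[OF U \<rho>])
  fix S T
  show "emb N (conj_by U \<rho>) S T = fconj N (emb N U) (emb N \<rho>) S T"
    unfolding emb_def fconj_def conj_by_index[OF U \<rho> code_less code_less]
      sum.reindex_bij_betw[OF bij_code, symmetric] ..
qed

section \<open>The unitary circuit followed by discarding\<close>

lemma unitary_carrier: "is_unitary d U \<Longrightarrow> U \<in> carrier_mat d d"
  by (simp add: is_unitary_def)

lemma unitary_columns:
  assumes "is_unitary d U" "i < d" "j < d"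
  shows "(\<Sum>r<d. cnj (U $$ (r, i)) * U $$ (r, j)) = (if i = j then 1 else 0)"
proof -
  have U: "U \<in> carrier_mat d d" by (rule unitary_carrier[OF assms(1)])
  have "(adj U * U) $$ (i, j) = (\<Sum>r<d. cnj (U $$ (r, i)) * U $$ (r, j))"
    using assms U by (subst mat_mult_index[of "adj U" d d U d]) (auto simp: adj_index)
  thus ?thesis using assms by (simp add: is_unitary_def)
qed

text \<open>A left inverse of a square matrix is a right inverse. Orthonormal columns make the
  conjugation contractive, orthonormal rows make it unital.\<close>

lemma unitary_rows:
  assumes "is_unitary d U" "i < d" "j < d"
  shows "(\<Sum>r<d. U $$ (i, r) * cnj (U $$ (j, r))) = (if i = j then 1 else 0)"
proof -
  have U: "U \<in> carrier_mat d d" by (rule unitary_carrier[OF assms(1)])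
  have "U * adj U = 1\<^sub>m d"
    using assms(1) mat_mult_left_right_inverse[of "adj U" d U] U by (simp add: is_unitary_def)
  moreover have "(U * adj U) $$ (i, j) = (\<Sum>r<d. U $$ (i, r) * cnj (U $$ (j, r)))"
    using assms U by (subst mat_mult_index[of U d d "adj U" d]) (auto simp: adj_index)
  ultimately show ?thesis using assms by simp
qed

lemma contr_emb:
  assumes "is_unitary (2 ^ N) U"
  shows "contr (Pow {..<N}) (Pow {..<N}) (emb N U)"
proof -
  have "orthonormal_columns (Pow {..<N}) (emb N U)"
    unfolding orthonormal_columns_def
  proof (intro ballI)
    fix S T assume ST: "S \<in> Pow {..<N}" "T \<in> Pow {..<N}"
    have "(\<Sum>R\<in>Pow {..<N}. cnj (emb N U R S) * emb N U R T)
      = (\<Sum>r<2 ^ N. cnj (U $$ (r, code N S)) * U $$ (r, code N T))"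
      unfolding emb_def by (rule sum.reindex_bij_betw[OF bij_code])
    also have "\<dots> = (if S = T then 1 else 0)"
      unfolding unitary_columns[OF assms code_less code_less] inj_on_eq_iff[OF code_inj ST] ..
    finally show "(\<Sum>R\<in>Pow {..<N}. cnj (emb N U R S) * emb N U R T) = (if S = T then 1 else 0)" .
  qed
  thus ?thesis by (rule orthonormal_columns_contr) simp
qed

lemma fconj_linear:
  "fconj N u (\<lambda>S T. c * x S T + d * y S T) = (\<lambda>S T. c * fconj N u x S T + d * fconj N u y S T)"
proof (intro ext)
  fix S T
  have "fconj N u (\<lambda>S T. c * x S T + d * y S T) S T = (\<Sum>S'\<in>Pow {..<N}. \<Sum>T'\<in>Pow {..<N}.
     c * (u S S' * x S' T' * cnj (u T T')) + d * (u S S' * y S' T' * cnj (u T T')))"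
    unfolding fconj_def by (intro sum.cong refl) (simp add: algebra_simps)
  thus "fconj N u (\<lambda>S T. c * x S T + d * y S T) S T = c * fconj N u x S T + d * fconj N u y S T"
    by (simp only: sum.distrib fconj_def sum_distrib_left)
qed

text \<open>The indices are restricted because distinct sets that agree below \<open>N\<close> have
  equal codes, and there the left side would still be \<open>c\<close>.\<close>

lemma fconj_unital:
  assumes "is_unitary (2 ^ N) U" "S \<in> Pow {..<N}" "T \<in> Pow {..<N}"
  shows "fconj N (emb N U) (\<lambda>S T. if S = T then c else 0) S T = (if S = T then c else 0)"
proof -
  have "fconj N (emb N U) (\<lambda>S T. if S = T then c else 0) S T
    = (\<Sum>S'\<in>Pow {..<N}. \<Sum>T'\<in>Pow {..<N}. if T' = S' then c * (emb N U S S' * cnj (emb N U T S')) else 0)"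
    unfolding fconj_def by (intro sum.cong refl) auto
  also have "\<dots> = (\<Sum>S'\<in>Pow {..<N}. c * (emb N U S S' * cnj (emb N U T S')))"
    by (intro sum.cong refl) simp
  also have "\<dots> = c * (\<Sum>S'\<in>Pow {..<N}. U $$ (code N S, code N S') * cnj (U $$ (code N T, code N S')))"
    by (simp only: sum_distrib_left emb_def)
  also have "(\<Sum>S'\<in>Pow {..<N}. U $$ (code N S, code N S') * cnj (U $$ (code N T, code N S')))
     = (\<Sum>r<2 ^ N. U $$ (code N S, r) * cnj (U $$ (code N T, r)))"
    by (rule sum.reindex_bij_betw[OF bij_code])
  also have "\<dots> = (if S = T then 1 else 0)"
    unfolding unitary_rows[OF assms(1) code_less code_less] inj_on_eq_iff[OF code_inj assms(2,3)] ..
  finally show ?thesis by simp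
qed

lemma tn_fconj:
  assumes "contr (Pow {..<N}) (Pow {..<N}) u" "finite R"
  shows "tn (Pow {..<N} \<times> R) (lift (fconj N u) X) \<le> tn (Pow {..<N} \<times> R) X"
proof -
  have fin: "finite (Pow {..<N})" by simp
  show ?thesis
    using tn_conj_left[OF fin fin assms(2,1) contr_cnj[OF assms(1)], of X]
    unfolding lift_def fconj_def .
qed

lemma fconj_3:
  "fconj N u (\<lambda>S T. x S T + y S T + z S T) S T = fconj N u x S T + fconj N u y S T + fconj N u z S T"
  using fconj_linear[of N u 1 "\<lambda>S T. x S T + y S T" 1 z] fconj_linear[of N u 1 x 1 y] by simp

text \<open>The multiple \<open>e\<close> of the identity is fixed by both unitaries, so it cancels in the difference.\<close>
lemma tn_unitary_pair_diff:
  fixes R :: "nat set" and Y P Z :: "nat set \<times> nat \<Rightarrow> nat set \<times> nat \<Rightarrow> complex"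
  assumes U1: "is_unitary (2 ^ N) U1" and U2: "is_unitary (2 ^ N) U2"
    and B: "good_op (Pow {..<N}) B" and R: "finite R"
    and Y: "\<And>p q. Y p q = P p q + (if fst p = fst q then e (snd p) (snd q) else 0) + Z p q"
  shows "tn (Pow {..<N} \<times> R) (\<lambda>p q. lift B (lift (fconj N (emb N U1)) Y) p q - lift B (lift (fconj N (emb N U2)) Y) p q)
    \<le> tn (Pow {..<N} \<times> R) (\<lambda>p q. lift B (lift (fconj N (emb N U1)) P) p q - lift B (lift (fconj N (emb N U2)) P) p q)
      + 2 * tn (Pow {..<N} \<times> R) Z"
proof -
  let ?I = "Pow {..<N} \<times> R"
  let ?c1 = "lift (fconj N (emb N U1))" and ?c2 = "lift (fconj N (emb N U2))"
  let ?E = "\<lambda>p q. if fst p = fst q then e (snd p) (snd q) else 0 :: complex"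
  let ?\<Delta> = "\<lambda>X p q. ?c1 X p q - ?c2 X p q"
  have fin: "finite ?I" using R by simp
  have lB: "lift B (?\<Delta> X) = (\<lambda>p q. lift B (?c1 X) p q - lift B (?c2 X) p q)" for X
    unfolding lift_def[of B] by (simp add: good_op_diff[OF B])
  have c3: "lift (fconj N u) Y p q = lift (fconj N u) P p q + lift (fconj N u) ?E p q + lift (fconj N u) Z p q" for u p q
    unfolding lift_def Y by (rule fconj_3)
  have D3: "?\<Delta> Y = (\<lambda>p q. (?\<Delta> P p q + ?\<Delta> E p q) + ?\<Delta> Z p q)" if "E = ?E" for E
    unfolding c3 that by (intro ext) simp
  have B3: "lift B (\<lambda>p q. (F p q + G p q) + H p q) = (\<lambda>p q. (lift B F p q + lift B G p q) + lift B H p q)" for F G H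
    using good_op_linear[OF B, of 1 _ 1] unfolding lift_def by simp
  have "tn ?I (lift B (?\<Delta> Y)) \<le> tn ?I (lift B (?\<Delta> P)) + tn ?I (lift B (?\<Delta> ?E)) + tn ?I (lift B (?\<Delta> Z))"
    unfolding D3[OF refl] B3
    by (intro order_trans[OF tn_triangle[OF fin]] add_right_mono tn_triangle[OF fin])
  also have "tn ?I (lift B (?\<Delta> ?E)) \<le> tn ?I (?\<Delta> ?E)"
    by (rule good_op_tn[OF B R])
  also have "tn ?I (?\<Delta> ?E) = tn ?I (\<lambda>p q. 0)"
  proof (rule tn_cong)
    fix p q assume pq: "p \<in> ?I" "q \<in> ?I"
    have "lift (fconj N (emb N U)) ?E p q = ?E p q" if U: "is_unitary (2 ^ N) U" for U
      unfolding lift_def fst_conv snd_conv by (rule fconj_unital[OF U]) (use pq in auto)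
    thus "?\<Delta> ?E p q = 0" using U1 U2 by simp
  qed
  also have "\<dots> = 0" by (rule tn_zero[OF fin])
  also have "tn ?I (lift B (?\<Delta> Z)) \<le> tn ?I (?\<Delta> Z)"
    by (rule good_op_tn[OF B R])
  also have "\<dots> \<le> tn ?I (?c1 Z) + tn ?I (?c2 Z)" by (rule tn_diff[OF fin])
  also have "\<dots> \<le> tn ?I Z + tn ?I Z"
    by (intro add_mono tn_fconj contr_emb U1 U2 R)
  finally show ?thesis by (simp add: lB)
qed

section \<open>The zero block: circuit and discarding give the Q channel next to a maximally mixed
  register\<close>

lemma kron_proj0:
  assumes \<rho>: "\<rho> \<in> carrier_mat d d" and d: "0 < d" and pq: "p < D * d" "q < D * d"
  shows "kron (proj0 D) \<rho> $$ (p, q) = (if p < d \<and> q < d then \<rho> $$ (p, q) else 0)"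
proof -
  have "p div d < D" "q div d < D" using pq by (simp_all add: less_mult_imp_div_less)
  thus ?thesis using assms by (auto simp: kron_def proj0_def div_eq_0_iff)
qed

lemma sum_restrict2:
  fixes F G :: "nat \<Rightarrow> complex"
  assumes "d \<le> D"
  shows "(\<Sum>p<D. \<Sum>q<D. F p * (if p < d \<and> q < d then x p q else 0) * G q) = (\<Sum>p<d. \<Sum>q<d. F p * x p q * G q)"
proof -
  have "(\<Sum>p<D. \<Sum>q<D. F p * (if p < d \<and> q < d then x p q else 0) * G q)
    = (\<Sum>p<d. \<Sum>q<D. F p * (if p < d \<and> q < d then x p q else 0) * G q)"
    using assms by (intro sum.mono_neutral_right) auto
  also have "\<dots> = (\<Sum>p<d. \<Sum>q<d. F p * (if p < d \<and> q < d then x p q else 0) * G q)"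
    using assms by (intro sum.cong refl sum.mono_neutral_right) auto
  also have "\<dots> = (\<Sum>p<d. \<Sum>q<d. F p * x p q * G q)" by (intro sum.cong refl) simp
  finally show ?thesis .
qed

lemma pair_code_less: "i < 2 ^ K \<Longrightarrow> l < 2 ^ b \<Longrightarrow> i * 2 ^ b + l < (2 :: nat) ^ (K + b)"
  using bij_betwE[OF bij_pair_code[of "2 ^ b" "2 ^ K"]] by (force simp: power_add)

text \<open>The ancilla is the leading tensor factor and in state 0, so only the first
  \<open>2 ^ n\<close> columns of \<open>U\<close> contribute.\<close>

lemma Qchan_index:
  assumes U: "U \<in> qmats (m + n)" and \<rho>: "\<rho> \<in> qmats n"
    and K: "m + n = K + b" and ij: "i < 2 ^ K" "j < 2 ^ K"
  shows "Qchan m n b U \<rho> $$ (i, j)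
    = (\<Sum>l<2 ^ b. \<Sum>p<2 ^ n. \<Sum>q<2 ^ n. U $$ (i * 2 ^ b + l, p) * \<rho> $$ (p, q) * cnj (U $$ (j * 2 ^ b + l, q)))"
proof -
  let ?D = "2 ^ (m + n) :: nat"
  have k: "kron (proj0 (2 ^ m)) \<rho> \<in> carrier_mat ?D ?D"
    using \<rho> by (simp add: kron_def proj0_def power_add)
  have "conj_by U (kron (proj0 (2 ^ m)) \<rho>) $$ (i * 2 ^ b + l, j * 2 ^ b + l)
    = (\<Sum>p<2 ^ n. \<Sum>q<2 ^ n. U $$ (i * 2 ^ b + l, p) * \<rho> $$ (p, q) * cnj (U $$ (j * 2 ^ b + l, q)))"
    if l: "l < 2 ^ b" for l
  proof -
    have "conj_by U (kron (proj0 (2 ^ m)) \<rho>) $$ (i * 2 ^ b + l, j * 2 ^ b + l)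
      = (\<Sum>p<?D. \<Sum>q<?D. U $$ (i * 2 ^ b + l, p) * kron (proj0 (2 ^ m)) \<rho> $$ (p, q) * cnj (U $$ (j * 2 ^ b + l, q)))"
      using pair_code_less[OF ij(1) l] pair_code_less[OF ij(2) l] K by (intro conj_by_index[OF U k]) auto
    also have "\<dots> = (\<Sum>p<?D. \<Sum>q<?D. U $$ (i * 2 ^ b + l, p) * (if p < 2 ^ n \<and> q < 2 ^ n then \<rho> $$ (p, q) else 0)
        * cnj (U $$ (j * 2 ^ b + l, q)))"
      by (intro sum.cong refl) (simp add: kron_proj0[OF \<rho>] power_add)
    also have "\<dots> = (\<Sum>p<2 ^ n. \<Sum>q<2 ^ n. U $$ (i * 2 ^ b + l, p) * \<rho> $$ (p, q) * cnj (U $$ (j * 2 ^ b + l, q)))"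
      by (rule sum_restrict2) simp
    finally show ?thesis .
  qed
  thus ?thesis using ij K by (simp add: Qchan_def ptrace_def)
qed

lemma op_of_Qchan:
  assumes U: "U \<in> qmats (m + n)" and K: "m + n = K + b" and ij: "i < 2 ^ K" "j < 2 ^ K"
  shows "op_of (2 ^ n) (Qchan m n b U) x i j
    = (\<Sum>l<2 ^ b. \<Sum>p<2 ^ n. \<Sum>q<2 ^ n. U $$ (i * 2 ^ b + l, p) * x p q * cnj (U $$ (j * 2 ^ b + l, q)))"
  unfolding op_of_def by (subst Qchan_index[OF U _ K ij]) simp_all

text \<open>Depolarising the last \<open>b\<close> qubits sums over a common value \<open>L\<close>
  of their bits, and this sum is the partial trace in \<open>Qchan\<close>. The condition on the low
  bits together with the factor \<open>1 / 2 ^ b\<close> is the maximally mixed state.\<close>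

lemma discard_fconj_zero_block:
  assumes U: "U \<in> qmats (m + n)" and K: "m + n = K + b"
    and ST: "S \<subseteq> {..<m + n}" "T \<subseteq> {..<m + n}"
  shows "seq (map fN [K..<m + n]) (fconj (m + n) (emb (m + n) U)
      (\<lambda>S T. if S \<inter> {..<m} = {} \<and> T \<inter> {..<m} = {} then x (code (m + n) S) (code (m + n) T) else 0)) S T
    = (if code (m + n) S mod 2 ^ b = code (m + n) T mod 2 ^ b
       then op_of (2 ^ n) (Qchan m n b U) x (code (m + n) S div 2 ^ b) (code (m + n) T div 2 ^ b) / 2 ^ b else 0)"
proof -
  let ?N = "m + n"
  let ?B = "{K..<K + b}"
  let ?x = "\<lambda>S T. if S \<inter> {..<m} = {} \<and> T \<inter> {..<m} = {} then x (code ?N S) (code ?N T) else 0"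
  have low: "S \<inter> {..<m} = {} \<longleftrightarrow> code ?N S < 2 ^ n" for S
    unfolding code_empty_iff[symmetric] code_div[of m n, symmetric] by (simp add: div_eq_0_iff)
  have fc: "fconj ?N (emb ?N U) ?x S T
    = (\<Sum>p<2 ^ n. \<Sum>q<2 ^ n. U $$ (code ?N S, p) * x p q * cnj (U $$ (code ?N T, q)))" for S T
  proof -
    have "fconj ?N (emb ?N U) ?x S T = (\<Sum>P\<in>Pow {..<?N}. \<Sum>Q\<in>Pow {..<?N}. U $$ (code ?N S, code ?N P)
      * (if code ?N P < 2 ^ n \<and> code ?N Q < 2 ^ n then x (code ?N P) (code ?N Q) else 0) * cnj (U $$ (code ?N T, code ?N Q)))"
      unfolding fconj_def emb_def low ..
    also have "\<dots> = (\<Sum>p<2 ^ ?N. \<Sum>q<2 ^ ?N. U $$ (code ?N S, p)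
      * (if p < 2 ^ n \<and> q < 2 ^ n then x p q else 0) * cnj (U $$ (code ?N T, q)))"
      unfolding sum.reindex_bij_betw[OF bij_code, symmetric] ..
    also have "\<dots> = (\<Sum>p<2 ^ n. \<Sum>q<2 ^ n. U $$ (code ?N S, p) * x p q * cnj (U $$ (code ?N T, q)))"
      by (rule sum_restrict2) simp
    finally show ?thesis .
  qed
  have i: "code K S < 2 ^ K" "code K T < 2 ^ K" by (rule code_less)+
  have "(\<Sum>L\<in>Pow ?B. fconj ?N (emb ?N U) ?x (S - ?B \<union> L) (T - ?B \<union> L))
    = (\<Sum>L\<in>Pow ?B. \<Sum>p<2 ^ n. \<Sum>q<2 ^ n. U $$ (code K S * 2 ^ b + code (K + b) L, p) * x p q
        * cnj (U $$ (code K T * 2 ^ b + code (K + b) L, q)))"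
    unfolding fc unfolding K
    using code_replace_low[of _ K b S] code_replace_low[of _ K b T] ST K by (intro sum.cong refl) simp
  also have "\<dots> = (\<Sum>l<2 ^ b. \<Sum>p<2 ^ n. \<Sum>q<2 ^ n. U $$ (code K S * 2 ^ b + l, p) * x p q
        * cnj (U $$ (code K T * 2 ^ b + l, q)))"
    by (rule sum.reindex_bij_betw[OF bij_code_low])
  also have "\<dots> = op_of (2 ^ n) (Qchan m n b U) x (code K S) (code K T)"
    by (rule op_of_Qchan[OF U K i, symmetric])
  finally have e: "(\<Sum>L\<in>Pow ?B. fconj ?N (emb ?N U) ?x (S - ?B \<union> L) (T - ?B \<union> L))
    = op_of (2 ^ n) (Qchan m n b U) x (code ?N S div 2 ^ b) (code ?N T div 2 ^ b)"
    unfolding K code_div .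
  have B: "set [K..<?N] = ?B" "length [K..<?N] = b" using K by auto
  have "S \<inter> ?B = T \<inter> ?B \<longleftrightarrow> code ?N S mod 2 ^ b = code ?N T mod 2 ^ b"
    using code_mod_eq_iff[of S K b T] ST K by simp
  thus ?thesis by (subst depolarize_apply) (simp_all only: distinct_upt B e)
qed

text \<open>The maximally mixed factor cuts the operator into \<open>2 ^ b\<close> identical
  diagonal blocks of weight \<open>1 / 2 ^ b\<close>, one for each value of the low bits.\<close>

lemma tn_tensor_mixed:
  fixes Q :: "nat \<times> 'r \<Rightarrow> nat \<times> 'r \<Rightarrow> complex"
  assumes "finite R"
  shows "tn ({..<2 ^ (K + b)} \<times> R) (\<lambda>p q. if fst p mod 2 ^ b = fst q mod 2 ^ b
      then Q (fst p div 2 ^ b, snd p) (fst q div 2 ^ b, snd q) / 2 ^ b else 0) = tn ({..<2 ^ K} \<times> R) Q"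
    (is "tn ?I ?X = _")
proof -
  have fin: "finite ?I" "finite ({..<2 ^ K :: nat} \<times> R)" using assms by auto
  have "tn ?I ?X = (\<Sum>z<2 ^ b. tn {p \<in> ?I. fst p mod 2 ^ b = z} ?X)"
    by (rule tn_block_diagonal) (use fin in auto)
  also have "\<dots> = (\<Sum>z<(2::nat) ^ b. 1 / 2 ^ b * tn ({..<2 ^ K} \<times> R) Q)"
  proof (rule sum.cong[OF refl])
    fix z :: nat assume z: "z \<in> {..<2 ^ b}"
    let ?f = "\<lambda>p :: nat \<times> 'r. (fst p * 2 ^ b + z, snd p)"
    have "bij_betw ?f ({..<2 ^ K} \<times> R) {p \<in> ?I. fst p mod 2 ^ b = z}"
    proof (rule bij_betw_byWitness[where f' = "\<lambda>p. (fst p div 2 ^ b, snd p)"])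
      show "?f ` ({..<2 ^ K} \<times> R) \<subseteq> {p \<in> ?I. fst p mod 2 ^ b = z}"
        using z pair_code_less[of _ K z b] by auto
      show "(\<lambda>p. (fst p div 2 ^ b, snd p)) ` {p \<in> ?I. fst p mod 2 ^ b = z} \<subseteq> {..<2 ^ K} \<times> R"
        by (auto simp: power_add less_mult_imp_div_less)
    qed (use z in \<open>auto simp: div_mult_mod_eq\<close>)
    from tn_bij[OF _ this, of ?X]
    have "tn {p \<in> ?I. fst p mod 2 ^ b = z} ?X = tn ({..<2 ^ K} \<times> R) (\<lambda>p q. ?X (?f p) (?f q))"
      using fin by simp
    also have "\<dots> = tn ({..<2 ^ K} \<times> R) (\<lambda>p q. 1 / 2 ^ b * Q p q)"
      using z by (intro tn_cong) simp
    also have "\<dots> = 1 / 2 ^ b * tn ({..<2 ^ K} \<times> R) Q"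
      using tn_scale[OF fin(2), of "1 / 2 ^ b" Q] by (simp add: norm_divide norm_power)
    finally show "tn {p \<in> ?I. fst p mod 2 ^ b = z} ?X = 1 / 2 ^ b * tn ({..<2 ^ K} \<times> R) Q" .
  qed
  finally show ?thesis by simp
qed

definition circuit_op :: "nat \<Rightarrow> nat \<Rightarrow> nat \<Rightarrow> complex mat
    \<Rightarrow> nat set mx \<Rightarrow> nat set mx" where
  "circuit_op m n K U x = seq (map fN [K..<m + n]) (fconj (m + n) (emb (m + n) U) (fM m (m + n) [0..<m] (fD m x)))"

lemma represents_Cchan:
  assumes "U \<in> qmats (m + n)" "m + n = K + b"
  shows "represents (m + n) (Cchan m n b U) (circuit_op m n K U)"
proof -
  have K: "m + n - b = K" using assms(2) by simp
  have mN: "m \<le> m + n" by simp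
  show ?thesis
    unfolding Cchan_def circuit_op_def K
    by (rule represents_comp[OF represents_N_B represents_comp[OF represents_conj_by[OF assms(1)]
          represents_comp[OF represents_M_chan[OF mN] represents_D_A[OF mN]]]])
qed

lemma lift_circuit_op:
  "lift (circuit_op m n K U) X = lift (seq (map fN [K..<m + n])) (lift (fconj (m + n) (emb (m + n) U))
     (lift (fM m (m + n) [0..<m]) (lift (fD m) X)))"
  by (simp add: lift_def circuit_op_def)

lemma bij_code_pair:
  "bij_betw (\<lambda>p. (code N (fst p), snd p)) (Pow {..<N} \<times> R) ({..<2 ^ N} \<times> R)"
proof -
  have f: "(\<lambda>p. (code N (fst p), snd p)) = map_prod (code N) (\<lambda>x. x)" by (simp add: fun_eq_iff)
  have "inj_on (\<lambda>p. (code N (fst p), snd p)) (Pow {..<N} \<times> R)"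
    using inj_on_eq_iff[OF code_inj[of N]] by (auto intro!: inj_onI)
  thus ?thesis
    using map_prod_surj_on[OF bij_betw_imp_surj_on[OF bij_code[of N]], of "\<lambda>x. x" R R]
    unfolding bij_betw_def f by simp
qed

lemma tn_lift_op_of_Cchan:
  assumes U: "U1 \<in> qmats (m + n)" "U2 \<in> qmats (m + n)"
    and K: "m + n = K + b" and R: "finite R"
  shows "tn ({..<2 ^ (m + n)} \<times> R) (lift (op_of (2 ^ (m + n)) (Cdiff m n b U1 U2)) \<xi>)
    = tn (Pow {..<m + n} \<times> R) (\<lambda>p q.
        lift (circuit_op m n K U1) (\<lambda>p q. \<xi> (code (m + n) (fst p), snd p) (code (m + n) (fst q), snd q)) p q
      - lift (circuit_op m n K U2) (\<lambda>p q. \<xi> (code (m + n) (fst p), snd p) (code (m + n) (fst q), snd q)) p q)"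
proof -
  let ?N = "m + n"
  let ?f = "\<lambda>p. (code ?N (fst p), snd p)"
  note b = bij_code_pair[of ?N R]
  have op: "op_of (2 ^ ?N) (Cdiff m n b U1 U2) x (code ?N S) (code ?N T)
    = circuit_op m n K U1 (\<lambda>S T. x (code ?N S) (code ?N T)) S T - circuit_op m n K U2 (\<lambda>S T. x (code ?N S) (code ?N T)) S T" for x S T
  proof -
    let ?\<rho> = "mat (2 ^ ?N) (2 ^ ?N) (\<lambda>(p, q). x p q)"
    have \<rho>: "?\<rho> \<in> qmats ?N" by simp
    have e: "emb ?N ?\<rho> = (\<lambda>S T. x (code ?N S) (code ?N T))"
      by (intro ext) (simp add: emb_def code_less)
    have C: "Cchan m n b U ?\<rho> \<in> qmats ?N"
      "emb ?N (Cchan m n b U ?\<rho>) = circuit_op m n K U (emb ?N ?\<rho>)"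
      if "U \<in> qmats ?N" for U
      using represents_Cchan[OF that K] \<rho> unfolding represents_def by blast+
    have "op_of (2 ^ ?N) (Cdiff m n b U1 U2) x (code ?N S) (code ?N T)
      = emb ?N (Cchan m n b U1 ?\<rho>) S T - emb ?N (Cchan m n b U2 ?\<rho>) S T"
      using C(1)[OF U(1)] C(1)[OF U(2)] by (simp add: op_of_def emb_def code_less)
    thus ?thesis by (simp only: C(2)[OF U(1)] C(2)[OF U(2)] e)
  qed
  show ?thesis
    using tn_bij[OF _ b, of "lift (op_of (2 ^ ?N) (Cdiff m n b U1 U2)) \<xi>"] R
    by (simp add: lift_def op)
qed

lemma op_of_Qchan_diff:
  assumes "m + n = K + b" "i < 2 ^ K" "j < 2 ^ K"
  shows "op_of (2 ^ n) (Qdiff m n b U1 U2) x i j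
    = op_of (2 ^ n) (Qchan m n b U1) x i j - op_of (2 ^ n) (Qchan m n b U2) x i j"
  using assms unfolding op_of_def by (simp add: Qchan_def ptrace_def)

text \<open>An equality, since a normalised register leaves the norm unchanged; it serves both the
  lower bound and the main term of the upper bound.\<close>

lemma tn_discard_zero_block:
  fixes \<xi> :: "nat \<times> nat \<Rightarrow> nat \<times> nat \<Rightarrow> complex"
  assumes U: "U1 \<in> qmats (m + n)" "U2 \<in> qmats (m + n)"
    and K: "m + n = K + b" and R: "finite R"
  defines "X \<equiv> \<lambda>p q :: nat set \<times> nat. \<xi> (code (m + n) (fst p), snd p) (code (m + n) (fst q), snd q)"
  shows "tn (Pow {..<m + n} \<times> R) (\<lambda>p q.
        lift (seq (map fN [K..<m + n])) (lift (fconj (m + n) (emb (m + n) U1)) (block m {} X)) p q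
      - lift (seq (map fN [K..<m + n])) (lift (fconj (m + n) (emb (m + n) U2)) (block m {} X)) p q)
    = tn ({..<2 ^ K} \<times> R) (lift (op_of (2 ^ n) (Qdiff m n b U1 U2)) \<xi>)"
    (is "tn (Pow {..<?N} \<times> R) ?L = tn _ (lift ?q \<xi>)")
proof -
  let ?f = "\<lambda>p. (code ?N (fst p), snd p)"
  let ?G = "\<lambda>p q. if fst p mod 2 ^ b = fst q mod 2 ^ b
      then lift ?q \<xi> (fst p div 2 ^ b, snd p) (fst q div 2 ^ b, snd q) / 2 ^ b else 0"
  have 1: "lift (seq (map fN [K..<?N])) (lift (fconj ?N (emb ?N U)) (block m {} X)) p q
    = (if fst (?f p) mod 2 ^ b = fst (?f q) mod 2 ^ b
       then op_of (2 ^ n) (Qchan m n b U) (\<lambda>p' q'. \<xi> (p', snd p) (q', snd q)) (fst (?f p) div 2 ^ b) (fst (?f q) div 2 ^ b) / 2 ^ b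
       else 0)"
    if "U \<in> qmats ?N" "p \<in> Pow {..<?N} \<times> R" "q \<in> Pow {..<?N} \<times> R" for U p q
    unfolding lift_def block_def X_def fst_conv snd_conv
    by (rule discard_fconj_zero_block[OF that(1) K]) (use that in auto)
  have "tn (Pow {..<?N} \<times> R) ?L = tn (Pow {..<?N} \<times> R) (\<lambda>p q. ?G (?f p) (?f q))"
  proof (rule tn_cong)
    fix p q assume pq: "p \<in> Pow {..<?N} \<times> R" "q \<in> Pow {..<?N} \<times> R"
    have "fst (?f p) div 2 ^ b < 2 ^ K" "fst (?f q) div 2 ^ b < 2 ^ K"
      unfolding fst_conv K code_div by (rule code_less)+
    from op_of_Qchan_diff[OF K this]
    show "?L p q = ?G (?f p) (?f q)"
      unfolding 1[OF U(1) pq] 1[OF U(2) pq] unfolding lift_def by (simp add: diff_divide_distrib)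
  qed
  also have "\<dots> = tn ({..<2 ^ ?N} \<times> R) ?G"
    by (rule tn_bij[OF _ bij_code_pair]) (use R in simp)
  also have "\<dots> = tn ({..<2 ^ K} \<times> R) (lift ?q \<xi>)"
    unfolding K by (rule tn_tensor_mixed[OF R])
  finally show ?thesis .
qed

section \<open>Comparing the C difference with the Q difference\<close>

lemma tn_code:
  assumes "finite R"
  shows "tn (Pow {..<N} \<times> R) (\<lambda>p q. \<xi> (code N (fst p), snd p) (code N (fst q), snd q)) = tn ({..<2 ^ N} \<times> R) \<xi>"
  by (rule tn_bij[OF _ bij_code_pair]) (use assms in simp)

lemma good_op_discard: "good_op (Pow {..<N}) (seq (map fN [K..<N]))"
  by (rule good_op_seq) (auto intro!: good_op_fN)

lemma good_op_fD: "good_op (Pow {..<N}) (fD m)"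
  unfolding fD_def by (rule good_op_seq) (auto intro!: good_op_hZ simp: zsign_def)

text \<open>Each of the two circuits contributes the norm of \<open>Z\<close>, hence twice the
  mixing error. The reference is arbitrary here; its size is adjusted only afterwards.\<close>

lemma tn_Cchan_diff_upper:
  fixes R :: "nat set"
  assumes U: "is_unitary (2 ^ (m + n)) U1" "is_unitary (2 ^ (m + n)) U2"
    and K: "m + n = K + b" and R: "finite R"
  shows "tn ({..<2 ^ (m + n)} \<times> R) (lift (op_of (2 ^ (m + n)) (Cdiff m n b U1 U2)) \<xi>)
    \<le> tn ({..<2 ^ K} \<times> R) (lift (op_of (2 ^ n) (Qdiff m n b U1 U2)) \<xi>)
      + 2 * mixing_error m * tn ({..<2 ^ (m + n)} \<times> R) \<xi>"
proof -
  let ?N = "m + n"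
  let ?I = "Pow {..<?N} \<times> R"
  let ?B = "seq (map fN [K..<?N])"
  note Uc = U[THEN unitary_carrier]
  define X where "X p q = \<xi> (code ?N (fst p), snd p) (code ?N (fst q), snd q)" for p q
  define Y where "Y = lift (fM m ?N [0..<m]) (lift (fD m) X)"
  obtain e where e: "tn ?I (\<lambda>p q. Y p q - block m {} X p q - (if fst p = fst q then e (snd p) (snd q) else 0))
      \<le> mixing_error m * tn ?I X"
    unfolding Y_def using fM_fD_decompose[OF R, of m ?N X] by auto
  define Z where "Z p q = Y p q - block m {} X p q - (if fst p = fst q then e (snd p) (snd q) else 0)" for p q
  have "tn ({..<2 ^ ?N} \<times> R) (lift (op_of (2 ^ ?N) (Cdiff m n b U1 U2)) \<xi>)
    = tn ?I (\<lambda>p q. lift ?B (lift (fconj ?N (emb ?N U1)) Y) p q - lift ?B (lift (fconj ?N (emb ?N U2)) Y) p q)"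
    unfolding tn_lift_op_of_Cchan[OF Uc K R] lift_circuit_op Y_def X_def ..
  also have "\<dots> \<le> tn ?I (\<lambda>p q. lift ?B (lift (fconj ?N (emb ?N U1)) (block m {} X)) p q
      - lift ?B (lift (fconj ?N (emb ?N U2)) (block m {} X)) p q) + 2 * tn ?I Z"
    by (rule tn_unitary_pair_diff[OF U good_op_discard R]) (simp add: Z_def)
  also have "tn ?I (\<lambda>p q. lift ?B (lift (fconj ?N (emb ?N U1)) (block m {} X)) p q
      - lift ?B (lift (fconj ?N (emb ?N U2)) (block m {} X)) p q)
    = tn ({..<2 ^ K} \<times> R) (lift (op_of (2 ^ n) (Qdiff m n b U1 U2)) \<xi>)"
    unfolding X_def by (rule tn_discard_zero_block[OF Uc K R])
  also have "2 * tn ?I Z \<le> 2 * (mixing_error m * tn ?I X)"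
    using e unfolding Z_def by (rule mult_left_mono) simp
  also have "tn ?I X = tn ({..<2 ^ ?N} \<times> R) \<xi>" unfolding X_def by (rule tn_code[OF R])
  finally show ?thesis by simp
qed

text \<open>On inputs with all ancillas 0 neither the dephasing nor the mixing acts, so there is no
  error term; this is why the lower bound is free of \<open>\<epsilon>\<close>.\<close>

lemma tn_Cchan_diff_zero_block:
  fixes R :: "nat set"
  assumes U: "is_unitary (2 ^ (m + n)) U1" "is_unitary (2 ^ (m + n)) U2"
    and K: "m + n = K + b" and R: "finite R"
    and supp: "\<And>p q. \<xi> p q \<noteq> 0 \<Longrightarrow> fst p < 2 ^ n \<and> fst q < 2 ^ n"
  shows "tn ({..<2 ^ (m + n)} \<times> R) (lift (op_of (2 ^ (m + n)) (Cdiff m n b U1 U2)) \<xi>)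
    = tn ({..<2 ^ K} \<times> R) (lift (op_of (2 ^ n) (Qdiff m n b U1 U2)) \<xi>)"
proof -
  let ?N = "m + n"
  note Uc = U[THEN unitary_carrier]
  define X where "X p q = \<xi> (code ?N (fst p), snd p) (code ?N (fst q), snd q)" for p q
  have X0: "fst p \<inter> {..<m} = {} \<and> fst q \<inter> {..<m} = {}" if "X p q \<noteq> 0" for p q
  proof -
    have "S \<inter> {..<m} = {}" if "code ?N S < 2 ^ n" for S
      using that code_div[of m n S] code_empty_iff[of m S] by simp
    thus ?thesis using supp that unfolding X_def by fastforce
  qed
  have bX: "block m {} X = X"
  proof (intro ext)
    show "block m {} X p q = X p q" for p q
      using X0[of p q] by (cases "X p q = 0") (simp_all add: block_def)
  qed
  have D: "fD m (\<lambda>S T. X (S, k) (T, l)) = (\<lambda>S T. X (S, k) (T, l))" for k l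
    using X0[of "(_, k)" "(_, l)"] by (intro ext) (auto simp: fD_apply)
  have "fM m ?N [0..<m] (\<lambda>S T. X (S, k) (T, l)) = (\<lambda>S T. X (S, k) (T, l))" for k l
    by (rule fM_zero_block) (use X0[of "(_, k)" "(_, l)"] in auto)
  hence Y: "lift (fM m ?N [0..<m]) (lift (fD m) X) = block m {} X"
    unfolding bX lift_def by (simp add: D)
  show ?thesis
    unfolding tn_lift_op_of_Cchan[OF Uc K R] lift_circuit_op X_def[symmetric] Y
    unfolding X_def by (rule tn_discard_zero_block[OF Uc K R])
qed

text \<open>Each circuit is contractive, so the triangle inequality gives 2. This is the a priori
  bound that makes the suprema finite.\<close>

lemma tn_Cchan_diff_bound:
  fixes R :: "nat set"
  assumes U: "is_unitary (2 ^ (m + n)) U1" "is_unitary (2 ^ (m + n)) U2"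
    and K: "m + n = K + b" and R: "finite R"
  shows "tn ({..<2 ^ (m + n)} \<times> R) (lift (op_of (2 ^ (m + n)) (Cdiff m n b U1 U2)) \<xi>)
    \<le> 2 * tn ({..<2 ^ (m + n)} \<times> R) \<xi>"
proof -
  let ?N = "m + n"
  let ?I = "Pow {..<?N} \<times> R"
  have fin: "finite ?I" using R by simp
  define X where "X p q = \<xi> (code ?N (fst p), snd p) (code ?N (fst q), snd q)" for p q
  have C: "tn ?I (lift (circuit_op m n K U) X) \<le> tn ?I X" if "is_unitary (2 ^ ?N) U" for U
    unfolding lift_circuit_op
    by (rule order_trans[OF good_op_tn[OF good_op_discard R]
      order_trans[OF tn_fconj[OF contr_emb[OF that] R]
      order_trans[OF good_op_tn[OF good_op_fM R] good_op_tn[OF good_op_fD R]]]]) auto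
  have "tn ?I (\<lambda>p q. lift (circuit_op m n K U1) X p q - lift (circuit_op m n K U2) X p q) \<le> 2 * tn ?I X"
    using tn_diff[OF fin, of "lift (circuit_op m n K U1) X" "lift (circuit_op m n K U2) X"] C[OF U(1)] C[OF U(2)] by simp
  also have "tn ?I X = tn ({..<2 ^ ?N} \<times> R) \<xi>" unfolding X_def by (rule tn_code[OF R])
  finally show ?thesis unfolding tn_lift_op_of_Cchan[OF U[THEN unitary_carrier] K R] X_def .
qed

text \<open>Writes the difference of the channels with a kernel \<open>\<kappa>\<close>, the form in
  which the reference can be shrunk; it is meant for the reference of dimension
  \<open>2 ^ (m + n)\<close> that the C difference brings along.\<close>

lemma tn_Qchan_diff_reduce:
  fixes R :: "nat set"
  defines "q U1 U2 m n b \<equiv> op_of (2 ^ n) (Qdiff m n b U1 U2)"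
  assumes U: "U1 \<in> qmats (m + n)" "U2 \<in> qmats (m + n)"
    and K: "m + n = K + b" and R: "finite R" and c: "0 \<le> c"
    and bound: "\<And>X. tn ({..<2 ^ K} \<times> {..<2 ^ n}) (lift (q U1 U2 m n b) X) \<le> c * tn ({..<2 ^ n} \<times> {..<2 ^ n :: nat}) X"
  shows "tn ({..<2 ^ K} \<times> R) (lift (q U1 U2 m n b) \<xi>) \<le> c * tn ({..<2 ^ n} \<times> R) \<xi>"
proof -
  let ?q = "q U1 U2 m n b"
  define \<kappa> where "\<kappa> i j p p' = (\<Sum>l<2 ^ b. U1 $$ (i * 2 ^ b + l, p) * cnj (U1 $$ (j * 2 ^ b + l, p')))
     - (\<Sum>l<2 ^ b. U2 $$ (i * 2 ^ b + l, p) * cnj (U2 $$ (j * 2 ^ b + l, p')))" for i j p p'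
  let ?\<phi> = "\<lambda>x i j. \<Sum>p<2 ^ n. \<Sum>p'<2 ^ n. \<kappa> i j p p' * x p p'"
  have k: "(\<Sum>l<2 ^ b. \<Sum>p<2 ^ n. \<Sum>q<2 ^ n. U $$ (i * 2 ^ b + l, p) * x p q * cnj (U $$ (j * 2 ^ b + l, q)))
    = (\<Sum>p<2 ^ n. \<Sum>q<2 ^ n. (\<Sum>l<2 ^ b. U $$ (i * 2 ^ b + l, p) * cnj (U $$ (j * 2 ^ b + l, q))) * x p q)"
    for U :: "complex mat" and i j x
    unfolding sum_distrib_right by (subst sum_swap3[symmetric]) (simp only: mult_ac)
  have e: "?q x i j = ?\<phi> x i j" if "i < 2 ^ K" "j < 2 ^ K" for x i j
    unfolding q_def op_of_Qchan_diff[OF K that] op_of_Qchan[OF U(1) K that] op_of_Qchan[OF U(2) K that] k \<kappa>_def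
    by (simp add: left_diff_distrib sum_subtractf)
  have le: "tn ({..<2 ^ K} \<times> R) (lift ?q \<xi>) = tn ({..<2 ^ K} \<times> R) (lift ?\<phi> \<xi>)" for R :: "nat set" and \<xi>
    by (rule tn_cong) (auto simp: lift_def e)
  show ?thesis
    unfolding le
    by (rule tn_lift_reduce) (use bound R c in \<open>auto simp: le\<close>)
qed

text \<open>The comparison holds for any ancilla register, with an error depending on its size;
  enlarging the register only changes \<open>m\<close>.\<close>

lemma diamond_norm_Cchan_diff:
  assumes U: "is_unitary (2 ^ (m + n)) U1" "is_unitary (2 ^ (m + n)) U2" and K: "m + n = K + b"
  defines "Q \<equiv> \<lambda>\<rho>. Qchan m n b U1 \<rho> - Qchan m n b U2 \<rho>"
    and "C \<equiv> \<lambda>\<rho>. Cchan m n b U1 \<rho> - Cchan m n b U2 \<rho>"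
  shows "diamond_norm (2 ^ n) Q \<le> diamond_norm (2 ^ (m + n)) C"
    and "diamond_norm (2 ^ (m + n)) C \<le> diamond_norm (2 ^ n) Q + 2 * mixing_error m"
proof -
  let ?N = "m + n"
  let ?q = "op_of (2 ^ n) Q" and ?c = "op_of (2 ^ ?N) C"
  let ?I = "{..<2 ^ ?N} :: nat set" and ?J = "{..<2 ^ n} :: nat set" and ?K = "{..<2 ^ K} :: nat set"
  let ?dQ = "diamond_norm (2 ^ n) Q" and ?dC = "diamond_norm (2 ^ ?N) C"
  note Uc = U[THEN unitary_carrier]
  have dimQ: "dim_row (Q (0\<^sub>m (2 ^ n) (2 ^ n))) = 2 ^ K"
    using K by (simp add: Q_def Qchan_def ptrace_def)
  have dimC: "dim_row (C (0\<^sub>m (2 ^ ?N) (2 ^ ?N))) = 2 ^ ?N"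
    using represents_Cchan[OF Uc(2) K] zero_carrier_mat unfolding represents_def C_def by auto
  have Cb: "tn (?I \<times> ?I) (lift ?c \<xi>) \<le> 2 * tn (?I \<times> ?I) \<xi>" for \<xi>
    unfolding C_def by (rule tn_Cchan_diff_bound[OF U K]) simp
  have Cd: "tn (?I \<times> ?I) (lift ?c \<xi>) \<le> ?dC * tn (?I \<times> ?I) \<xi>" for \<xi>
    by (rule tn_lift_le_diamond_norm[where \<Phi> = C, OF _ dimC Cb]) simp
  have sub: "?J \<subseteq> ?I" unfolding lessThan_subset_iff by (rule power_increasing) auto
  \<comment> \<open>Pads an input by zeros in both system and reference: all ancillas are then 0,
    and the reference has the dimension that the C side demands.\<close>
  have embed: "\<exists>\<xi>. tn (?I \<times> ?I) \<xi> = tn (?J \<times> ?J) x \<and> tn (?K \<times> ?J) (lift ?q x) \<le> tn (?I \<times> ?I) (lift ?c \<xi>)" for x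
  proof -
    define \<xi> where "\<xi> p q = (if p \<in> ?J \<times> ?J \<and> q \<in> ?J \<times> ?J then x p q else 0)" for p q
    have "tn (?I \<times> ?I) \<xi> = tn (?J \<times> ?J) \<xi>"
    proof (rule tn_support)
      show "?J \<times> ?J \<subseteq> ?I \<times> ?I" by (rule Sigma_mono[OF sub sub])
    qed (auto simp: \<xi>_def)
    also have "\<dots> = tn (?J \<times> ?J) x" by (rule tn_cong) (simp add: \<xi>_def)
    finally have 1: "tn (?I \<times> ?I) \<xi> = tn (?J \<times> ?J) x" .
    have "tn (?K \<times> ?J) (lift ?q x) = tn (?K \<times> ?J) (lift ?q \<xi>)"
    proof (rule tn_cong)
      fix p q assume "p \<in> ?K \<times> ?J" "q \<in> ?K \<times> ?J"
      hence "mat (2 ^ n) (2 ^ n) (\<lambda>(i, j). x (i, snd p) (j, snd q)) = mat (2 ^ n) (2 ^ n) (\<lambda>(i, j). \<xi> (i, snd p) (j, snd q))"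
        by (intro eq_matI) (auto simp: \<xi>_def)
      thus "lift ?q x p q = lift ?q \<xi> p q" by (simp add: lift_def op_of_def)
    qed
    also have "\<dots> \<le> tn (?K \<times> ?I) (lift ?q \<xi>)"
      by (rule tn_subset[OF _ Sigma_mono[OF subset_refl sub]]) simp
    also have "\<dots> = tn (?I \<times> ?I) (lift ?c \<xi>)"
      unfolding Q_def C_def
      by (rule tn_Cchan_diff_zero_block[OF U K, symmetric]) (auto simp: \<xi>_def split: if_splits)
    finally show ?thesis using 1 by blast
  qed
  show "?dQ \<le> ?dC"
  proof (rule diamond_norm_le[where \<Phi> = Q, OF _ dimQ])
    fix x
    show "tn (?K \<times> ?J) (lift ?q x) \<le> ?dC * tn (?J \<times> ?J) x"
    proof -
      obtain \<xi> where \<xi>: "tn (?I \<times> ?I) \<xi> = tn (?J \<times> ?J) x"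
        "tn (?K \<times> ?J) (lift ?q x) \<le> tn (?I \<times> ?I) (lift ?c \<xi>)" using embed[of x] by blast
      show ?thesis using order_trans[OF \<xi>(2) Cd] unfolding \<xi>(1) .
    qed
  qed simp
  \<comment> \<open>The a priori bound for the Q difference is inherited from the C difference
    through the embedding.\<close>
  have "tn (?K \<times> ?J) (lift ?q x) \<le> 2 * tn (?J \<times> ?J) x" for x
  proof -
    obtain \<xi> where \<xi>: "tn (?I \<times> ?I) \<xi> = tn (?J \<times> ?J) x"
      "tn (?K \<times> ?J) (lift ?q x) \<le> tn (?I \<times> ?I) (lift ?c \<xi>)" using embed[of x] by blast
    show ?thesis using order_trans[OF \<xi>(2) Cb] unfolding \<xi>(1) .
  qed
  hence Qd: "tn (?K \<times> ?J) (lift ?q x) \<le> ?dQ * tn (?J \<times> ?J) x" for x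
    by (intro tn_lift_le_diamond_norm[where \<Phi> = Q, OF _ dimQ]) simp_all
  \<comment> \<open>The sign is needed to scale inequalities by \<open>?dQ\<close>; it follows from
    the bound at one operator of positive norm.\<close>
  have dQ: "0 \<le> ?dQ"
  proof -
    have "1 \<le> tn (?J \<times> ?J) (\<lambda>p q. 1)"
      using tn_entry[of "?J \<times> ?J" "(0, 0)" "(0, 0)" "\<lambda>p q. 1"] by simp
    moreover have "0 \<le> ?dQ * tn (?J \<times> ?J) (\<lambda>p q. 1)"
      by (rule order_trans[OF tn_nonneg Qd]) simp
    ultimately show ?thesis by (simp add: zero_le_mult_iff)
  qed
  show "?dC \<le> ?dQ + 2 * mixing_error m"
  proof (rule diamond_norm_le[where \<Phi> = C, OF _ dimC])
    fix \<xi>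
    have "tn (?I \<times> ?I) (lift ?c \<xi>) \<le> tn (?K \<times> ?I) (lift ?q \<xi>) + 2 * mixing_error m * tn (?I \<times> ?I) \<xi>"
      unfolding Q_def C_def by (rule tn_Cchan_diff_upper[OF U K]) simp
    \<comment> \<open>The Q difference reads only the compression of \<open>\<xi>\<close> to codes
      below \<open>2 ^ n\<close>, while the reference still has dimension
      \<open>2 ^ (m + n)\<close>.\<close>
    also have "tn (?K \<times> ?I) (lift ?q \<xi>) \<le> ?dQ * tn (?J \<times> ?I) \<xi>"
      unfolding Q_def by (rule tn_Qchan_diff_reduce[OF Uc K _ dQ[unfolded Q_def] Qd[unfolded Q_def]]) simp
    also have "?dQ * tn (?J \<times> ?I) \<xi> \<le> ?dQ * tn (?I \<times> ?I) \<xi>"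
      by (rule mult_left_mono[OF tn_subset[OF _ Sigma_mono[OF sub subset_refl]] dQ]) simp
    finally show "tn (?I \<times> ?I) (lift ?c \<xi>) \<le> (?dQ + 2 * mixing_error m) * tn (?I \<times> ?I) \<xi>"
      by (simp add: distrib_right)
  qed simp
qed

lemma enlarge_carrier:
  assumes "U \<in> qmats (m + n)"
  shows "enlarge n k U \<in> qmats (m + k + n)"
  using assms by (simp add: enlarge_def power_add mult_ac)

text \<open>Rows carry the extra register last, columns carry it between ancilla and input; the
  nested divisions cut this middle digit out of \<open>j\<close>.\<close>

lemma enlarge_index:
  assumes "U \<in> qmats (m + n)" "r < 2 ^ (m + n)" "e < 2 ^ k" "j < 2 ^ (m + k + n)"
  shows "enlarge n k U $$ (r * 2 ^ k + e, j)
    = (if e = (j div 2 ^ n) mod 2 ^ k then U $$ (r, (j div 2 ^ n) div 2 ^ k * 2 ^ n + j mod 2 ^ n) else 0)"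
proof -
  have "r * 2 ^ k + e < 2 ^ (m + n) * 2 ^ k"
    using pair_code_less[OF assms(2,3)] by (simp add: power_add)
  moreover have "j < 2 ^ (m + n) * 2 ^ k" using assms(4) by (simp add: power_add mult_ac)
  ultimately show ?thesis using assms by (simp add: enlarge_def)
qed

lemma sum_pair_code:
  fixes f :: "nat \<Rightarrow> complex"
  shows "(\<Sum>i<2 ^ (a + k). f i) = (\<Sum>r<2 ^ a. \<Sum>e<2 ^ k. f (r * 2 ^ k + e))"
proof -
  have "(\<Sum>i<2 ^ (a + k). f i) = (\<Sum>p\<in>{..<2 ^ a} \<times> {..<2 ^ k}. f (fst p * 2 ^ k + snd p))"
    unfolding power_add by (rule sum.reindex_bij_betw[OF bij_pair_code, symmetric]) simp
  thus ?thesis by (simp add: sum.cartesian_product')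
qed

text \<open>Up to the order of columns the matrix is \<open>U\<close> tensored with an identity:
  column \<open>j\<close> is column \<open>?s j\<close> of \<open>U\<close> placed in the copy
  \<open>?e j\<close>, so columns in different copies have disjoint support.\<close>

lemma is_unitary_enlarge:
  assumes U: "is_unitary (2 ^ (m + n)) U"
  shows "is_unitary (2 ^ (m + k + n)) (enlarge n k U)"
proof -
  let ?D = "2 ^ (m + k + n) :: nat"
  let ?E = "enlarge n k U"
  let ?e = "\<lambda>j :: nat. (j div 2 ^ n) mod 2 ^ k"
  let ?s = "\<lambda>j :: nat. (j div 2 ^ n) div 2 ^ k * 2 ^ n + j mod 2 ^ n"
  note Uc = unitary_carrier[OF U]
  note Ec = enlarge_carrier[OF Uc, of k]
  have s: "?s j < 2 ^ (m + n)" if "j < ?D" for j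
    by (rule pair_code_less) (use that in \<open>auto simp: power_add less_mult_imp_div_less mult_ac\<close>)
  \<comment> \<open>The extra digit and the remaining digits together determine the column
    index.\<close>
  have inj: "j = j'" if "?e j = ?e j'" "?s j = ?s j'" for j j' :: nat
  proof -
    have "?s j div 2 ^ n = ?s j' div 2 ^ n" "?s j mod 2 ^ n = ?s j' mod 2 ^ n" using that(2) by simp_all
    hence *: "(j div 2 ^ n) div 2 ^ k = (j' div 2 ^ n) div 2 ^ k" "j mod 2 ^ n = j' mod 2 ^ n" by simp_all
    have "j div 2 ^ n = j' div 2 ^ n" using that(1) *(1) by (metis div_mult_mod_eq)
    thus ?thesis using *(2) by (metis div_mult_mod_eq)
  qed
  have "adj ?E * ?E = 1\<^sub>m ?D"
  proof (rule eq_matI)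
    fix i j assume "i < dim_row (1\<^sub>m ?D :: complex mat)" "j < dim_col (1\<^sub>m ?D :: complex mat)"
    hence ij: "i < ?D" "j < ?D" by simp_all
    have D: "?D = 2 ^ ((m + n) + k)" by (simp add: power_add)
    have "(adj ?E * ?E) $$ (i, j) = (\<Sum>r<?D. cnj (?E $$ (r, i)) * ?E $$ (r, j))"
      using ij Ec by (subst mat_mult_index[of "adj ?E" ?D ?D ?E ?D]) (auto simp: adj_index)
    also have "\<dots> = (\<Sum>r<2 ^ (m + n). \<Sum>e<2 ^ k. cnj (?E $$ (r * 2 ^ k + e, i)) * ?E $$ (r * 2 ^ k + e, j))"
      unfolding D by (rule sum_pair_code)
    also have "\<dots> = (\<Sum>r<2 ^ (m + n). \<Sum>e<2 ^ k. if e = ?e i then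
        (if ?e i = ?e j then cnj (U $$ (r, ?s i)) * U $$ (r, ?s j) else 0) else 0)"
      by (intro sum.cong refl) (simp add: enlarge_index[OF Uc] ij)
    also have "\<dots> = (\<Sum>r<2 ^ (m + n). if ?e i = ?e j then cnj (U $$ (r, ?s i)) * U $$ (r, ?s j) else 0)"
      by (intro sum.cong refl) simp
    also have "\<dots> = (if ?e i = ?e j \<and> ?s i = ?s j then 1 else 0)"
      using unitary_columns[OF U s[OF ij(1)] s[OF ij(2)]]
      by (cases "?e i = ?e j") (simp_all only: if_True if_False simp_thms sum.neutral_const)
    also have "\<dots> = (1\<^sub>m ?D) $$ (i, j)" using ij inj[of i j] by auto
    finally show "(adj ?E * ?E) $$ (i, j) = (1\<^sub>m ?D) $$ (i, j)" .
  qed (use Ec in \<open>auto simp: adj_def\<close>)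
  thus ?thesis using Ec by (simp add: is_unitary_def)
qed

text \<open>The extra qubits start in state 0 and the extension leaves them there, so in the larger
  partial trace only the terms with \<open>e = 0\<close> survive.\<close>

lemma Qchan_enlarge:
  assumes U: "U \<in> qmats (m + n)" and \<rho>: "\<rho> \<in> qmats n"
    and K: "m + n = K + b"
  shows "Qchan (m + k) n (b + k) (enlarge n k U) \<rho> = Qchan m n b U \<rho>"
proof (rule eq_matI)
  have K': "m + k + n = K + (b + k)" using K by simp
  show "dim_row (Qchan (m + k) n (b + k) (enlarge n k U) \<rho>) = dim_row (Qchan m n b U \<rho>)"
    "dim_col (Qchan (m + k) n (b + k) (enlarge n k U) \<rho>) = dim_col (Qchan m n b U \<rho>)"
    using K by (simp_all add: Qchan_def ptrace_def)
  fix i j assume "i < dim_row (Qchan m n b U \<rho>)" "j < dim_col (Qchan m n b U \<rho>)"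
  hence ij: "i < 2 ^ K" "j < 2 ^ K" using K by (simp_all add: Qchan_def ptrace_def)
  have E: "enlarge n k U $$ (i * 2 ^ (b + k) + (l * 2 ^ k + e), p) = (if e = 0 then U $$ (i * 2 ^ b + l, p) else 0)"
    if "i < 2 ^ K" "l < 2 ^ b" "e < 2 ^ k" "p < 2 ^ n" for i l e p
  proof -
    have r: "i * 2 ^ b + l < 2 ^ (m + n)" using pair_code_less[OF that(1,2)] K by simp
    have eq: "i * 2 ^ (b + k) + (l * 2 ^ k + e) = (i * 2 ^ b + l) * 2 ^ k + e"
      by (simp add: power_add algebra_simps)
    have "(2 :: nat) ^ n \<le> 2 ^ (m + k + n)" by simp
    hence "p < 2 ^ (m + k + n)" using that(4) by (rule order_less_le_trans[rotated])
    thus ?thesis unfolding eq using enlarge_index[OF U r that(3), of p] that(4) by simp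
  qed
  have "Qchan (m + k) n (b + k) (enlarge n k U) \<rho> $$ (i, j)
    = (\<Sum>l<2 ^ b. \<Sum>e<2 ^ k. \<Sum>p<2 ^ n. \<Sum>q<2 ^ n. enlarge n k U $$ (i * 2 ^ (b + k) + (l * 2 ^ k + e), p) * \<rho> $$ (p, q)
        * cnj (enlarge n k U $$ (j * 2 ^ (b + k) + (l * 2 ^ k + e), q)))"
    unfolding Qchan_index[OF enlarge_carrier[OF U] \<rho> K' ij] by (rule sum_pair_code)
  also have "\<dots> = (\<Sum>l<2 ^ b. \<Sum>e<(2::nat) ^ k. if e = 0 then (\<Sum>p<2 ^ n. \<Sum>q<2 ^ n. U $$ (i * 2 ^ b + l, p) * \<rho> $$ (p, q)
        * cnj (U $$ (j * 2 ^ b + l, q))) else 0)"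
    by (intro sum.cong refl) (simp add: E ij)
  also have "\<dots> = (\<Sum>l<2 ^ b. \<Sum>p<2 ^ n. \<Sum>q<2 ^ n. U $$ (i * 2 ^ b + l, p) * \<rho> $$ (p, q)
        * cnj (U $$ (j * 2 ^ b + l, q)))"
    by (rule sum.cong[OF refl]) simp
  also have "\<dots> = Qchan m n b U \<rho> $$ (i, j)" by (rule Qchan_index[OF U \<rho> K ij, symmetric])
  finally show "Qchan (m + k) n (b + k) (enlarge n k U) \<rho> $$ (i, j) = Qchan m n b U \<rho> $$ (i, j)" .
qed

lemma diamond_norm_cong:
  assumes "\<And>\<rho>. \<rho> \<in> carrier_mat d d \<Longrightarrow> \<Phi> \<rho> = \<Psi> \<rho>"
  shows "diamond_norm d \<Phi> = diamond_norm d \<Psi>"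
proof -
  have "tensor_id d \<Phi> X = tensor_id d \<Psi> X" for X
    unfolding tensor_id_def by (simp add: assms)
  thus ?thesis by (simp add: diamond_norm_def)
qed

text \<open>The rate \<open>1/4\<close> in place of \<open>ln 2\<close> needs only rational
  estimates: \<open>1/2 \<le> 3/4 \<le> exp (- 1/4)\<close> in the step and
  \<open>2 \<le> 1 + 3/4 + 9/32 \<le> exp (3/4)\<close> at \<open>k = 1\<close>. At
  \<open>k = 0\<close> the claim would read \<open>4 \<le> exp 1\<close> and fail.\<close>

lemma four_div_pow_le_exp: "1 \<le> k \<Longrightarrow> 4 / 2 ^ k \<le> exp (1 - real k / 4)"
proof (induction k rule: dec_induct)
  case base
  show ?case using exp_lower_Taylor_quadratic[of "3 / 4 :: real"] by (simp add: power2_eq_square)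
next
  case (step k)
  have "4 / 2 ^ Suc k = 4 / 2 ^ k * (1 / 2 :: real)" by simp
  also have "\<dots> \<le> exp (1 - real k / 4) * exp (- (1 / 4))"
    using step.IH exp_ge_add_one_self[of "- (1 / 4) :: real"] by (intro mult_mono) auto
  also have "\<dots> = exp (1 - real (Suc k) / 4)" by (simp add: field_simps flip: exp_add)
  finally show ?case .
qed

text \<open>Slope and offset 4 turn the hypothesis on \<open>k\<close> into
  \<open>exp (1 - k / 4) \<le> \<epsilon>\<close>. For \<open>k > 0\<close> the original
  \<open>m\<close> ancillas only reduce the error, so the bound is uniform in
  \<open>m\<close>.\<close>

lemma mixing_error_le:
  assumes "\<epsilon> > 0" "real k \<ge> 4 * ln (1 / \<epsilon>) + 4"
  shows "2 * mixing_error (m + k) \<le> \<epsilon>"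
proof -
  have "1 - real k / 4 \<le> ln \<epsilon>" using assms by (simp add: ln_div)
  hence e: "exp (1 - real k / 4) \<le> \<epsilon>" using assms(1) by (simp add: ln_ge_iff)
  show ?thesis
  proof (cases "k = 0")
    case True
    \<comment> \<open>For \<open>k = 0\<close> the hypothesis forces
      \<open>exp 1 \<le> \<epsilon>\<close>, and twice the error is at most 2, its value at
      \<open>m = 1\<close>.\<close>
    have "2 * mixing_error (m + k) \<le> 2"
      using True self_le_power[of "2 :: real" m] by (cases m) (auto simp: mixing_error_def field_simps)
    also have "\<dots> \<le> exp 1" using exp_ge_add_one_self[of "1 :: real"] by simp
    finally show ?thesis using e True by simp
  next
    case False
    have "2 * mixing_error (m + k) = 4 / 2 ^ (m + k)" using False by (simp add: mixing_error_def)
    also have "\<dots> \<le> 4 / 2 ^ k" by (intro divide_left_mono) auto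
    also have "\<dots> \<le> exp (1 - real k / 4)" using False by (intro four_div_pow_le_exp) simp
    finally show ?thesis using e by simp
  qed
qed

theorem theorem7p14:
  shows "\<exists>c>0. \<forall>\<epsilon>>0. \<forall>k::nat. real k \<ge> c * ln (1 / \<epsilon>) + c \<longrightarrow>
    (\<forall>(m::nat) (n::nat) (nK::nat) (b::nat) U1 U2.
       m + n = nK + b \<and> is_unitary (2 ^ (m + n)) U1 \<and> is_unitary (2 ^ (m + n)) U2 \<longrightarrow>
       diamond_norm (2 ^ n) (\<lambda>\<rho>. Qchan m n b U1 \<rho> - Qchan m n b U2 \<rho>)
         \<le> diamond_norm (2 ^ (m + k + n))
              (\<lambda>\<rho>. Cchan (m + k) n (b + k) (enlarge n k U1) \<rho> - Cchan (m + k) n (b + k) (enlarge n k U2) \<rho>)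
       \<and> diamond_norm (2 ^ (m + k + n))
              (\<lambda>\<rho>. Cchan (m + k) n (b + k) (enlarge n k U1) \<rho> - Cchan (m + k) n (b + k) (enlarge n k U2) \<rho>)
         \<le> diamond_norm (2 ^ n) (\<lambda>\<rho>. Qchan m n b U1 \<rho> - Qchan m n b U2 \<rho>) + \<epsilon>)"
proof (intro exI[of _ 4] conjI allI impI)
  fix \<epsilon> :: real and k m n nK b :: nat and U1 U2 :: "complex mat"
  assume \<epsilon>: "0 < \<epsilon>" "4 * ln (1 / \<epsilon>) + 4 \<le> real k"
    and "m + n = nK + b \<and> is_unitary (2 ^ (m + n)) U1 \<and> is_unitary (2 ^ (m + n)) U2"
  hence K: "m + n = nK + b" and U: "is_unitary (2 ^ (m + n)) U1" "is_unitary (2 ^ (m + n)) U2" by auto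
  have K': "m + k + n = nK + (b + k)" using K by simp
  \<comment> \<open>The enlarged circuits implement the original channels, so only the C side feels
    the extra qubits.\<close>
  have Q: "diamond_norm (2 ^ n) (\<lambda>\<rho>. Qchan (m + k) n (b + k) (enlarge n k U1) \<rho> - Qchan (m + k) n (b + k) (enlarge n k U2) \<rho>)
    = diamond_norm (2 ^ n) (\<lambda>\<rho>. Qchan m n b U1 \<rho> - Qchan m n b U2 \<rho>)"
    by (rule diamond_norm_cong) (simp add: Qchan_enlarge[OF _ _ K] U[THEN unitary_carrier])
  note main = diamond_norm_Cchan_diff[OF U[THEN is_unitary_enlarge] K', unfolded Q]
  show "diamond_norm (2 ^ n) (\<lambda>\<rho>. Qchan m n b U1 \<rho> - Qchan m n b U2 \<rho>)
         \<le> diamond_norm (2 ^ (m + k + n))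
              (\<lambda>\<rho>. Cchan (m + k) n (b + k) (enlarge n k U1) \<rho> - Cchan (m + k) n (b + k) (enlarge n k U2) \<rho>)"
    by (rule main(1))
  show "diamond_norm (2 ^ (m + k + n))
              (\<lambda>\<rho>. Cchan (m + k) n (b + k) (enlarge n k U1) \<rho> - Cchan (m + k) n (b + k) (enlarge n k U2) \<rho>)
         \<le> diamond_norm (2 ^ n) (\<lambda>\<rho>. Qchan m n b U1 \<rho> - Qchan m n b U2 \<rho>) + \<epsilon>"
    using main(2) mixing_error_le[OF \<epsilon>, of m] by linarith
qed simp

end
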